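(* Let $m\ge 1$. In terms of any initial function $f(\zeta,0)=\sum_{j=1}^{m+1}a_j(0)\zeta^j$ (with $a_1(0)>0$ and $a_{m+1}(0)\ne 0$), let $M>0$ be a common upper bound for $|M_1|,\dots,|M_m|$ and $\sqrt{N_0(0)}$. Then, for any $\varepsilon>0$, there exists a number $B=B(\varepsilon,M,m)>0$ such that whenever $a_1(0)>B$ the polynomial solution $f(\zeta,t)=\sum_{j=1}^{m+1}a_j(t)\zeta^j$ of the Polubarinova-Galin equation starting with $f(\zeta,0)$ is global in time (it exists as a locally univalent solution for all $0\le t<\infty$) and the following assertions (i)-(iii) hold for $1\le k\le m$. (i) For a suitable ordering of the $\tilde\omega_k(t)$ and $\hat\omega_k$ we have $|\tilde\omega_k(t)-\hat\omega_k|<\varepsilon$ for $0\le t<\infty$. In particular the roots $\omega_k$ never collide (with $\varepsilon>0$ sufficiently small). (ii) $|\tilde\omega_k(t)-\hat\omega_k|\to 0$ as $t\to\infty$. (iii) The roots $\omega_k(t)$ move away from the origin (for all $t\ge 0$). Here $\omega_1(t),\dots,\omega_m(t)$ are the zeros of $f'(\zeta,t)$, $\tilde\omega_k(t)=\omega_k(t)\,a_1(t)^{-\frac{m+2}{m}}$ are the rescaled zeros, and $\hat\omega_1,\dots,\hat\omega_m$ are the $m$ distinct $m$-th roots of $-\frac{1}{(m+1)\overline{M_m}}$.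
   Context: $\mathbb{D}$ is the open unit disk; dot denotes $\partial/\partial t$ and prime denotes $\partial/\partial\zeta$. A locally univalent solution is a family $f(\cdot,t)$, analytic in a neighborhood of $\overline{\mathbb{D}}$ and depending smoothly on $t$, with $f(0,t)=0$, $f'(0,t)=a_1(t)>0$, $f'(\zeta,t)\ne 0$ for $\zeta\in\overline{\mathbb{D}}$, satisfying the Polubarinova-Galin equation $\operatorname{Re}[\dot f(\zeta,t)\overline{\zeta f'(\zeta,t)}]=q(t)$ for $\zeta\in\partial\mathbb{D}$. Here $q$ is a given continuous function with $q(t)>0$ and $Q(t)=\int_0^t q(s)\,ds\to\infty$ as $t\to\infty$. The harmonic moments are $M_k=\frac{1}{2\pi i}\int_{\partial\mathbb{D}}f(\zeta,t)^k f^*(\zeta,t)f'(\zeta,t)\,d\zeta$ with $f^*(\zeta,t)=\overline{f(1/\bar\zeta,t)}$; for $k\ge 1$ they are independent of $t$ under the evolution, and $M_m=a_1^{m+1}\overline{a_{m+1}}\neq 0$. Also $N_0(t)=\sum_{j=2}^{m+1}j|a_j(t)|^2$. That a root $\omega_k(t)$ moves away from the origin means $\frac{d}{dt}\log|\omega_k(t)|>0$.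
   Formalization: With B=B(ε,M,m) only, (i), non-collision and (iii) fail as M_m→0 (m=2, a_3→0); they are proved for a_1(0) above a bound that also depends on a lower bound δ for |M_m| (for every m, even m=1); global existence and (ii) keep B(ε,M,m). *)

theory Defs
  imports "HOL-Complex_Analysis.Complex_Analysis"
begin

(* q is only used on [0, \<infinity>). *)
definition admissible_source :: "(real \<Rightarrow> real) \<Rightarrow> bool" where
  "admissible_source q \<longleftrightarrow>
     continuous_on {0..} q \<and> (\<forall>t\<ge>0. q t > 0) \<and>
     filterlim (\<lambda>t. integral {0..t} q) at_top at_top"

(* A family f(\<zeta>,t), t in the time interval I, written f \<zeta> t.  Since q is merely continuous,
   "smooth in t" means continuously differentiable; at an end point of I the time derivative
   is the one-sided one. *)
definition locally_univalent_solution ::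
    "(real \<Rightarrow> real) \<Rightarrow> real set \<Rightarrow> (complex \<Rightarrow> real \<Rightarrow> complex) \<Rightarrow> bool" where
  "locally_univalent_solution q I f \<longleftrightarrow>
     (\<forall>t\<in>I. (\<lambda>z. f z t) analytic_on cball 0 1 \<and>
        f 0 t = 0 \<and>
        deriv (\<lambda>z. f z t) 0 \<in> \<real> \<and> Re (deriv (\<lambda>z. f z t) 0) > 0 \<and>
        (\<forall>\<zeta>\<in>cball 0 1. deriv (\<lambda>z. f z t) \<zeta> \<noteq> 0)) \<and>
     (\<forall>\<zeta>\<in>cball 0 1. \<forall>t\<in>I. (\<lambda>s. f \<zeta> s) differentiable (at t within I)) \<and>
     continuous_on (cball 0 1 \<times> I)
       (\<lambda>(\<zeta>, t). vector_derivative (\<lambda>s. f \<zeta> s) (at t within I)) \<and>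
     (\<forall>t\<in>I. \<forall>\<zeta>\<in>sphere 0 1.
        Re (vector_derivative (\<lambda>s. f \<zeta> s) (at t within I) * cnj (\<zeta> * deriv (\<lambda>z. f z t) \<zeta>)) = q t)"

definition harmonic_moment :: "nat \<Rightarrow> (complex \<Rightarrow> complex) \<Rightarrow> complex" where
  "harmonic_moment k f =
     1 / (2 * of_real pi * \<i>) *
     contour_integral (circlepath 0 1) (\<lambda>\<zeta>. f \<zeta> ^ k * cnj (f (1 / cnj \<zeta>)) * deriv f \<zeta>)"

definition polynomial_map :: "nat \<Rightarrow> (nat \<Rightarrow> complex) \<Rightarrow> complex \<Rightarrow> complex" where
  "polynomial_map m a \<zeta> = (\<Sum>j=1..m+1. a j * \<zeta> ^ j)"

definition polynomial_family :: "nat \<Rightarrow> (nat \<Rightarrow> real \<Rightarrow> complex) \<Rightarrow> complex \<Rightarrow> real \<Rightarrow> complex" where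
  "polynomial_family m a \<zeta> t = polynomial_map m (\<lambda>j. a j t) \<zeta>"

definition N0 :: "nat \<Rightarrow> (nat \<Rightarrow> complex) \<Rightarrow> real" where
  "N0 m a = (\<Sum>j=2..m+1. real j * (cmod (a j))\<^sup>2)"

definition initial_data :: "nat \<Rightarrow> (nat \<Rightarrow> complex) \<Rightarrow> bool" where
  "initial_data m a0 \<longleftrightarrow> a0 1 \<in> \<real> \<and> Re (a0 1) > 0 \<and> a0 (m + 1) \<noteq> 0"

definition moment_bound :: "nat \<Rightarrow> (nat \<Rightarrow> complex) \<Rightarrow> real \<Rightarrow> bool" where
  "moment_bound m a0 M \<longleftrightarrow>
     (\<forall>k\<in>{1..m}. cmod (harmonic_moment k (polynomial_map m a0)) \<le> M) \<and> sqrt (N0 m a0) \<le> M"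

definition global_polynomial_solution ::
    "(real \<Rightarrow> real) \<Rightarrow> nat \<Rightarrow> (nat \<Rightarrow> complex) \<Rightarrow> (nat \<Rightarrow> real \<Rightarrow> complex) \<Rightarrow> bool" where
  "global_polynomial_solution q m a0 a \<longleftrightarrow>
     locally_univalent_solution q {0..} (polynomial_family m a) \<and> (\<forall>j\<in>{1..m+1}. a j 0 = a0 j)"

(* \<omega> 1 t, ..., \<omega> m t are all the zeros of f'(\<cdot>,t) in the complex plane, with multiplicity. *)
definition zeros_of_derivative ::
    "nat \<Rightarrow> (nat \<Rightarrow> real \<Rightarrow> complex) \<Rightarrow> (nat \<Rightarrow> real \<Rightarrow> complex) \<Rightarrow> bool" where
  "zeros_of_derivative m a \<omega> \<longleftrightarrow>
     (\<forall>t\<ge>0. a (m + 1) t \<noteq> 0 \<and>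
        (\<forall>\<zeta>. deriv (\<lambda>z. polynomial_family m a z t) \<zeta> =
               of_nat (m + 1) * a (m + 1) t * (\<Prod>k=1..m. \<zeta> - \<omega> k t)))"

definition rescaled_zero ::
    "nat \<Rightarrow> (nat \<Rightarrow> real \<Rightarrow> complex) \<Rightarrow> (nat \<Rightarrow> real \<Rightarrow> complex) \<Rightarrow> nat \<Rightarrow> real \<Rightarrow> complex" where
  "rescaled_zero m a \<omega> k t =
     \<omega> k t * of_real (Re (a 1 t) powr (- ((real m + 2) / real m)))"

(* The moments are constants of motion, so M_m is evaluated on the initial function. *)
definition limit_zeros :: "nat \<Rightarrow> (nat \<Rightarrow> complex) \<Rightarrow> (nat \<Rightarrow> complex) \<Rightarrow> bool" where
  "limit_zeros m a0 \<omega>h \<longleftrightarrow>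
     bij_betw \<omega>h {1..m}
       {z. z ^ m = - 1 / (of_nat (m + 1) * cnj (harmonic_moment m (polynomial_map m a0)))}"

definition moves_away_from_origin :: "(real \<Rightarrow> complex) \<Rightarrow> bool" where
  "moves_away_from_origin w \<longleftrightarrow>
     (\<forall>t\<ge>0. \<exists>d>0. ((\<lambda>s. ln (cmod (w s))) has_real_derivative d) (at t within {0..}))"

(* On the bounds B and B' in the theorem: an upper bound M on the moments gives a threshold B for
   global existence and for the asymptotics of the zeros, but closeness of the rescaled zeros
   for all t >= 0, and their monotone motion, cannot be uniform as M_m tends to 0.
   For m = 2 and real coefficients the rescaled zeros have sum -2 a_1 a_2 / (3 M_2) and the
   limit points have sum 0; letting a_3 -> 0 with a_1, a_2 fixed makes M_2 = a_1^3 a_3 -> 0 while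
   all upper bounds persist.  The threshold B' therefore also depends on a lower bound \<delta>
   for |M_m|, which every admissible initial function has. *)

end

theory Submission
  imports Defs "HOL-Computational_Algebra.Fundamental_Theorem_Algebra"
begin

text \<open>
  For a polynomial solution the Polubarinova-Galin equation says exactly that \<open>M\<^sub>k\<close> is constant for
  \<open>1 \<le> k \<le> m\<close> and that \<open>M\<^sub>0\<close> grows at the rate \<open>2 q\<close>.  With \<open>b\<^sub>j = a\<^sub>1 ^ j * cnj a\<^sub>j\<close> and \<open>y = 1 / a\<^sub>1\<^sup>2\<close>
  the moment equations read \<open>b\<^sub>j = M\<^bsub>j-1\<^esub> - y * (polynomial in y, b, cnj b)\<close>, a contraction for small \<open>y\<close>.
  Treating \<open>cnj b\<close> as an independent unknown \<open>c\<close> makes the fixed point holomorphic in \<open>y\<close>, so all polynomials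
  with the given moments and small \<open>N\<^sub>0\<close> lie on one smooth curve parametrized by \<open>y\<close>.  A solution cannot
  leave it, because \<open>N\<^sub>0 \<le> 4 M\<^sup>2\<close> improves itself to \<open>N\<^sub>0 < M\<^sup>2\<close> when \<open>a\<^sub>1\<close> is large.  On the curve
  \<open>M\<^sub>0 = 1 / y + O(1)\<close> is strictly decreasing in \<open>y\<close>, which determines \<open>y\<close> as a function of \<open>t\<close>; this gives
  existence and \<open>y' < 0\<close>.  With \<open>s = y powr (1 / m)\<close> the rescaled zeros are the roots of
  \<open>1 + (\<Sum>i=1..<m. g\<^sub>i s * z ^ i) + (m + 1) * cnj M\<^sub>m * z ^ m\<close> with \<open>g\<^sub>i s = O(s)\<close>, and
  \<open>ln \<bar>\<omega>\<^sub>k\<bar> = ln \<bar>z\<^sub>k s\<bar> - (m + 2) / 2 * ln s\<close>, where the last term dominates the derivative.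
\<close>

text \<open>The threshold for a_1(0) must be chosen before q and the initial data. Hence
  \<open>contraction_radius\<close>, \<open>a_priori_radius\<close> and
  \<open>roots_controlled\<close> are predicates on constants with the data quantified inside, and
  the constants of \<open>moment_branch\<close> are obtained before the moments. The conclusion
  concerns every global solution, not only a constructed one. So arbitrary solutions are placed on
  the curve, and existence and asymptotics both reduce to the scalar equation
  \<open>branch_energy m c y = E t\<close>, where E is the known value of M_0. A lower bound on M_m
  enters only through the zeros: their rescaled equation has leading coefficient (m+1) cnj M_m, and
  a small leading coefficient lets roots escape to infinity. \<open>roots_controlled\<close> is
  therefore applied twice: with the uniform bound (m+1) \<delta> for the statements valid at all
  times, and with the actual modulus of the leading coefficient for the limit t -> infinity, where
  the waiting time may depend on the data.\<close>

section \<open>A truncated coefficient norm on polynomials\<close>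

definition trunc_norm :: "nat \<Rightarrow> complex poly \<Rightarrow> real" where
  "trunc_norm N p = (\<Sum>i\<le>N. cmod (coeff p i))"

lemma trunc_norm_nonneg: "0 \<le> trunc_norm N p"
  by (simp add: trunc_norm_def sum_nonneg)

lemma cmod_coeff_le_trunc_norm: "n \<le> N \<Longrightarrow> cmod (coeff p n) \<le> trunc_norm N p"
  unfolding trunc_norm_def by (rule member_le_sum) auto

lemma trunc_norm_add: "trunc_norm N (p + q) \<le> trunc_norm N p + trunc_norm N q"
  unfolding trunc_norm_def sum.distrib [symmetric]
  by (rule sum_mono) (simp add: norm_triangle_ineq)

lemma trunc_norm_0 [simp]: "trunc_norm N 0 = 0"
  by (simp add: trunc_norm_def)

lemma trunc_norm_sum: "trunc_norm N (sum f A) \<le> (\<Sum>x\<in>A. trunc_norm N (f x))"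
proof (induction A rule: infinite_finite_induct)
  case (insert x F)
  then show ?case using trunc_norm_add[of N "f x" "sum f F"] by simp
qed auto

lemma trunc_norm_monom: "trunc_norm N (monom c n) \<le> cmod c"
proof -
  have "trunc_norm N (monom c n) = (\<Sum>i\<le>N. if i = n then cmod c else 0)"
    unfolding trunc_norm_def by (rule sum.cong) auto
  then show ?thesis by (simp add: sum.delta)
qed

lemma trunc_norm_one: "trunc_norm N 1 = 1"
proof -
  have "trunc_norm N 1 = (\<Sum>i\<le>N. if i = 0 then 1 else 0)"
    unfolding trunc_norm_def by (rule sum.cong) (auto simp: coeff_1)
  then show ?thesis by simp
qed

text \<open>A coefficient of degree n <= N of a product involves only indices up to N, so the
  triangle i + j <= N sits inside the square. Truncation thus keeps the l1 norm submultiplicative,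
  and powers can be bounded without tracking their degrees; the moments see only degrees up to m +
  1.\<close>

lemma trunc_norm_mult: "trunc_norm N (p * q) \<le> trunc_norm N p * trunc_norm N q"
proof -
  have "trunc_norm N (p * q) \<le> (\<Sum>n\<le>N. \<Sum>i\<le>n. cmod (coeff p i) * cmod (coeff q (n - i)))"
    unfolding trunc_norm_def coeff_mult
    by (intro sum_mono order.trans[OF norm_sum] eq_refl) (simp add: norm_mult)
  also have "\<dots> = (\<Sum>(i,j)\<in>{(i,j). i + j \<le> N}. cmod (coeff p i) * cmod (coeff q j))"
    by (simp add: sum.triangle_reindex_eq)
  also have "\<dots> \<le> (\<Sum>(i,j)\<in>{..N} \<times> {..N}. cmod (coeff p i) * cmod (coeff q j))"
    by (rule sum_mono2) auto
  also have "\<dots> = trunc_norm N p * trunc_norm N q"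
    by (simp add: trunc_norm_def sum_product sum.cartesian_product)
  finally show ?thesis .
qed

lemma trunc_norm_power: "trunc_norm N (p ^ k) \<le> trunc_norm N p ^ k"
proof (induction k)
  case (Suc k)
  have "trunc_norm N (p ^ Suc k) \<le> trunc_norm N p * trunc_norm N (p ^ k)"
    using trunc_norm_mult by simp
  also have "\<dots> \<le> trunc_norm N p * trunc_norm N p ^ k"
    by (intro mult_left_mono Suc trunc_norm_nonneg)
  finally show ?case by simp
qed (simp add: trunc_norm_one)

text \<open>The Lipschitz bound for the power map, by telescoping. It yields the contraction and,
  with q a monomial, the size of the off-diagonal terms in the a priori bound.\<close>

lemma trunc_norm_power_diff:
  assumes "trunc_norm N p \<le> W" "trunc_norm N q \<le> W"
  shows "trunc_norm N (p ^ k - q ^ k) \<le> real k * W ^ (k - 1) * trunc_norm N (p - q)"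
proof (induction k)
  case (Suc k)
  have W: "0 \<le> W" using assms(1) trunc_norm_nonneg order.trans by blast
  have "p ^ Suc k - q ^ Suc k = p ^ k * (p - q) + (p ^ k - q ^ k) * q"
    by (simp add: algebra_simps)
  then have "trunc_norm N (p ^ Suc k - q ^ Suc k)
      \<le> trunc_norm N (p ^ k * (p - q)) + trunc_norm N ((p ^ k - q ^ k) * q)"
    using trunc_norm_add by simp
  also have "\<dots> \<le> trunc_norm N (p ^ k) * trunc_norm N (p - q)
      + trunc_norm N (p ^ k - q ^ k) * trunc_norm N q"
    by (intro add_mono trunc_norm_mult)
  also have "\<dots> \<le> W ^ k * trunc_norm N (p - q)
      + real k * W ^ (k - 1) * trunc_norm N (p - q) * W"
  proof (intro add_mono mult_mono Suc assms trunc_norm_nonneg mult_nonneg_nonneg)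
    show "trunc_norm N (p ^ k) \<le> W ^ k"
      using trunc_norm_power power_mono[OF assms(1) trunc_norm_nonneg] order.trans by blast
  qed (use W in auto)
  \<comment> \<open>For k = 0 the exponent \<open>k - 1\<close> truncates to 0; the factor
    \<open>real k\<close> removes that term.\<close>
  also have "\<dots> = real (Suc k) * W ^ (Suc k - 1) * trunc_norm N (p - q)"
    by (cases k) (auto simp: algebra_simps)
  finally show ?case .
qed simp

section \<open>Moments of polynomial maps and their scaling\<close>

definition coeff_poly :: "nat \<Rightarrow> (nat \<Rightarrow> complex) \<Rightarrow> complex poly" where
  "coeff_poly m a = (\<Sum>j=1..m+1. monom (a j) j)"

lemma coeff_coeff_poly: "coeff (coeff_poly m a) n = (if n \<in> {1..m+1} then a n else 0)"
proof -
  have "coeff (coeff_poly m a) n = (\<Sum>j=1..m+1. if j = n then a j else 0)"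
    by (simp add: coeff_poly_def coeff_sum)
  also have "\<dots> = (if n \<in> {1..m+1} then a n else 0)"
    by (subst sum.delta) auto
  finally show ?thesis .
qed

lemma poly_coeff_poly: "poly (coeff_poly m a) z = polynomial_map m a z"
  by (simp add: coeff_poly_def polynomial_map_def poly_sum poly_monom)

lemma pderiv_sum: "pderiv (sum f A) = (\<Sum>x\<in>A. pderiv (f x))"
  using higher_pderiv_sum [of 1 f A] by simp

lemma poly_pderiv_coeff_poly: "poly (pderiv (coeff_poly m a)) z = (\<Sum>j=1..m+1. of_nat j * a j * z ^ (j - 1))"
  by (simp add: coeff_poly_def pderiv_sum poly_sum pderiv_monom poly_monom del: sum.cl_ivl_Suc)

text \<open>Divisibility by X makes \<open>p ^ k\<close> start at degree k. Hence the sum for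
  M_(j-1) starts with the term n = j, whose coefficient \<open>a 1 ^ j\<close> isolates b_j.\<close>

lemma coeff_power_of_coeff_0:
  fixes p :: "complex poly"
  assumes "coeff p 0 = 0"
  shows "n < k \<Longrightarrow> coeff (p ^ k) n = 0" and "coeff (p ^ k) k = coeff p 1 ^ k"
proof -
  obtain q where p: "p = monom 1 1 * q"
    using assms by (cases p) (auto simp: monom_altdef)
  have "p ^ k = monom 1 k * q ^ k"
    by (simp add: p power_mult_distrib monom_power)
  then show "n < k \<Longrightarrow> coeff (p ^ k) n = 0" and "coeff (p ^ k) k = coeff p 1 ^ k"
    by (simp_all add: coeff_monom_mult p coeff_0_power)
qed

text \<open>
  Integrating \<open>f ^ k * f' = (f ^ (k + 1))' / (k + 1)\<close> against the coefficients of \<open>f\<^sup>*\<close> gives this form of \<open>M\<^sub>k\<close>.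
\<close>

definition moment :: "nat \<Rightarrow> nat \<Rightarrow> (nat \<Rightarrow> complex) \<Rightarrow> complex" where
  "moment m k a =
     (\<Sum>n=1..m+1. of_nat n * coeff (coeff_poly m a ^ (k+1)) n * cnj (a n)) / of_nat (k+1)"

definition scaled_poly :: "nat \<Rightarrow> complex \<Rightarrow> (nat \<Rightarrow> complex) \<Rightarrow> complex poly" where
  "scaled_poly m y c = monom 1 1 + (\<Sum>j=2..m+1. monom (y * c j) j)"

lemma coeff_scaled_poly:
  "coeff (scaled_poly m y c) n = (if n = 1 then 1 else if n \<in> {2..m+1} then y * c n else 0)"
proof -
  have "coeff (scaled_poly m y c) n = (if n = 1 then 1 else 0) + (\<Sum>j=2..m+1. if j = n then y * c j else 0)"
    by (simp add: scaled_poly_def coeff_sum)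
  also have "(\<Sum>j=2..m+1. if j = n then y * c j else 0) = (if n \<in> {2..m+1} then y * c n else 0)"
    by (subst sum.delta) auto
  finally show ?thesis by auto
qed

text \<open>
  Here \<open>y = 1 / r\<^sup>2\<close>, \<open>b j = r ^ j * cnj (a j)\<close> and \<open>c j = r ^ j * a j\<close> for a polynomial with \<open>a 1 = r\<close>, as in
  \<open>moment_scaling\<close>; the powers of \<open>r\<close> come from the substitution \<open>\<zeta> \<mapsto> r * \<zeta>\<close>, under which the
  polynomial becomes \<open>r\<^sup>2\<close> times \<open>scaled_poly m y c\<close>.
\<close>

definition moment_fixpoint_map :: "nat \<Rightarrow> (nat \<Rightarrow> complex) \<Rightarrow> complex \<Rightarrow> (nat \<Rightarrow> complex) \<Rightarrow> (nat \<Rightarrow> complex) \<Rightarrow> nat \<Rightarrow> complex" where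
  "moment_fixpoint_map m \<mu> y b c j = \<mu> (j - 1) -
     (\<Sum>n=j+1..m+1. of_nat n / of_nat j * y ^ (n - j) * b n * coeff (scaled_poly m y c ^ j) n)"

text \<open>Since \<open>R ^ (2 * n) * y ^ (n - j) = R ^ (2 * j)\<close>, the substitution cancels
  every power of r except y^(n-j). Stated as an equality of differences, it serves both directions:
  prescribed moments give a fixed point, and a fixed point has the prescribed moments.\<close>

lemma moment_scaling:
  assumes r: "r > 0" and a1: "a 1 = of_real r" and j: "j \<in> {2..m+1}"
  defines "b \<equiv> \<lambda>j. of_real r ^ j * cnj (a j)" and "c \<equiv> \<lambda>j. of_real r ^ j * a j"
    and "y \<equiv> of_real (1 / r\<^sup>2)"
  shows "moment m (j - 1) a - \<mu> (j - 1) = b j - moment_fixpoint_map m \<mu> y b c j"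
proof -
  define R :: complex where "R = of_real r"
  have R0: "R \<noteq> 0" using r by (simp add: R_def)
  have yR: "y * R\<^sup>2 = 1" using r by (simp add: y_def R_def)
  have pc: "pcompose (coeff_poly m a) [:0, R:] = smult (R\<^sup>2) (scaled_poly m y c)"
  proof (rule poly_eqI)
    fix n
    consider "n = 0" | "n = 1" | "n \<in> {2..m+1}" | "n > m+1" by force
    then show "coeff (pcompose (coeff_poly m a) [:0, R:]) n = coeff (smult (R\<^sup>2) (scaled_poly m y c)) n"
      using yR a1 by cases (auto simp: coeff_pcompose_linear pcompose_coeff_0 poly_0_coeff_0 coeff_coeff_poly coeff_scaled_poly a1 R_def c_def
            power2_eq_square mult.assoc mult.commute mult.left_commute)
  qed
  have "pcompose (coeff_poly m a ^ j) [:0, R:] = smult (R ^ (2 * j)) (scaled_poly m y c ^ j)"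
  proof -
    have "pcompose (coeff_poly m a ^ j) [:0, R:] = (pcompose (coeff_poly m a) [:0, R:]) ^ j"
      by (induction j) (simp_all add: pcompose_mult pcompose_1)
    then show ?thesis by (simp add: pc smult_power power_mult)
  qed
  then have cp: "R ^ n * coeff (coeff_poly m a ^ j) n = R ^ (2 * j) * coeff (scaled_poly m y c ^ j) n" for n
    by (metis coeff_pcompose_linear coeff_smult)
  have trm: "of_nat n * coeff (coeff_poly m a ^ j) n * cnj (a n)
      = of_nat n * y ^ (n - j) * b n * coeff (scaled_poly m y c ^ j) n" if "n \<ge> j" for n
  proof -
    have e: "R ^ (2 * n) * y ^ (n - j) = R ^ (2 * j)"
    proof -
      have "R ^ (2 * n) = R ^ (2 * j) * (R\<^sup>2) ^ (n - j)"
        using that by (metis le_add_diff_inverse power_add power_mult)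
      then show ?thesis using yR by (simp add: power_mult_distrib [symmetric] mult.assoc mult.commute)
    qed
    have "R ^ (2*n) * (coeff (coeff_poly m a ^ j) n * cnj (a n))
       = (R ^ n * coeff (coeff_poly m a ^ j) n) * (R ^ n * cnj (a n))"
      unfolding mult_2 power_add by (simp add: mult_ac)
    also have "\<dots> = R ^ (2 * j) * coeff (scaled_poly m y c ^ j) n * b n"
      unfolding cp by (simp add: b_def R_def)
    also have "\<dots> = R ^ (2*n) * (y ^ (n - j) * b n * coeff (scaled_poly m y c ^ j) n)"
      unfolding e [symmetric] by (simp only: mult_ac)
    finally show ?thesis using R0 by (simp add: mult_ac)
  qed
  have "(\<Sum>n=1..m+1. of_nat n * coeff (coeff_poly m a ^ j) n * cnj (a n))
      = (\<Sum>n=j..m+1. of_nat n * coeff (coeff_poly m a ^ j) n * cnj (a n))"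
    using j by (intro sum.mono_neutral_right) (auto simp: coeff_power_of_coeff_0 coeff_coeff_poly)
  also have "\<dots> = (\<Sum>n=j..m+1. of_nat n * y ^ (n - j) * b n * coeff (scaled_poly m y c ^ j) n)"
    by (rule sum.cong) (auto simp: trm)
  also have "\<dots> = of_nat j * b j + (\<Sum>n=j+1..m+1. of_nat n * y ^ (n - j) * b n * coeff (scaled_poly m y c ^ j) n)"
    using j by (subst sum.atLeast_Suc_atMost) (auto simp: coeff_power_of_coeff_0 coeff_scaled_poly)
  finally have "moment m (j - 1) a = b j + (\<Sum>n=j+1..m+1. of_nat n * y ^ (n - j) * b n * coeff (scaled_poly m y c ^ j) n) / of_nat j"
    using j by (simp add: moment_def add_divide_distrib)
  then show ?thesis
    by (simp add: moment_fixpoint_map_def sum_divide_distrib del: sum.cl_ivl_Suc)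
qed

section \<open>The contraction for the scaled coefficients\<close>

lemma trunc_norm_scaled_poly:
  assumes "cmod y \<le> 1" "\<And>i. i \<in> {2..m+1} \<Longrightarrow> cmod (c i) \<le> K"
  shows "trunc_norm N (scaled_poly m y c) \<le> 1 + real m * K"
proof -
  have "trunc_norm N (scaled_poly m y c) \<le> trunc_norm N (monom 1 1) + (\<Sum>j=2..m+1. trunc_norm N (monom (y * c j) j))"
    unfolding scaled_poly_def by (rule order.trans[OF trunc_norm_add add_left_mono[OF trunc_norm_sum]])
  also have "\<dots> \<le> 1 + (\<Sum>j=2..m+1. K)"
  proof (intro add_mono sum_mono)
    show "trunc_norm N (monom 1 1) \<le> 1" using trunc_norm_monom [of N 1 1] by simp
    fix j assume "j \<in> {2..m+1}"
    then have "cmod y * cmod (c j) \<le> 1 * K"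
      using assms by (intro mult_mono) auto
    then show "trunc_norm N (monom (y * c j) j) \<le> K"
      using trunc_norm_monom [of N "y * c j" j] by (simp add: norm_mult)
  qed
  finally show ?thesis by simp
qed

lemma trunc_norm_scaled_poly_diff:
  assumes "cmod y \<le> 1" "\<And>i. i \<in> {2..m+1} \<Longrightarrow> cmod (c i - c' i) \<le> D"
  shows "trunc_norm N (scaled_poly m y c - scaled_poly m y c') \<le> real m * D"
proof -
  have "scaled_poly m y c - scaled_poly m y c' = (\<Sum>j=2..m+1. monom (y * (c j - c' j)) j)"
    by (simp add: scaled_poly_def sum_subtractf [symmetric] diff_monom right_diff_distrib del: sum.cl_ivl_Suc)
  then have "trunc_norm N (scaled_poly m y c - scaled_poly m y c')
      \<le> (\<Sum>j=2..m+1. trunc_norm N (monom (y * (c j - c' j)) j))"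
    by (simp only: trunc_norm_sum)
  also have "\<dots> \<le> (\<Sum>j=2..m+1. D)"
  proof (intro sum_mono)
    fix j assume "j \<in> {2..m+1}"
    then have "cmod y * cmod (c j - c' j) \<le> 1 * D"
      using assms by (intro mult_mono) auto
    then show "trunc_norm N (monom (y * (c j - c' j)) j) \<le> D"
      using trunc_norm_monom [of N "y * (c j - c' j)" j] by (simp add: norm_mult)
  qed
  finally show ?thesis by simp
qed

text \<open>The first clause keeps the ball of radius 2 M invariant when |\<mu>| <= M, the second
  gives contraction by 1/2 in the maximum norm. The moments \<mu> are quantified inside because they
  enter the map only additively, so one \<rho> serves all data with the same M. The parameter y is
  complex, as holomorphy in y is wanted.\<close>

definition contraction_radius :: "nat \<Rightarrow> real \<Rightarrow> real \<Rightarrow> bool" where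
  "contraction_radius m M \<rho> \<longleftrightarrow> 0 < \<rho> \<and> \<rho> \<le> 1 \<and>
     (\<forall>y \<mu> b c. cmod y < \<rho> \<and> (\<forall>i\<in>{2..m+1}. cmod (b i) \<le> 2 * M \<and> cmod (c i) \<le> 2 * M) \<longrightarrow>
        (\<forall>j\<in>{2..m+1}. cmod (moment_fixpoint_map m \<mu> y b c j - \<mu> (j - 1)) \<le> M)) \<and>
     (\<forall>y \<mu> b c b' c' D. cmod y < \<rho> \<and> (\<forall>i\<in>{2..m+1}. cmod (b i) \<le> 2 * M \<and> cmod (c i) \<le> 2 * M) \<and>
        (\<forall>i\<in>{2..m+1}. cmod (b' i) \<le> 2 * M \<and> cmod (c' i) \<le> 2 * M) \<and>
        (\<forall>i\<in>{2..m+1}. cmod (b i - b' i) \<le> D \<and> cmod (c i - c' i) \<le> D) \<longrightarrow>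
        (\<forall>j\<in>{2..m+1}. cmod (moment_fixpoint_map m \<mu> y b c j - moment_fixpoint_map m \<mu> y b' c' j) \<le> D / 2))"

text \<open>The sum in the map starts at n = j + 1, so every term keeps a factor y; this factor is
  the only source of smallness in the contraction.\<close>

lemma moment_fixpoint_term_bound:
  assumes "j \<in> {2..m+1}" "n \<in> {j+1..m+1}" "cmod y \<le> 1" "cmod x \<le> C"
  shows "cmod (of_nat n / of_nat j * y ^ (n - j) * x) \<le> cmod y * (real (m+1) * C)"
proof -
  have "n - j = Suc (n - j - 1)" using assms by auto
  then have "cmod y ^ (n - j) = cmod y * cmod y ^ (n - j - 1)" by (metis power_Suc)
  also have "\<dots> \<le> cmod y * 1"
    using assms by (intro mult_left_mono power_le_one) auto
  finally have 1: "cmod y ^ (n - j) \<le> cmod y" by simp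
  have 2: "real n / real j \<le> real (m+1)"
  proof -
    have "real n / real j \<le> real n / 1" using assms by (intro divide_left_mono) auto
    also have "\<dots> \<le> real (m+1)" using assms by simp
    finally show ?thesis .
  qed
  have "cmod (of_nat n / of_nat j * y ^ (n - j) * x) = (real n / real j) * (cmod y ^ (n - j) * cmod x)"
    by (simp add: norm_mult norm_divide norm_power)
  also have "\<dots> \<le> real (m+1) * (cmod y * C)"
    using 1 2 assms by (intro mult_mono) auto
  finally show ?thesis by (simp add: mult_ac)
qed

lemma contraction_radius_exists:
  assumes M: "M > 0"
  shows "\<exists>\<rho>. contraction_radius m M \<rho>"
proof -
  \<comment> \<open>Bounds the norm of \<open>scaled_poly m y c\<close> on the ball |c_i| <= 2
    M.\<close>
  define W where "W = 1 + real m * (2 * M)"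
  have W1: "W \<ge> 1" using M by (simp add: W_def)
  \<comment> \<open>|y| L bounds the Lipschitz constant: in the last factor, 1 accounts for varying
    b and \<open>2 * M * (real (m+1) * real m)\<close> for varying c. The displacement is at most
    |y| L * 2 M, so |y| L <= 1/2 settles both clauses.\<close>
  define L where "L = (real (m+1))\<^sup>2 * (W ^ (m+1) * (1 + 2 * M * (real (m+1) * real m)))"
  have L0: "L > 0" using W1 M by (auto simp: L_def intro!: mult_pos_pos add_pos_nonneg)
  define \<rho> where "\<rho> = min 1 (1 / (2 * L))"
  have \<rho>: "0 < \<rho>" "\<rho> \<le> 1" using L0 by (auto simp: \<rho>_def)
  have yL: "cmod y * L \<le> 1 / 2" if "cmod y < \<rho>" for y :: complex
  proof -
    have "cmod y * L \<le> 1 / (2 * L) * L" using that L0 by (intro mult_right_mono) (auto simp: \<rho>_def)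
    then show ?thesis using L0 by simp
  qed
  let ?J = "{2..m+1}" and ?N = "m + 1"
  have tn: "trunc_norm ?N (scaled_poly m y c) \<le> W" if "cmod y < \<rho>" "\<forall>i\<in>?J. cmod (c i) \<le> 2 * M" for y c
    unfolding W_def using that \<rho> by (intro trunc_norm_scaled_poly) auto
  have cb: "cmod (coeff (scaled_poly m y c ^ j) n) \<le> W ^ (m+1)"
    if "cmod y < \<rho>" "\<forall>i\<in>?J. cmod (c i) \<le> 2 * M" "j \<in> ?J" "n \<le> ?N" for y c j n
  proof -
    have "cmod (coeff (scaled_poly m y c ^ j) n) \<le> trunc_norm ?N (scaled_poly m y c) ^ j"
      using cmod_coeff_le_trunc_norm trunc_norm_power that(4) order.trans by blast
    also have "\<dots> \<le> W ^ j" using tn that by (intro power_mono trunc_norm_nonneg) auto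
    also have "\<dots> \<le> W ^ (m+1)" using that W1 by (intro power_increasing) auto
    finally show ?thesis .
  qed
  have cd: "cmod (coeff (scaled_poly m y c ^ j) n - coeff (scaled_poly m y c' ^ j) n) \<le> real (m+1) * W ^ (m+1) * (real m * D)"
    if "cmod y < \<rho>" "\<forall>i\<in>?J. cmod (c i) \<le> 2 * M" "\<forall>i\<in>?J. cmod (c' i) \<le> 2 * M"
       "\<forall>i\<in>?J. cmod (c i - c' i) \<le> D" "j \<in> ?J" "n \<le> ?N" for y c c' D j n
  proof -
    have D: "0 \<le> D" using that(4,5) norm_ge_zero order.trans by blast
    have "cmod (coeff (scaled_poly m y c ^ j - scaled_poly m y c' ^ j) n)
        \<le> real j * W ^ (j - 1) * trunc_norm ?N (scaled_poly m y c - scaled_poly m y c')"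
      using that(6) tn that by (intro order.trans[OF cmod_coeff_le_trunc_norm trunc_norm_power_diff]) auto
    also have "\<dots> \<le> real (m+1) * W ^ (m+1) * (real m * D)"
      using that W1 \<rho> D
      by (intro mult_mono power_increasing trunc_norm_scaled_poly_diff) (auto simp: trunc_norm_nonneg)
    finally show ?thesis by simp
  qed
  have 1: "cmod (moment_fixpoint_map m \<mu> y b c j - \<mu> (j - 1)) \<le> M"
    if y: "cmod y < \<rho>" and bc: "\<forall>i\<in>?J. cmod (b i) \<le> 2 * M \<and> cmod (c i) \<le> 2 * M" and j: "j \<in> ?J" for \<mu> y b c j
  proof -
    have "cmod (moment_fixpoint_map m \<mu> y b c j - \<mu> (j - 1))
      = cmod (\<Sum>n=j+1..m+1. of_nat n / of_nat j * y ^ (n - j) * (b n * coeff (scaled_poly m y c ^ j) n))"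
      by (simp add: moment_fixpoint_map_def mult.assoc)
    also have "\<dots> \<le> (\<Sum>n=j+1..m+1. cmod y * (real (m+1) * (2 * M * W ^ (m+1))))"
    proof (rule sum_norm_le)
      fix n assume n: "n \<in> {j+1..m+1}"
      have "cmod (b n * coeff (scaled_poly m y c ^ j) n) \<le> 2 * M * W ^ (m+1)"
        unfolding norm_mult using cb[OF y _ j, of c n] bc n j M by (intro mult_mono) auto
      then show "cmod (of_nat n / of_nat j * y ^ (n - j) * (b n * coeff (scaled_poly m y c ^ j) n))
         \<le> cmod y * (real (m+1) * (2 * M * W ^ (m+1)))"
        using j n y \<rho> by (intro moment_fixpoint_term_bound) auto
    qed
    also have "\<dots> \<le> real (m+1) * (cmod y * (real (m+1) * (2 * M * W ^ (m+1))))"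
      using M W1 by (simp only: sum_constant) (intro mult_right_mono, auto)
    also have "\<dots> = (cmod y * ((real (m+1))\<^sup>2 * (W ^ (m+1) * 1))) * (2 * M)"
      by (simp add: power2_eq_square mult_ac)
    also have "\<dots> \<le> (cmod y * L) * (2 * M)"
      unfolding L_def using M W1 by (intro mult_right_mono mult_left_mono) auto
    also have "\<dots> \<le> 1 / 2 * (2 * M)"
      using yL[OF y] M by (intro mult_right_mono) auto
    finally show ?thesis by simp
  qed
  have 2: "cmod (moment_fixpoint_map m \<mu> y b c j - moment_fixpoint_map m \<mu> y b' c' j) \<le> D / 2"
    if y: "cmod y < \<rho>" and bc: "\<forall>i\<in>?J. cmod (b i) \<le> 2 * M \<and> cmod (c i) \<le> 2 * M"
      and bc': "\<forall>i\<in>?J. cmod (b' i) \<le> 2 * M \<and> cmod (c' i) \<le> 2 * M"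
      and bcD: "\<forall>i\<in>?J. cmod (b i - b' i) \<le> D \<and> cmod (c i - c' i) \<le> D" and j: "j \<in> ?J" for \<mu> y b c b' c' j D
  proof -
    have D: "0 \<le> D" using bcD j norm_ge_zero order.trans by blast
    define E where "E = D * W ^ (m+1) + 2 * M * (real (m+1) * W ^ (m+1) * (real m * D))"
    have E0: "0 \<le> E" using D W1 M by (auto simp: E_def)
    have "cmod (moment_fixpoint_map m \<mu> y b c j - moment_fixpoint_map m \<mu> y b' c' j)
      = cmod (\<Sum>n=j+1..m+1. of_nat n / of_nat j * y ^ (n - j) *
          (b' n * coeff (scaled_poly m y c' ^ j) n - b n * coeff (scaled_poly m y c ^ j) n))"
      by (simp add: moment_fixpoint_map_def sum_subtractf [symmetric] algebra_simps del: sum.cl_ivl_Suc)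
    also have "\<dots> \<le> (\<Sum>n=j+1..m+1. cmod y * (real (m+1) * E))"
    proof (rule sum_norm_le)
      fix n assume n: "n \<in> {j+1..m+1}"
      have "b' n * coeff (scaled_poly m y c' ^ j) n - b n * coeff (scaled_poly m y c ^ j) n
         = - ((b n - b' n) * coeff (scaled_poly m y c' ^ j) n
            + b n * (coeff (scaled_poly m y c ^ j) n - coeff (scaled_poly m y c' ^ j) n))"
        by (simp add: algebra_simps)
      also have "cmod \<dots> \<le> E"
        unfolding E_def norm_minus_cancel
      proof (rule norm_triangle_mono)
        show "cmod ((b n - b' n) * coeff (scaled_poly m y c' ^ j) n) \<le> D * W ^ (m+1)"
          unfolding norm_mult using cb[OF y _ j, of c' n] bc' bcD n j M D by (intro mult_mono) auto
        show "cmod (b n * (coeff (scaled_poly m y c ^ j) n - coeff (scaled_poly m y c' ^ j) n))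
          \<le> 2 * M * (real (m+1) * W ^ (m+1) * (real m * D))"
          unfolding norm_mult using cd[OF y _ _ _ j, of c c' D n] bc bc' bcD n j M D by (intro mult_mono) auto
      qed
      finally show "cmod (of_nat n / of_nat j * y ^ (n - j) *
          (b' n * coeff (scaled_poly m y c' ^ j) n - b n * coeff (scaled_poly m y c ^ j) n))
         \<le> cmod y * (real (m+1) * E)"
        using j n y \<rho> by (intro moment_fixpoint_term_bound) auto
    qed
    also have "\<dots> \<le> real (m+1) * (cmod y * (real (m+1) * E))"
      using E0 by (simp only: sum_constant) (intro mult_right_mono, auto)
    also have "\<dots> = (cmod y * L) * D"
      by (simp add: power2_eq_square L_def E_def algebra_simps)
    also have "\<dots> \<le> 1 / 2 * D"
      using yL[OF y] D by (intro mult_right_mono) auto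
    finally show ?thesis by simp
  qed
  show ?thesis
    unfolding contraction_radius_def
  proof (intro exI[of _ \<rho>] conjI allI impI ballI; (elim conjE)?)
  qed (fact \<rho> | rule 1 2; assumption)+
qed

lemma contraction_radius_pos: "contraction_radius m M \<rho> \<Longrightarrow> 0 < \<rho>" "contraction_radius m M \<rho> \<Longrightarrow> \<rho> \<le> 1"
  by (simp_all add: contraction_radius_def)

lemma contraction_radius_bound:
  assumes "contraction_radius m M \<rho>" "cmod y < \<rho>" "\<forall>i\<in>{2..m+1}. cmod (b i) \<le> 2 * M \<and> cmod (c i) \<le> 2 * M" "j \<in> {2..m+1}"
  shows "cmod (moment_fixpoint_map m \<mu> y b c j - \<mu> (j - 1)) \<le> M"
  using assms(1) [unfolded contraction_radius_def, THEN conjunct2, THEN conjunct2, THEN conjunct1, rule_format,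
    of y b c j \<mu>] assms(2-) by simp

lemma contraction_radius_contraction:
  assumes "contraction_radius m M \<rho>" "cmod y < \<rho>" "\<forall>i\<in>{2..m+1}. cmod (b i) \<le> 2 * M \<and> cmod (c i) \<le> 2 * M"
    "\<forall>i\<in>{2..m+1}. cmod (b' i) \<le> 2 * M \<and> cmod (c' i) \<le> 2 * M"
    "\<forall>i\<in>{2..m+1}. cmod (b i - b' i) \<le> D \<and> cmod (c i - c' i) \<le> D" "j \<in> {2..m+1}"
  shows "cmod (moment_fixpoint_map m \<mu> y b c j - moment_fixpoint_map m \<mu> y b' c' j) \<le> D / 2"
  using assms(1) [unfolded contraction_radius_def, THEN conjunct2, THEN conjunct2, THEN conjunct2, rule_format,
    of y b c b' c' D j \<mu>] assms(2-) by simp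

section \<open>The fixed point as a holomorphic function of y\<close>

lemma holomorphic_on_coeff_power:
  assumes "\<And>n. (\<lambda>y. coeff (P y) n) holomorphic_on S"
  shows "(\<lambda>y. coeff (P y ^ k) n) holomorphic_on S"
proof (induction k arbitrary: n)
  case (Suc k)
  then show ?case by (auto simp: coeff_mult intro!: holomorphic_intros assms)
qed simp

lemma tendsto_coeff_power:
  assumes "\<And>n. ((\<lambda>x. coeff (P x) n :: complex) \<longlongrightarrow> coeff p n) F"
  shows "((\<lambda>x. coeff (P x ^ k) n) \<longlongrightarrow> coeff (p ^ k) n) F"
proof (induction k arbitrary: n)
  case (Suc k)
  then show ?case by (auto simp: coeff_mult intro!: tendsto_intros assms)
qed simp

lemma cnj_coeff_power:
  assumes "\<And>n. cnj (coeff p n) = coeff q n"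
  shows "cnj (coeff (p ^ k) n) = coeff (q ^ k) n"
proof (induction k arbitrary: n)
  case (Suc k)
  then show ?case by (simp add: coeff_mult assms)
qed simp

text \<open>Conjugation exchanges the equation for b with the one for c, which carries the conjugate
  moments. Together with uniqueness, this forces the two unknowns to be conjugate at real y.\<close>

lemma cnj_moment_fixpoint_map:
  "cnj (moment_fixpoint_map m \<mu> y b c j) = moment_fixpoint_map m (\<lambda>i. cnj (\<mu> i)) (cnj y) (\<lambda>i. cnj (b i)) (\<lambda>i. cnj (c i)) j"
proof -
  have "cnj (coeff (scaled_poly m y c ^ j) n) = coeff (scaled_poly m (cnj y) (\<lambda>i. cnj (c i)) ^ j) n" for n
    by (rule cnj_coeff_power) (auto simp: coeff_scaled_poly)
  then show ?thesis by (simp add: moment_fixpoint_map_def del: sum.cl_ivl_Suc)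
qed

text \<open>The largest distance D between two solution pairs satisfies D <= D / 2. Used to identify
  a given polynomial with the branch, and to show that b and c are conjugate at real y.\<close>

lemma moment_fixpoint_map_unique:
  assumes \<rho>: "contraction_radius m M \<rho>" and y: "cmod y < \<rho>"
    and b: "\<And>i. i \<in> {2..m+1} \<Longrightarrow> cmod (b i) \<le> 2 * M \<and> cmod (c i) \<le> 2 * M"
    and b': "\<And>i. i \<in> {2..m+1} \<Longrightarrow> cmod (b' i) \<le> 2 * M \<and> cmod (c' i) \<le> 2 * M"
    and fb: "\<And>i. i \<in> {2..m+1} \<Longrightarrow> b i = moment_fixpoint_map m \<mu> y b c i \<and> c i = moment_fixpoint_map m \<nu> y c b i"
    and fb': "\<And>i. i \<in> {2..m+1} \<Longrightarrow> b' i = moment_fixpoint_map m \<mu> y b' c' i \<and> c' i = moment_fixpoint_map m \<nu> y c' b' i"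
    and j: "j \<in> {2..m+1}"
  shows "b j = b' j \<and> c j = c' j"
proof -
  let ?J = "{2..m+1}"
  define d where "d i = max (cmod (b i - b' i)) (cmod (c i - c' i))" for i
  define D where "D = Max (d ` ?J)"
  have dD: "d i \<le> D" if "i \<in> ?J" for i using that by (auto simp: D_def)
  have le: "cmod (b i - b' i) \<le> D \<and> cmod (c i - c' i) \<le> D" if "i \<in> ?J" for i
    using dD[OF that] by (simp add: d_def)
  have "d i \<le> D / 2" if i: "i \<in> ?J" for i
  proof -
    have "cmod (moment_fixpoint_map m \<mu> y b c i - moment_fixpoint_map m \<mu> y b' c' i) \<le> D / 2"
      by (rule contraction_radius_contraction[OF \<rho> y]) (use b b' le i in auto)
    moreover have "cmod (moment_fixpoint_map m \<nu> y c b i - moment_fixpoint_map m \<nu> y c' b' i) \<le> D / 2"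
      by (rule contraction_radius_contraction[OF \<rho> y]) (use b b' le i in auto)
    ultimately show ?thesis using fb[OF i] fb'[OF i] by (simp add: d_def)
  qed
  then have "D \<le> D / 2" unfolding D_def using j by (subst Max_le_iff) auto
  with dD[OF j] have "d j \<le> 0" by simp
  then show ?thesis by (simp add: d_def)
qed

text \<open>Picard iteration from 0 for the pair (b, c). Every iterate is a polynomial in y, hence
  holomorphic, and a uniform limit inherits this.\<close>

primrec moment_iterate :: "nat \<Rightarrow> (nat \<Rightarrow> complex) \<Rightarrow> nat \<Rightarrow> complex \<Rightarrow> (nat \<Rightarrow> complex) \<times> (nat \<Rightarrow> complex)" where
  "moment_iterate m \<mu> 0 y = (\<lambda>_. 0, \<lambda>_. 0)"
| "moment_iterate m \<mu> (Suc N) y =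
     (moment_fixpoint_map m \<mu> y (fst (moment_iterate m \<mu> N y)) (snd (moment_iterate m \<mu> N y)),
      moment_fixpoint_map m (\<lambda>i. cnj (\<mu> i)) y (snd (moment_iterate m \<mu> N y)) (fst (moment_iterate m \<mu> N y)))"

lemma holomorphic_on_moment_fixpoint_map:
  assumes "\<And>i. b i holomorphic_on S" "\<And>i. c i holomorphic_on S"
  shows "(\<lambda>y. moment_fixpoint_map m \<mu> y (\<lambda>i. b i y) (\<lambda>i. c i y) j) holomorphic_on S"
proof -
  have "(\<lambda>y. coeff (scaled_poly m y (\<lambda>i. c i y)) n) holomorphic_on S" for n
    by (cases "n = 1"; cases "n \<in> {2..m+1}") (auto simp: coeff_scaled_poly intro!: holomorphic_intros assms)
  from holomorphic_on_coeff_power[OF this] show ?thesis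
    unfolding moment_fixpoint_map_def by (intro holomorphic_intros assms)
qed

lemma tendsto_moment_fixpoint_map:
  assumes "\<And>i. i \<in> {2..m+1} \<Longrightarrow> (\<lambda>N. b N i) \<longlonglongrightarrow> b' i" "\<And>i. i \<in> {2..m+1} \<Longrightarrow> (\<lambda>N. c N i) \<longlonglongrightarrow> c' i"
    "j \<in> {2..m+1}"
  shows "(\<lambda>N. moment_fixpoint_map m \<mu> y (b N) (c N) j) \<longlonglongrightarrow> moment_fixpoint_map m \<mu> y b' c' j"
proof -
  have "(\<lambda>N. coeff (scaled_poly m y (c N)) n) \<longlonglongrightarrow> coeff (scaled_poly m y c') n" for n
    by (cases "n = 1"; cases "n \<in> {2..m+1}") (auto simp: coeff_scaled_poly intro!: tendsto_intros assms)
  from tendsto_coeff_power[OF this] show ?thesis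
    unfolding moment_fixpoint_map_def using assms(3) by (intro tendsto_intros assms(1)) auto
qed

lemma moment_fixpoint_branch:
  assumes \<rho>: "contraction_radius m M \<rho>" and M: "M > 0" and \<mu>: "\<And>k. k \<in> {1..m} \<Longrightarrow> cmod (\<mu> k) \<le> M"
  obtains b c where
    "\<And>j. j \<in> {2..m+1} \<Longrightarrow> b j holomorphic_on ball 0 \<rho>"
    "\<And>j. j \<in> {2..m+1} \<Longrightarrow> c j holomorphic_on ball 0 \<rho>"
    "\<And>j y. j \<in> {2..m+1} \<Longrightarrow> cmod y < \<rho> \<Longrightarrow> cmod (b j y) \<le> 2 * M \<and> cmod (c j y) \<le> 2 * M"
    "\<And>j y. j \<in> {2..m+1} \<Longrightarrow> cmod y < \<rho> \<Longrightarrow> b j y = moment_fixpoint_map m \<mu> y (\<lambda>i. b i y) (\<lambda>i. c i y) j"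
    "\<And>j y. j \<in> {2..m+1} \<Longrightarrow> cmod y < \<rho> \<Longrightarrow> c j y = moment_fixpoint_map m (\<lambda>i. cnj (\<mu> i)) y (\<lambda>i. c i y) (\<lambda>i. b i y) j"
proof -
  let ?J = "{2..m+1}"
  define B where "B N j y = fst (moment_iterate m \<mu> N y) j" for N j y
  define C where "C N j y = snd (moment_iterate m \<mu> N y) j" for N j y
  have B0: "B 0 j y = 0" "C 0 j y = 0" for j y by (simp_all add: B_def C_def)
  have BS: "B (Suc N) j y = moment_fixpoint_map m \<mu> y (\<lambda>i. B N i y) (\<lambda>i. C N i y) j"
    "C (Suc N) j y = moment_fixpoint_map m (\<lambda>i. cnj (\<mu> i)) y (\<lambda>i. C N i y) (\<lambda>i. B N i y) j" for N j y
    by (simp_all add: B_def C_def)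
  have hol: "(B N j holomorphic_on S) \<and> (C N j holomorphic_on S)" for N j S
  proof (induction N arbitrary: j)
    case 0
    have "B 0 j = (\<lambda>_. 0)" "C 0 j = (\<lambda>_. 0)" using B0 by auto
    then show ?case by simp
  next
    case (Suc N)
    have "B (Suc N) j = (\<lambda>y. moment_fixpoint_map m \<mu> y (\<lambda>i. B N i y) (\<lambda>i. C N i y) j)"
      "C (Suc N) j = (\<lambda>y. moment_fixpoint_map m (\<lambda>i. cnj (\<mu> i)) y (\<lambda>i. C N i y) (\<lambda>i. B N i y) j)"
      using BS by auto
    then show ?case using Suc by (auto intro!: holomorphic_on_moment_fixpoint_map)
  qed
  have e1: "\<And>\<mu> y b c j. cmod y < \<rho> \<Longrightarrow> (\<forall>i\<in>?J. cmod (b i) \<le> 2 * M \<and> cmod (c i) \<le> 2 * M) \<Longrightarrow>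
        j\<in>?J \<Longrightarrow> cmod (moment_fixpoint_map m \<mu> y b c j - \<mu> (j - 1)) \<le> M"
    by (rule contraction_radius_bound[OF \<rho>])
  have bd: "\<forall>j\<in>?J. cmod (B N j y) \<le> 2 * M \<and> cmod (C N j y) \<le> 2 * M" if y: "cmod y < \<rho>" for N y
  proof (induction N)
    case 0
    then show ?case using M by (simp add: B0)
  next
    case (Suc N)
    show ?case
    proof
      fix j assume j: "j \<in> ?J"
      have "cmod (\<mu> (j - 1)) \<le> M" using \<mu>[of "j - 1"] j by force
      moreover have "cmod (B (Suc N) j y - \<mu> (j - 1)) \<le> M"
        unfolding BS using Suc by (intro e1 y j) auto
      moreover have "cmod (C (Suc N) j y - cnj (\<mu> (j - 1))) \<le> M"
        unfolding BS using Suc e1[OF y _ j, of "\<lambda>i. C N i y" "\<lambda>i. B N i y" "\<lambda>i. cnj (\<mu> i)"] by auto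
      ultimately show "cmod (B (Suc N) j y) \<le> 2 * M \<and> cmod (C (Suc N) j y) \<le> 2 * M"
        using norm_triangle_sub[of "B (Suc N) j y" "\<mu> (j - 1)"]
          norm_triangle_sub[of "C (Suc N) j y" "cnj (\<mu> (j - 1))"] by simp
    qed
  qed
  have df: "\<forall>j\<in>?J. cmod (B (Suc N) j y - B N j y) \<le> 2 * M * (1/2) ^ N \<and> cmod (C (Suc N) j y - C N j y) \<le> 2 * M * (1/2)^N"
    if y: "cmod y < \<rho>" for N y
  proof (induction N)
    case 0
    then show ?case using bd[OF y, of 1] by (simp add: B0)
  next
    case (Suc N)
    have e2: "cmod (moment_fixpoint_map m \<mu> y b c j - moment_fixpoint_map m \<mu> y b' c' j) \<le> D / 2" if
      "\<forall>i\<in>?J. cmod (b i) \<le> 2 * M \<and> cmod (c i) \<le> 2 * M"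
      "\<forall>i\<in>?J. cmod (b' i) \<le> 2 * M \<and> cmod (c' i) \<le> 2 * M"
      "\<forall>i\<in>?J. cmod (b i - b' i) \<le> D \<and> cmod (c i - c' i) \<le> D" "j \<in> ?J" for \<mu> b c b' c' j D
      by (rule contraction_radius_contraction[OF \<rho> y that])
    show ?case
    proof
      fix j assume j: "j \<in> ?J"
      have "cmod (B (Suc (Suc N)) j y - B (Suc N) j y) \<le> 2 * M * (1/2) ^ N / 2"
        unfolding BS[of "Suc N"] BS(1)[of N j] using Suc bd[OF y] by (intro e2 j) auto
      moreover have "cmod (C (Suc (Suc N)) j y - C (Suc N) j y) \<le> 2 * M * (1/2) ^ N / 2"
        unfolding BS[of "Suc N"] BS(2)[of N j] using Suc bd[OF y] by (intro e2 j) auto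
      ultimately show "cmod (B (Suc (Suc N)) j y - B (Suc N) j y) \<le> 2 * M * (1/2) ^ Suc N \<and>
         cmod (C (Suc (Suc N)) j y - C (Suc N) j y) \<le> 2 * M * (1/2)^Suc N" by simp
    qed
  qed
  have sm: "summable (\<lambda>N. 2 * M * (1/2) ^ N)"
    by (intro summable_mult summable_geometric) auto
  \<comment> \<open>Writing the limit as a telescoping series turns the geometric decay of the
    increments into uniform convergence by the Weierstrass M-test.\<close>
  define b where "b j y = (\<Sum>N. B (Suc N) j y - B N j y)" for j y
  define c where "c j y = (\<Sum>N. C (Suc N) j y - C N j y)" for j y
  have telB: "(\<Sum>i<N. B (Suc i) j y - B i j y) = B N j y" for N j y
    using sum_lessThan_telescope[of "\<lambda>i. B i j y" N] by (simp add: B0)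
  have telC: "(\<Sum>i<N. C (Suc i) j y - C i j y) = C N j y" for N j y
    using sum_lessThan_telescope[of "\<lambda>i. C i j y" N] by (simp add: B0)
  have ulB: "uniform_limit (ball 0 \<rho>) (\<lambda>N y. B N j y) (b j) sequentially" if "j \<in> ?J" for j
    using Weierstrass_m_test[of "ball 0 \<rho>" "\<lambda>N y. B (Suc N) j y - B N j y", OF _ sm] df that
    unfolding telB b_def by auto
  have ulC: "uniform_limit (ball 0 \<rho>) (\<lambda>N y. C N j y) (c j) sequentially" if "j \<in> ?J" for j
    using Weierstrass_m_test[of "ball 0 \<rho>" "\<lambda>N y. C (Suc N) j y - C N j y", OF _ sm] df that
    unfolding telC c_def by auto
  have limB: "(\<lambda>N. B N j y) \<longlonglongrightarrow> b j y" "(\<lambda>N. C N j y) \<longlonglongrightarrow> c j y" if "j \<in> ?J" "cmod y < \<rho>" for j y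
    using tendsto_uniform_limitI[OF ulB[OF that(1)], of y] tendsto_uniform_limitI[OF ulC[OF that(1)], of y] that by auto
  show ?thesis
  proof (rule that)
    fix j assume j: "j \<in> ?J"
    show "b j holomorphic_on ball 0 \<rho>"
    proof (rule holomorphic_uniform_sequence[of _ "\<lambda>N. B N j"])
      fix x :: complex assume "x \<in> ball 0 \<rho>"
      then show "\<exists>d>0. cball x d \<subseteq> ball 0 \<rho> \<and> uniform_limit (cball x d) (\<lambda>N. B N j) (b j) sequentially"
        using uniform_limit_on_subset[OF ulB[OF j]] open_contains_cball[of "ball (0::complex) \<rho>"] open_ball by blast
    qed (use hol in auto)
    show "c j holomorphic_on ball 0 \<rho>"
    proof (rule holomorphic_uniform_sequence[of _ "\<lambda>N. C N j"])
      fix x :: complex assume "x \<in> ball 0 \<rho>"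
      then show "\<exists>d>0. cball x d \<subseteq> ball 0 \<rho> \<and> uniform_limit (cball x d) (\<lambda>N. C N j) (c j) sequentially"
        using uniform_limit_on_subset[OF ulC[OF j]] open_contains_cball[of "ball (0::complex) \<rho>"] open_ball by blast
    qed (use hol in auto)
  next
    fix j y assume j: "j \<in> ?J" and y: "cmod y < \<rho>"
    show "cmod (b j y) \<le> 2 * M \<and> cmod (c j y) \<le> 2 * M"
      using Lim_bounded[OF tendsto_norm[OF limB(1)[OF j y]], of 0 "2 * M"]
        Lim_bounded[OF tendsto_norm[OF limB(2)[OF j y]], of 0 "2 * M"] bd[OF y] j by blast
    have "(\<lambda>N. B (Suc N) j y) \<longlonglongrightarrow> moment_fixpoint_map m \<mu> y (\<lambda>i. b i y) (\<lambda>i. c i y) j"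
      unfolding BS by (rule tendsto_moment_fixpoint_map) (use limB j y in auto)
    then show "b j y = moment_fixpoint_map m \<mu> y (\<lambda>i. b i y) (\<lambda>i. c i y) j"
      using LIMSEQ_unique limB(1)[OF j y] LIMSEQ_Suc by blast
    have "(\<lambda>N. C (Suc N) j y) \<longlonglongrightarrow> moment_fixpoint_map m (\<lambda>i. cnj (\<mu> i)) y (\<lambda>i. c i y) (\<lambda>i. b i y) j"
      unfolding BS by (rule tendsto_moment_fixpoint_map) (use limB j y in auto)
    then show "c j y = moment_fixpoint_map m (\<lambda>i. cnj (\<mu> i)) y (\<lambda>i. c i y) (\<lambda>i. b i y) j"
      using LIMSEQ_unique limB(2)[OF j y] LIMSEQ_Suc by blast
  qed
qed

section \<open>Coefficients determined by the moments\<close>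

lemma scaled_coefficients_fixpoint:
  assumes r: "r > 0" and a1: "a 1 = of_real r"
    and mu: "\<And>k. k \<in> {1..m} \<Longrightarrow> moment m k a = \<mu> k" and j: "j \<in> {2..m+1}"
  shows "of_real r ^ j * cnj (a j) = moment_fixpoint_map m \<mu> (of_real (1 / r\<^sup>2)) (\<lambda>j. of_real r ^ j * cnj (a j)) (\<lambda>j. of_real r ^ j * a j) j"
    and "of_real r ^ j * a j = moment_fixpoint_map m (\<lambda>i. cnj (\<mu> i)) (of_real (1 / r\<^sup>2)) (\<lambda>j. of_real r ^ j * a j) (\<lambda>j. of_real r ^ j * cnj (a j)) j"
proof -
  have "j - 1 \<in> {1..m}" using j by auto
  then show *: "of_real r ^ j * cnj (a j) = moment_fixpoint_map m \<mu> (of_real (1 / r\<^sup>2)) (\<lambda>j. of_real r ^ j * cnj (a j)) (\<lambda>j. of_real r ^ j * a j) j"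
    using moment_scaling[where r = r and a = a and \<mu> = \<mu>, OF r a1 j] mu by simp
  from arg_cong[OF *, of cnj]
  show "of_real r ^ j * a j = moment_fixpoint_map m (\<lambda>i. cnj (\<mu> i)) (of_real (1 / r\<^sup>2)) (\<lambda>j. of_real r ^ j * a j) (\<lambda>j. of_real r ^ j * cnj (a j)) j"
    by (simp add: cnj_moment_fixpoint_map)
qed

text \<open>Two implications are recorded: the first places an arbitrary polynomial with the given
  moments and controlled scaled coefficients on the branch, the second shows that branch points
  really have these moments.\<close>

lemma coefficient_branch:
  assumes \<rho>: "contraction_radius m M \<rho>" and m: "m \<ge> 1" and M: "M > 0" and \<mu>: "\<forall>k\<in>{1..m}. cmod (\<mu> k) \<le> M"
  shows "\<exists>c. (\<forall>j\<in>{2..m+1}. c j holomorphic_on ball 0 \<rho> \<and> (\<forall>y. cmod y < \<rho> \<longrightarrow> cmod (c j y) \<le> 2 * M)) \<and>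
    (\<forall>y. cmod y < \<rho> \<longrightarrow> c (m+1) y = cnj (\<mu> m)) \<and>
    (\<forall>a r. r > 0 \<and> 1 / r\<^sup>2 < \<rho> \<and> a 1 = of_real r \<and> (\<forall>k\<in>{1..m}. moment m k a = \<mu> k) \<and>
       (\<forall>j\<in>{2..m+1}. r ^ j * cmod (a j) \<le> 2 * M) \<longrightarrow>
       (\<forall>j\<in>{2..m+1}. a j = c j (of_real (1 / r\<^sup>2)) / of_real r ^ j)) \<and>
    (\<forall>a r. r > 0 \<and> 1 / r\<^sup>2 < \<rho> \<and> a 1 = of_real r \<and>
       (\<forall>j\<in>{2..m+1}. a j = c j (of_real (1 / r\<^sup>2)) / of_real r ^ j) \<longrightarrow>
       (\<forall>k\<in>{1..m}. moment m k a = \<mu> k))"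
proof -
  let ?J = "{2..m+1}"
  obtain b c where
    holb: "\<And>j. j \<in> ?J \<Longrightarrow> b j holomorphic_on ball 0 \<rho>" and
    holc: "\<And>j. j \<in> ?J \<Longrightarrow> c j holomorphic_on ball 0 \<rho>" and
    bd: "\<And>j y. j \<in> ?J \<Longrightarrow> cmod y < \<rho> \<Longrightarrow> cmod (b j y) \<le> 2 * M \<and> cmod (c j y) \<le> 2 * M" and
    fb: "\<And>j y. j \<in> ?J \<Longrightarrow> cmod y < \<rho> \<Longrightarrow> b j y = moment_fixpoint_map m \<mu> y (\<lambda>i. b i y) (\<lambda>i. c i y) j" and
    fc: "\<And>j y. j \<in> ?J \<Longrightarrow> cmod y < \<rho> \<Longrightarrow> c j y = moment_fixpoint_map m (\<lambda>i. cnj (\<mu> i)) y (\<lambda>i. c i y) (\<lambda>i. b i y) j"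
    by (rule moment_fixpoint_branch[where \<mu> = \<mu>, OF \<rho> M]) (use \<mu> in blast)+
  have scaled: "\<forall>j\<in>?J. a j = c j (of_real (1 / r\<^sup>2)) / of_real r ^ j"
    if r: "r > 0" and yr: "1 / r\<^sup>2 < \<rho>" and a1: "a 1 = of_real r"
      and mu: "\<And>k. k \<in> {1..m} \<Longrightarrow> moment m k a = \<mu> k"
      and ab: "\<And>j. j \<in> ?J \<Longrightarrow> r ^ j * cmod (a j) \<le> 2 * M" for a r
  proof -
    define y where "y = complex_of_real (1 / r\<^sup>2)"
    have y: "cmod y < \<rho>" using yr r by (simp add: y_def norm_divide norm_power)
    define B where "B j = of_real r ^ j * cnj (a j)" for j
    define C where "C j = of_real r ^ j * a j" for j
    have BC: "cmod (B j) \<le> 2 * M \<and> cmod (C j) \<le> 2 * M" if "j \<in> ?J" for j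
      using ab[OF that] r by (simp add: B_def C_def norm_mult norm_power)
    have F: "B j = moment_fixpoint_map m \<mu> y B C j \<and> C j = moment_fixpoint_map m (\<lambda>i. cnj (\<mu> i)) y C B j" if "j \<in> ?J" for j
      using scaled_coefficients_fixpoint[OF r a1 mu that] unfolding B_def C_def y_def by blast
    have "C j = c j y" if j: "j \<in> ?J" for j
    proof -
      have "B j = b j y \<and> C j = c j y"
        by (rule moment_fixpoint_map_unique[OF \<rho> y, where b = B and c = C and b' = "\<lambda>j. b j y" and c' = "\<lambda>j. c j y"])
           (use BC bd y F fb fc j in auto)
      then show ?thesis by blast
    qed
    then show "\<forall>j\<in>?J. a j = c j (of_real (1 / r\<^sup>2)) / of_real r ^ j"
      using r by (auto simp: C_def y_def field_simps)
  qed
  have moments: "\<forall>k\<in>{1..m}. moment m k a = \<mu> k"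
    if r: "r > 0" and yr: "1 / r\<^sup>2 < \<rho>" and a1: "a 1 = of_real r"
      and a: "\<And>j. j \<in> ?J \<Longrightarrow> a j = c j (of_real (1 / r\<^sup>2)) / of_real r ^ j" for a r
  proof -
    define y where "y = complex_of_real (1 / r\<^sup>2)"
    have y: "cmod y < \<rho>" using yr r by (simp add: y_def norm_divide norm_power)
    have cy: "cnj y = y" by (simp add: y_def)
    \<comment> \<open>At real y the pair (cnj c, cnj b) solves the same system, so uniqueness gives
      cnj c = b. Only then does the fixed point with independent unknowns come from a
      polynomial.\<close>
    have c: "cnj (c j y) = b j y" if j: "j \<in> ?J" for j
    proof -
      have "cnj (c j y) = b j y \<and> cnj (b j y) = c j y"
      proof (rule moment_fixpoint_map_unique[OF \<rho> y, where b = "\<lambda>j. cnj (c j y)" and c = "\<lambda>j. cnj (b j y)" and b' = "\<lambda>j. b j y" and c' = "\<lambda>j. c j y"])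
        fix i assume i: "i \<in> ?J"
        show "cnj (c i y) = moment_fixpoint_map m \<mu> y (\<lambda>j. cnj (c j y)) (\<lambda>j. cnj (b j y)) i \<and>
              cnj (b i y) = moment_fixpoint_map m (\<lambda>i. cnj (\<mu> i)) y (\<lambda>j. cnj (b j y)) (\<lambda>j. cnj (c j y)) i"
          using arg_cong[OF fb[OF i y], of cnj] arg_cong[OF fc[OF i y], of cnj] by (simp add: cnj_moment_fixpoint_map cy)
      qed (use bd y fb fc j in auto)
      then show ?thesis by blast
    qed
    have C: "of_real r ^ j * a j = c j y" "of_real r ^ j * cnj (a j) = b j y" if "j \<in> ?J" for j
      using a[OF that] c[OF that, symmetric] r by (auto simp: y_def)
    show "\<forall>k\<in>{1..m}. moment m k a = \<mu> k"
    proof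
      fix k assume k: "k \<in> {1..m}"
      then have j: "k + 1 \<in> ?J" by auto
      have "scaled_poly m y (\<lambda>j. of_real r ^ j * a j) = scaled_poly m y (\<lambda>j. c j y)"
        unfolding scaled_poly_def using C by (intro arg_cong2[of _ _ _ _ "(+)"] sum.cong) auto
      moreover have "(\<Sum>n=k+1+1..m+1. of_nat n / of_nat (k+1) * y ^ (n - (k+1)) * (of_real r ^ n * cnj (a n)) * X n)
           = (\<Sum>n=k+1+1..m+1. of_nat n / of_nat (k+1) * y ^ (n - (k+1)) * b n y * X n)" for X
        using C by (intro sum.cong) auto
      ultimately have "moment_fixpoint_map m \<mu> y (\<lambda>j. of_real r ^ j * cnj (a j)) (\<lambda>j. of_real r ^ j * a j) (k+1)
         = moment_fixpoint_map m \<mu> y (\<lambda>j. b j y) (\<lambda>j. c j y) (k+1)"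
        unfolding moment_fixpoint_map_def by simp
      then show "moment m k a = \<mu> k"
        using moment_scaling[where r = r and a = a and \<mu> = \<mu>, OF r a1 j] C[OF j] fb[OF j y] by (simp add: y_def)
    qed
  qed
  \<comment> \<open>For j = m + 1 the correction sum is empty.\<close>
  have top: "c (m+1) y = cnj (\<mu> m)" if "cmod y < \<rho>" for y
    using fc[of "m+1" y] that m by (simp add: moment_fixpoint_map_def)
  show ?thesis
  proof (intro exI[of _ c] conjI)
    show "\<forall>j\<in>?J. c j holomorphic_on ball 0 \<rho> \<and> (\<forall>y. cmod y < \<rho> \<longrightarrow> cmod (c j y) \<le> 2 * M)"
      using holc bd by blast
  qed (use top scaled moments in \<open>blast+\<close>)
qed

text \<open>M_0 is the area of the image, counted with multiplicity, divided by pi: the sum of n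
  |a_n|^2, with the term n = 1 split off.\<close>

lemma moment_0:
  assumes "a 1 = of_real r"
  shows "moment m 0 a = of_real (r\<^sup>2 + N0 m a)"
proof -
  have "moment m 0 a = (\<Sum>n=1..m+1. of_real (real n * (cmod (a n))\<^sup>2))"
  proof -
    have "moment m 0 a = (\<Sum>n=1..m+1. of_nat n * coeff (coeff_poly m a) n * cnj (a n))"
      by (simp add: moment_def del: sum.cl_ivl_Suc)
    also have "\<dots> = (\<Sum>n=1..m+1. of_real (real n * (cmod (a n))\<^sup>2))"
    proof (rule sum.cong)
      fix n assume "n \<in> {1..m+1}"
      then have "of_nat n * coeff (coeff_poly m a) n * cnj (a n) = of_nat n * (a n * cnj (a n))"
        by (simp add: coeff_coeff_poly)
      then show "of_nat n * coeff (coeff_poly m a) n * cnj (a n) = of_real (real n * (cmod (a n))\<^sup>2)"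
        unfolding complex_norm_square [symmetric] by simp
    qed simp
    finally show ?thesis .
  qed
  also have "\<dots> = of_real (r\<^sup>2 + N0 m a)"
    unfolding N0_def using assms
    by (subst sum.atLeast_Suc_atMost) (simp_all add: numeral_2_eq_2 norm_of_real power2_eq_square del: sum.cl_ivl_Suc flip: of_real_mult)
  finally show ?thesis .
qed

section \<open>A priori bounds for polynomials with large first coefficient\<close>

lemma cmod_coeff_le_of_N0:
  assumes "N0 m a \<le> K\<^sup>2" "0 \<le> K" "j \<in> {2..m+1}"
  shows "cmod (a j) \<le> K"
proof -
  have "1 * (cmod (a j))\<^sup>2 \<le> real j * (cmod (a j))\<^sup>2"
    using assms by (intro mult_right_mono) auto
  also have "\<dots> \<le> N0 m a"
    unfolding N0_def using assms by (intro member_le_sum[of j _ "\<lambda>j. real j * (cmod (a j))\<^sup>2"]) auto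
  finally have "(cmod (a j))\<^sup>2 \<le> K\<^sup>2" using assms(1) by simp
  then show ?thesis using assms(2) by (rule power2_le_imp_le)
qed

definition a_priori_radius :: "nat \<Rightarrow> real \<Rightarrow> real \<Rightarrow> bool" where
  "a_priori_radius m M R \<longleftrightarrow> R \<ge> 1 \<and>
    (\<forall>a r. r \<ge> R \<and> a 1 = of_real r \<and> N0 m a \<le> (2 * M)\<^sup>2 \<and> (\<forall>k\<in>{1..m}. cmod (moment m k a) \<le> M) \<longrightarrow>
       (\<forall>j\<in>{2..m+1}. r ^ j * cmod (a j) \<le> 2 * M) \<and> N0 m a < M\<^sup>2)"

text \<open>The contraction ball is not yet available: the bound on N_0 controls |a_j| but not
  \<beta>_j = r^j |a_j|. Comparing f^j with (r X)^j shows that its coefficients above degree j are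
  O(r^(j-1)), and r^(j-1) |a_n| <= \<beta>_n / r for n > j. The moment equation then gives \<beta>_j
  <= M + (K / r) max \<beta>, hence max \<beta> <= 2 M once r >= 2 K.\<close>

lemma a_priori_radius_exists:
  assumes M: "M > 0"
  shows "\<exists>R. a_priori_radius m M R"
proof -
  let ?J = "{2..m+1}" and ?N = "m + 1"
  define W where "W = 1 + real m * (2 * M)"
  have W1: "W \<ge> 1" using M by (simp add: W_def)
  \<comment> \<open>The three factors m + 1 bound the weight n, the exponent j in the Lipschitz
    estimate, and the number of terms.\<close>
  define K where "K = (real (m+1))^3 * W ^ m * (real m * (2 * M))"
  have K0: "K \<ge> 0" using M W1 by (simp add: K_def)
  \<comment> \<open>The summand \<open>2 * K\<close> gives K / r <= 1/2;
    \<open>4 * (real (m+1))\<^sup>2\<close> makes the resulting bound for N_0 smaller than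
    M^2.\<close>
  define R where "R = 1 + 2 * K + 4 * (real (m+1))\<^sup>2"
  have R1: "R \<ge> 1" using K0 by (simp add: R_def)
  have bound: "\<forall>j\<in>?J. r ^ j * cmod (a j) \<le> 2 * M"
    if rR: "r \<ge> R" and a1: "a 1 = of_real r" and N: "N0 m a \<le> (2 * M)\<^sup>2"
      and mu: "\<And>k. k \<in> {1..m} \<Longrightarrow> cmod (moment m k a) \<le> M" for a :: "nat \<Rightarrow> complex" and r
  proof -
    have r1: "r \<ge> 1" using rR R1 by simp
    have aj: "cmod (a j) \<le> 2 * M" if "j \<in> ?J" for j
      using cmod_coeff_le_of_N0[OF N _ that] M by simp
    define p where "p = coeff_poly m a"
    define l where "l = monom (of_real r :: complex) 1"
    have pl: "p - l = (\<Sum>j=2..m+1. monom (a j) j)"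
      unfolding p_def l_def coeff_poly_def
      by (subst sum.atLeast_Suc_atMost) (simp_all add: a1[simplified] numeral_2_eq_2 del: sum.cl_ivl_Suc)
    have tpl: "trunc_norm ?N (p - l) \<le> real m * (2 * M)"
    proof -
      have "trunc_norm ?N (p - l) \<le> (\<Sum>j=2..m+1. trunc_norm ?N (monom (a j) j))"
        unfolding pl by (rule trunc_norm_sum)
      also have "\<dots> \<le> (\<Sum>j=2..m+1. 2 * M)"
        using trunc_norm_monom aj by (intro sum_mono) (meson order.trans)
      finally show ?thesis by simp
    qed
    have tl: "trunc_norm ?N l \<le> r" using trunc_norm_monom[of ?N "of_real r" 1] r1 by (simp add: l_def)
    have rW: "r + real m * (2 * M) \<le> r * W"
      using mult_right_mono[OF r1, of "real m * (2 * M)"] M by (simp add: W_def algebra_simps)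
    have tp: "trunc_norm ?N p \<le> r * W"
      using trunc_norm_add[of ?N "p - l" l] tpl tl rW by simp
    have tl': "trunc_norm ?N l \<le> r * W"
      using tl rW mult_nonneg_nonneg[of "real m" "2 * M"] M by linarith
    have co: "cmod (coeff (p ^ j) n) \<le> real (m+1) * (r ^ (j - 1) * W ^ m) * (real m * (2 * M))"
      if "j \<in> ?J" "n \<in> {j+1..m+1}" for j n
    proof -
      \<comment> \<open>\<open>l ^ j\<close> is a monomial of degree j, so subtracting it changes
        nothing at degree n > j.\<close>
      have "coeff (p ^ j) n = coeff (p ^ j - l ^ j) n"
        using that by (simp add: l_def monom_power)
      also have "cmod \<dots> \<le> real j * (r * W) ^ (j - 1) * trunc_norm ?N (p - l)"
        using that by (intro order.trans[OF cmod_coeff_le_trunc_norm trunc_norm_power_diff[OF tp tl']]) auto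
      also have "\<dots> \<le> real (m+1) * (r ^ (j - 1) * W ^ m) * (real m * (2 * M))"
        using that r1 W1 M unfolding power_mult_distrib
        by (intro mult_mono tpl power_increasing) (auto simp: trunc_norm_nonneg)
      finally show ?thesis .
    qed
    define \<beta> where "\<beta> j = r ^ j * cmod (a j)" for j
    define b where "b = (if m = 0 then 0 else Max (\<beta> ` ?J))"
    have \<beta>b: "\<beta> j \<le> b" if "j \<in> ?J" for j using that by (auto simp: b_def)
    have \<beta>0: "0 \<le> \<beta> j" for j using r1 by (simp add: \<beta>_def)
    have main: "\<beta> j \<le> M + b / 2" if j: "j \<in> ?J" for j
    proof -
      have b0: "0 \<le> b" using \<beta>0 \<beta>b[OF j] order.trans by blast
      have "(\<Sum>n=1..m+1. of_nat n * coeff (p ^ j) n * cnj (a n))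
          = (\<Sum>n=j..m+1. of_nat n * coeff (p ^ j) n * cnj (a n))"
        using j by (intro sum.mono_neutral_right) (auto simp: p_def coeff_power_of_coeff_0 coeff_coeff_poly)
      also have "\<dots> = of_nat j * of_real r ^ j * cnj (a j) + (\<Sum>n=j+1..m+1. of_nat n * coeff (p ^ j) n * cnj (a n))"
        using j a1 by (subst sum.atLeast_Suc_atMost) (auto simp: p_def coeff_power_of_coeff_0 coeff_coeff_poly)
      finally have "of_nat j * moment m (j - 1) a = of_nat j * of_real r ^ j * cnj (a j)
          + (\<Sum>n=j+1..m+1. of_nat n * coeff (p ^ j) n * cnj (a n))"
        using j unfolding moment_def by (simp add: p_def del: sum.cl_ivl_Suc)
      then have "of_real r ^ j * cnj (a j) = moment m (j - 1) a
          - (\<Sum>n=j+1..m+1. of_nat n * coeff (p ^ j) n * cnj (a n)) / of_nat j"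
        using j by (simp add: field_simps del: sum.cl_ivl_Suc)
      then have "\<beta> j = cmod (moment m (j - 1) a - (\<Sum>n=j+1..m+1. of_nat n * coeff (p ^ j) n * cnj (a n)) / of_nat j)"
        using r1 unfolding \<beta>_def by (metis abs_of_nonneg complex_mod_cnj norm_mult norm_of_real norm_power order.trans zero_le_one)
      also have "\<dots> \<le> M + cmod (\<Sum>n=j+1..m+1. of_nat n * coeff (p ^ j) n * cnj (a n)) / real j"
        using mu[of "j - 1"] j by (intro order.trans[OF norm_triangle_ineq4] add_mono) (force simp: norm_divide)+
      also have "\<dots> \<le> M + cmod (\<Sum>n=j+1..m+1. of_nat n * coeff (p ^ j) n * cnj (a n)) / 1"
        using j by (intro add_left_mono divide_left_mono) auto
      also have "cmod (\<Sum>n=j+1..m+1. of_nat n * coeff (p ^ j) n * cnj (a n))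
          \<le> (\<Sum>n=j+1..m+1. (real (m+1))\<^sup>2 * W ^ m * (real m * (2 * M)) * (b / r))"
      proof (rule sum_norm_le)
        fix n assume n: "n \<in> {j+1..m+1}"
        have "r ^ (j - 1) * cmod (a n) * r \<le> r ^ (j - 1) * cmod (a n) * r ^ (n - (j - 1))"
          using n j r1 power_increasing[of 1 "n - (j - 1)" r] by (intro mult_left_mono) auto
        also have "\<dots> = \<beta> n"
          using n j by (simp add: \<beta>_def mult_ac power_add [symmetric])
        also have "\<dots> \<le> b" using n j by (intro \<beta>b) auto
        finally have *: "r ^ (j - 1) * cmod (a n) \<le> b / r" using r1 by (simp add: field_simps)
        have "cmod (of_nat n * coeff (p ^ j) n * cnj (a n))
           \<le> real (m+1) * (real (m+1) * (r ^ (j - 1) * W ^ m) * (real m * (2 * M))) * cmod (a n)"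
          unfolding norm_mult using n co[OF j n] M W1 r1 by (intro mult_mono) (auto simp del: of_nat_Suc)
        also have "\<dots> = (real (m+1))\<^sup>2 * W ^ m * (real m * (2 * M)) * (r ^ (j - 1) * cmod (a n))"
          by (simp add: power2_eq_square mult_ac)
        also have "\<dots> \<le> (real (m+1))\<^sup>2 * W ^ m * (real m * (2 * M)) * (b / r)"
          using * M W1 by (intro mult_left_mono) auto
        finally show "cmod (of_nat n * coeff (p ^ j) n * cnj (a n)) \<le> (real (m+1))\<^sup>2 * W ^ m * (real m * (2 * M)) * (b / r)" .
      qed
      also have "\<dots> \<le> real (m+1) * ((real (m+1))\<^sup>2 * W ^ m * (real m * (2 * M)) * (b / r))"
        unfolding sum_constant using M W1 b0 r1 by (intro mult_right_mono) auto
      also have "\<dots> = K / r * b"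
        by (simp add: K_def power3_eq_cube power2_eq_square mult_ac)
      also have "\<dots> \<le> 1 / 2 * b"
      proof (intro mult_right_mono b0)
        have "2 * K \<le> r" using rR zero_le_power2[of "real (m+1)"] unfolding R_def by linarith
        then show "K / r \<le> 1 / 2" using r1 by (simp add: field_simps)
      qed
      finally show ?thesis by simp
    qed
    show ?thesis
    proof
      fix j assume j: "j \<in> ?J"
      then have "b = Max (\<beta> ` ?J)" by (auto simp: b_def)
      moreover have "Max (\<beta> ` ?J) \<le> M + b / 2" using j main by (subst Max_le_iff) auto
      ultimately have "b \<le> M + b / 2" by simp
      with main[OF j] show "r ^ j * cmod (a j) \<le> 2 * M" by (simp add: \<beta>_def)
    qed
  qed
  have small: "N0 m a < M\<^sup>2"
    if rR: "r \<ge> R" and ab: "\<forall>j\<in>?J. r ^ j * cmod (a j) \<le> 2 * M" for a :: "nat \<Rightarrow> complex" and r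
  proof -
    have r1: "r \<ge> 1" using rR R1 by simp
    have "N0 m a \<le> (\<Sum>j=2..m+1. real (m+1) * (2 * M / r)\<^sup>2)"
      unfolding N0_def
    proof (intro sum_mono mult_mono power_mono)
      fix j assume j: "j \<in> ?J"
      have "r * cmod (a j) \<le> r ^ j * cmod (a j)"
        using j r1 power_increasing[of 1 j r] by (intro mult_right_mono) auto
      then show "cmod (a j) \<le> 2 * M / r" using ab[THEN bspec, OF j] r1 by (simp add: field_simps)
    qed auto
    also have "\<dots> \<le> real (m+1) * (real (m+1) * (2 * M / r)\<^sup>2)"
      unfolding sum_constant by (intro mult_right_mono) auto
    also have "\<dots> = 4 * (real (m+1))\<^sup>2 / r\<^sup>2 * M\<^sup>2"
      by (simp add: power2_eq_square)
    also have "\<dots> < 1 * M\<^sup>2"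
    proof (rule mult_strict_right_mono)
      have "4 * (real (m+1))\<^sup>2 < r" using rR K0 by (simp add: R_def)
      also have "r \<le> r\<^sup>2" using r1 by (simp add: power2_eq_square)
      finally show "4 * (real (m+1))\<^sup>2 / r\<^sup>2 < 1" using r1 by simp
    qed (use M in simp)
    finally show ?thesis by simp
  qed
  show ?thesis
    unfolding a_priori_radius_def
  proof (intro exI[of _ R] conjI allI impI R1; elim conjE)
    fix a :: "nat \<Rightarrow> complex" and r :: real
    assume *: "R \<le> r" "a 1 = of_real r" "N0 m a \<le> (2 * M)\<^sup>2" "\<forall>k\<in>{1..m}. cmod (moment m k a) \<le> M"
    show **: "\<forall>j\<in>?J. r ^ j * cmod (a j) \<le> 2 * M"
      by (rule bound) (use * in auto)
    show "N0 m a < M\<^sup>2" by (rule small[OF *(1) **])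
  qed
qed

section \<open>The Polubarinova-Galin equation in terms of moments\<close>

definition unity_mean :: "nat \<Rightarrow> (complex \<Rightarrow> complex) \<Rightarrow> complex" where
  "unity_mean N F = (\<Sum>i<N. F (cis (2 * pi * real i / real N))) / of_nat N"

lemma unity_mean_add: "unity_mean N (\<lambda>z. F z + G z) = unity_mean N F + unity_mean N G"
  by (simp add: unity_mean_def sum.distrib add_divide_distrib)

lemma unity_mean_cmult: "unity_mean N (\<lambda>z. c * F z) = c * unity_mean N F"
  by (simp add: unity_mean_def sum_distrib_left)

lemma unity_mean_sum: "unity_mean N (\<lambda>z. \<Sum>x\<in>A. F x z) = (\<Sum>x\<in>A. unity_mean N (F x))"
  unfolding unity_mean_def by (subst sum.swap) (simp add: sum_divide_distrib)

lemma unity_mean_cong: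
  assumes "\<And>z. cmod z = 1 \<Longrightarrow> F z = G z"
  shows "unity_mean N F = unity_mean N G"
  using assms by (simp add: unity_mean_def)

lemma unit_power_mult_cnj: "cmod z = 1 \<Longrightarrow> z ^ k * cnj z ^ k = 1"
  by (simp flip: power_mult_distrib complex_norm_square)

text \<open>For k and l distinct and below N, the summands are the powers of an N-th root of unity w
  other than 1, and their geometric sum vanishes.\<close>

lemma unity_mean_monomials:
  assumes "k < N" "l < N"
  shows "unity_mean N (\<lambda>z. z ^ k * cnj (z ^ l)) = (if k = l then 1 else 0)"
proof (cases "k = l")
  case True
  have "unity_mean N (\<lambda>z. z ^ k * cnj (z ^ l)) = unity_mean N (\<lambda>z. 1)"
    by (rule unity_mean_cong) (simp add: True unit_power_mult_cnj)
  also have "\<dots> = 1" using assms by (simp add: unity_mean_def)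
  finally show ?thesis using True by simp
next
  case False
  have N: "N > 0" using assms by simp
  define u where "u i = cis (2 * pi * real i / real N)" for i
  have u1: "u j ^ i = u i ^ j" for i j
    unfolding u_def Complex.DeMoivre by (rule arg_cong[of _ _ cis]) (simp add: mult_ac)
  have uN: "u i ^ N = 1" for i
    using N by (simp add: u_def Complex.DeMoivre cis_multiple_2pi[of "real i"])
  define w where "w = u k * cnj (u l)"
  have "w \<noteq> 1"
  proof
    assume "w = 1"
    then have "u k * (cnj (u l) * u l) = u l" by (simp add: w_def mult.assoc [symmetric])
    then have "u k = u l" by (simp add: u_def cis_cnj cis_mult)
    moreover have "inj_on u {..<N}"
      using Complex.bij_betw_roots_unity[OF N] unfolding u_def bij_betw_def by simp
    ultimately show False using False assms by (auto dest: inj_onD)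
  qed
  moreover have "w ^ N = 1" by (simp add: w_def power_mult_distrib uN flip: complex_cnj_power)
  ultimately have "(\<Sum>i<N. w ^ i) = 0" by (simp add: geometric_sum)
  moreover have "u i ^ k * cnj (u i ^ l) = w ^ i" for i
    by (simp add: w_def power_mult_distrib u1[of i k] u1[of i l])
  ultimately show ?thesis using False by (simp add: unity_mean_def flip: u_def)
qed

lemma unity_mean_poly_mult_cnj:
  assumes "degree p < N" "degree q < N"
  shows "unity_mean N (\<lambda>z. poly p z * cnj (poly q z)) = (\<Sum>n<N. coeff p n * cnj (coeff q n))"
proof -
  have alt: "poly p z = (\<Sum>n<N. coeff p n * z ^ n)" if "degree p < N" for p :: "complex poly" and z
    unfolding poly_altdef using that by (intro sum.mono_neutral_left) (auto simp: coeff_eq_0)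
  have "unity_mean N (\<lambda>z. poly p z * cnj (poly q z))
     = unity_mean N (\<lambda>z. \<Sum>k<N. \<Sum>l<N. (coeff p k * cnj (coeff q l)) * (z ^ k * cnj (z ^ l)))"
    unfolding alt[OF assms(1)] alt[OF assms(2)] by (simp add: sum_product mult_ac)
  also have "\<dots> = (\<Sum>k<N. \<Sum>l<N. (coeff p k * cnj (coeff q l)) * (if k = l then 1 else 0))"
    unfolding unity_mean_sum unity_mean_cmult
    by (intro sum.cong refl arg_cong2[of _ _ _ _ "(*)"] unity_mean_monomials) auto
  also have "\<dots> = (\<Sum>k<N. coeff p k * cnj (coeff q k))"
    by (rule sum.cong) (auto simp: if_distrib sum.delta cong: if_cong)
  finally show ?thesis .
qed

text \<open>The Euler operator z d/dz. It produces the factor \<zeta> f' of the Polubarinova-Galin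
  equation and multiplies the n-th coefficient by n.\<close>

definition theta_poly :: "complex poly \<Rightarrow> complex poly" where
  "theta_poly p = monom 1 1 * pderiv p"

lemma coeff_theta_poly: "coeff (theta_poly p) n = of_nat n * coeff p n"
  by (cases n) (simp_all add: theta_poly_def coeff_monom_mult coeff_pderiv)

lemma poly_theta_poly: "poly (theta_poly p) z = z * poly (pderiv p) z"
  by (simp add: theta_poly_def poly_monom)

text \<open>Kept for arbitrary g, in which it is linear, so that information at the powers of f can
  be transferred to monomials and from there to any test polynomial.\<close>

definition moment_rate :: "nat \<Rightarrow> (nat \<Rightarrow> complex) \<Rightarrow> (nat \<Rightarrow> complex) \<Rightarrow> complex poly \<Rightarrow> complex" where
  "moment_rate m a a' g =
     (\<Sum>n=1..m+1. coeff (g * coeff_poly m a') n * cnj (of_nat n * a n)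
                 + coeff (g * theta_poly (coeff_poly m a)) n * cnj (a' n))"

lemma degree_coeff_poly: "degree (coeff_poly m a) \<le> m + 1"
  by (rule degree_le) (auto simp: coeff_coeff_poly)

lemma degree_theta_coeff_poly: "degree (theta_poly (coeff_poly m a)) \<le> m + 1"
  by (rule degree_le) (auto simp: coeff_coeff_poly coeff_theta_poly)

text \<open>
  The time derivative of \<open>M\<^sub>k\<close> is \<open>moment_rate\<close> at \<open>g = f ^ k\<close>; it is the mean over the circle of \<open>g\<close> times twice
  the left-hand side of the Polubarinova-Galin equation.  Means are taken over roots of unity, which is
  exact for trigonometric polynomials of small degree.
\<close>

lemma PG_imp_moment_rate:
  assumes PG: "\<And>z. cmod z = 1 \<Longrightarrow>
    Re (poly (coeff_poly m a') z * cnj (z * poly (pderiv (coeff_poly m a)) z)) = q"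
  shows "moment_rate m a a' g = 2 * of_real q * coeff g 0"
proof -
  define d where "d = coeff_poly m a'"
  define v where "v = theta_poly (coeff_poly m a)"
  \<comment> \<open>Larger than all degrees involved, including those of \<open>g * d\<close> and
    \<open>g * v\<close>, so that the discrete means are exact.\<close>
  define N where "N = degree g + m + 2"
  have deg: "degree (g * d) < N" "degree v < N" "degree (g * v) < N" "degree d < N" "degree g < N" "degree (1 :: complex poly) < N"
    using degree_mult_le[of g d] degree_mult_le[of g v] degree_coeff_poly[of m a'] degree_theta_coeff_poly[of m a]
    by (auto simp: N_def d_def v_def)
  have s1: "(\<Sum>n<N. coeff (g * d) n * cnj (coeff v n)) = (\<Sum>n=1..m+1. coeff (g * d) n * cnj (of_nat n * a n))"
  proof -
    have "(\<Sum>n<N. coeff (g * d) n * cnj (coeff v n)) = (\<Sum>n=1..m+1. coeff (g * d) n * cnj (coeff v n))"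
      by (rule sum.mono_neutral_right) (auto simp: v_def coeff_theta_poly coeff_coeff_poly N_def)
    also have "\<dots> = (\<Sum>n=1..m+1. coeff (g * d) n * cnj (of_nat n * a n))"
      by (rule sum.cong) (auto simp: v_def coeff_theta_poly coeff_coeff_poly)
    finally show ?thesis .
  qed
  have s2: "(\<Sum>n<N. coeff (g * v) n * cnj (coeff d n)) = (\<Sum>n=1..m+1. coeff (g * v) n * cnj (a' n))"
  proof -
    have "(\<Sum>n<N. coeff (g * v) n * cnj (coeff d n)) = (\<Sum>n=1..m+1. coeff (g * v) n * cnj (coeff d n))"
      by (rule sum.mono_neutral_right) (auto simp: d_def coeff_coeff_poly N_def)
    also have "\<dots> = (\<Sum>n=1..m+1. coeff (g * v) n * cnj (a' n))"
      by (rule sum.cong) (auto simp: d_def coeff_coeff_poly)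
    finally show ?thesis .
  qed
  have "moment_rate m a a' g = (\<Sum>n<N. coeff (g * d) n * cnj (coeff v n)) + (\<Sum>n<N. coeff (g * v) n * cnj (coeff d n))"
    unfolding moment_rate_def s1 s2 by (simp add: sum.distrib d_def v_def del: sum.cl_ivl_Suc)
  also have "\<dots> = unity_mean N (\<lambda>z. poly (g * d) z * cnj (poly v z)) + unity_mean N (\<lambda>z. poly (g * v) z * cnj (poly d z))"
    by (simp only: unity_mean_poly_mult_cnj[OF deg(1,2)] unity_mean_poly_mult_cnj[OF deg(3,4)])
  also have "\<dots> = unity_mean N (\<lambda>z. poly (g * d) z * cnj (poly v z) + poly (g * v) z * cnj (poly d z))"
    by (simp add: unity_mean_add)
  also have "\<dots> = unity_mean N (\<lambda>z. (2 * of_real q) * (poly g z * cnj (poly 1 z)))"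
  proof (rule unity_mean_cong)
    fix z :: complex assume z: "cmod z = 1"
    have "poly d z * cnj (poly v z) + poly v z * cnj (poly d z) = 2 * of_real q"
      using PG[OF z] complex_add_cnj[of "poly d z * cnj (poly v z)"]
      by (simp add: d_def v_def poly_theta_poly mult_ac)
    then show "poly (g * d) z * cnj (poly v z) + poly (g * v) z * cnj (poly d z) = (2 * of_real q) * (poly g z * cnj (poly 1 z))"
      by (simp add: mult.assoc flip: distrib_left)
  qed
  also have "\<dots> = 2 * of_real q * (\<Sum>n<N. coeff g n * cnj (coeff 1 n))"
    by (simp only: unity_mean_cmult unity_mean_poly_mult_cnj deg)
  also have "(\<Sum>n<N. coeff g n * cnj (coeff 1 n)) = (\<Sum>n\<in>{0}. coeff g n * cnj (coeff 1 n))"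
    by (rule sum.mono_neutral_right) (auto simp: coeff_1 N_def)
  finally show ?thesis by simp
qed

lemma has_vector_derivative_coeff_power:
  fixes P :: "real \<Rightarrow> complex poly"
  assumes "\<And>n. ((\<lambda>t. coeff (P t) n) has_vector_derivative coeff D n) (at t within S)"
  shows "((\<lambda>t. coeff (P t ^ Suc k) n) has_vector_derivative coeff (smult (of_nat (Suc k)) (P t ^ k * D)) n) (at t within S)"
proof (induction k arbitrary: n)
  case 0
  then show ?case using assms by simp
next
  case (Suc k)
  have "((\<lambda>t. coeff (P t * P t ^ Suc k) n) has_vector_derivative
      (\<Sum>i\<le>n. coeff (P t) i * coeff (smult (of_nat (Suc k)) (P t ^ k * D)) (n - i)
             + coeff D i * coeff (P t ^ Suc k) (n - i))) (at t within S)"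
    unfolding coeff_mult[of "P _"]
    by (intro has_vector_derivative_sum has_vector_derivative_mult assms Suc)
  also have "(\<Sum>i\<le>n. coeff (P t) i * coeff (smult (of_nat (Suc k)) (P t ^ k * D)) (n - i)
             + coeff D i * coeff (P t ^ Suc k) (n - i))
     = coeff (P t * smult (of_nat (Suc k)) (P t ^ k * D) + D * P t ^ Suc k) n"
    by (simp only: coeff_mult coeff_add sum.distrib)
  also have "P t * smult (of_nat (Suc k)) (P t ^ k * D) + D * P t ^ Suc k
     = smult (of_nat (Suc (Suc k))) (P t ^ Suc k * D)"
  proof -
    have "P t * smult c (P t ^ k * D) + D * P t ^ Suc k = smult (1 + c) (P t ^ Suc k * D)" for c
      by (simp add: smult_add_left mult_ac)
    then show ?thesis by (simp only: of_nat_Suc)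
  qed
  finally show ?case by simp
qed

lemma moment_has_vector_derivative:
  assumes "\<And>j. j \<in> {1..m+1} \<Longrightarrow> ((\<lambda>t. a j t) has_vector_derivative a' j) (at t within S)"
  shows "((\<lambda>t. moment m k (\<lambda>j. a j t)) has_vector_derivative
     moment_rate m (\<lambda>j. a j t) a' (coeff_poly m (\<lambda>j. a j t) ^ k)) (at t within S)"
proof -
  define P where "P t = coeff_poly m (\<lambda>j. a j t)" for t
  define D where "D = coeff_poly m a'"
  have 1: "((\<lambda>t. coeff (P t) n) has_vector_derivative coeff D n) (at t within S)" for n
    using assms by (cases "n \<in> {1..m+1}") (auto simp: P_def D_def coeff_coeff_poly)
  have 2: "((\<lambda>t. cnj (a n t)) has_vector_derivative cnj (a' n)) (at t within S)" if "n \<in> {1..m+1}" for n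
    using assms[OF that] by (rule has_vector_derivative_cnj)
  \<comment> \<open>The chain rule for the Euler operator turns the weighted coefficient of f^(k+1)
    into one of f^k times \<zeta> f'; its factor k + 1 cancels the denominator in
    \<open>moment\<close>.\<close>
  have 3: "of_nat n * coeff (P t ^ Suc k) n = of_nat (Suc k) * coeff (P t ^ k * theta_poly (P t)) n" for n
  proof -
    have "of_nat n * coeff (P t ^ Suc k) n = coeff (theta_poly (P t ^ Suc k)) n"
      by (simp only: coeff_theta_poly)
    also have "theta_poly (P t ^ Suc k) = smult (of_nat (Suc k)) (P t ^ k * theta_poly (P t))"
      by (simp only: theta_poly_def pderiv_power_Suc mult_smult_right mult_ac)
    finally show ?thesis by simp
  qed
  have "((\<lambda>t. moment m k (\<lambda>j. a j t)) has_vector_derivative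
     (\<Sum>n=1..m+1. (of_nat n * coeff (P t ^ Suc k) n) * cnj (a' n)
         + (of_nat n * coeff (smult (of_nat (Suc k)) (P t ^ k * D)) n) * cnj (a n t)) / of_nat (Suc k)) (at t within S)"
    unfolding moment_def P_def [symmetric] add_Suc_right Suc_eq_plus1 [symmetric] add_0_right
    by (intro has_vector_derivative_divide has_vector_derivative_sum has_vector_derivative_mult
        has_vector_derivative_mult_right has_vector_derivative_coeff_power 1 2) auto
  also have "(\<Sum>n=1..m+1. (of_nat n * coeff (P t ^ Suc k) n) * cnj (a' n)
         + (of_nat n * coeff (smult (of_nat (Suc k)) (P t ^ k * D)) n) * cnj (a n t)) / of_nat (Suc k)
      = moment_rate m (\<lambda>j. a j t) a' (P t ^ k)"
    unfolding moment_rate_def sum_divide_distrib 3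
    by (intro sum.cong refl) (simp add: add_divide_distrib P_def D_def mult_ac del: of_nat_Suc)
  finally show ?thesis by (simp add: P_def)
qed

lemma sum_symmetric:
  fixes f :: "nat \<Rightarrow> nat \<Rightarrow> real"
  assumes "\<And>i n. f i n = f n i"
  shows "(\<Sum>n=1..N. \<Sum>i=1..N. f i n) = 2 * (\<Sum>n=1..N. \<Sum>i=1..n. f i n) - (\<Sum>n=1..N. f n n)"
proof (induction N)
  case (Suc N)
  have "(\<Sum>n=1..N. f (Suc N) n) = (\<Sum>n=1..N. f n (Suc N))"
    using assms by (intro sum.cong) auto
  with Suc show ?case by (simp add: sum.distrib)
qed simp

lemma moment_rate_monoms:
  "moment_rate m a a' g = (\<Sum>l\<le>degree g. coeff g l * moment_rate m a a' (monom 1 l))"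
proof -
  have lin: "coeff (g * p) n = (\<Sum>l\<le>degree g. coeff g l * coeff (monom 1 l * p) n)" for n and p :: "complex poly"
  proof -
    have "g * p = (\<Sum>l\<le>degree g. smult (coeff g l) (monom 1 l)) * p"
      by (simp add: smult_monom poly_as_sum_of_monoms)
    then show ?thesis by (simp add: sum_distrib_right coeff_sum)
  qed
  have sw: "(\<Sum>n=1..m+1. (\<Sum>l\<le>degree g. coeff g l * A l n) * u n)
      = (\<Sum>l\<le>degree g. coeff g l * (\<Sum>n=1..m+1. A l n * u n))" for A u
    unfolding sum_distrib_left sum_distrib_right mult.assoc by (rule sum.swap)
  show ?thesis
    unfolding moment_rate_def sum.distrib lin[of "coeff_poly m a'"] lin[of "theta_poly _"] sw
    by (simp only: distrib_left sum.distrib)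
qed

text \<open>Both factors multiplied by X^l vanish at 0, so the products start at degree l + 1 > m +
  1, beyond the range of the sum.\<close>

lemma moment_rate_monom_large:
  assumes "l > m"
  shows "moment_rate m a a' (monom 1 l) = 0"
  unfolding moment_rate_def
proof (rule sum.neutral, rule ballI)
  fix n assume n: "n \<in> {1..m+1}"
  have "coeff (monom 1 l * p) n = 0" if "coeff p 0 = 0" for p :: "complex poly"
    using n assms that by (cases "n = l") (auto simp: coeff_monom_mult)
  then show "coeff (monom 1 l * coeff_poly m a') n * cnj (of_nat n * a n)
      + coeff (monom 1 l * theta_poly (coeff_poly m a)) n * cnj (a' n) = 0"
    by (simp add: coeff_coeff_poly coeff_theta_poly)
qed

text \<open>The powers of f are triangular with respect to the monomials, with diagonal entries
  \<open>a 1 ^ l\<close>. Degrees above m contribute nothing, which starts a descending induction on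
  l.\<close>

lemma moment_rate_monom:
  assumes a1: "a 1 \<noteq> 0"
    and rate: "\<And>k. k \<le> m \<Longrightarrow> moment_rate m a a' (coeff_poly m a ^ k) = (if k = 0 then 2 * of_real q else 0)"
  shows "moment_rate m a a' (monom 1 l) = (if l = 0 then 2 * of_real q else 0)"
proof (cases "l > m")
  case True
  then show ?thesis by (simp add: moment_rate_monom_large)
next
  case False
  then have "l \<le> m" by simp
  have "l > 0 \<longrightarrow> moment_rate m a a' (monom 1 l) = 0"
    using \<open>l \<le> m\<close>
  proof (induction "m - l" arbitrary: l rule: less_induct)
    case less
    show ?case
    proof
      assume l: "l > 0"
      define p where "p = coeff_poly m a"
      have p0: "coeff p 0 = 0" by (simp add: p_def coeff_coeff_poly)
      have deg: "l \<le> degree (p ^ l)"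
        using coeff_power_of_coeff_0(2)[OF p0, of l] a1 by (intro le_degree) (simp add: p_def coeff_coeff_poly)
      have "0 = moment_rate m a a' (p ^ l)"
        using rate[of l] less l by (simp add: p_def)
      also have "\<dots> = (\<Sum>j\<le>degree (p ^ l). coeff (p ^ l) j * moment_rate m a a' (monom 1 j))"
        by (rule moment_rate_monoms)
      also have "\<dots> = (\<Sum>j\<in>{l}. coeff (p ^ l) j * moment_rate m a a' (monom 1 j))"
      proof (rule sum.mono_neutral_right)
        show "\<forall>j\<in>{..degree (p ^ l)} - {l}. coeff (p ^ l) j * moment_rate m a a' (monom 1 j) = 0"
        proof
          fix j assume "j \<in> {..degree (p ^ l)} - {l}"
          then consider "j < l" | "j > l" "j \<le> m" | "j > m" by force
          then show "coeff (p ^ l) j * moment_rate m a a' (monom 1 j) = 0"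
          proof cases
            case 1
            then show ?thesis by (simp add: coeff_power_of_coeff_0(1)[OF p0])
          next
            case 2
            then show ?thesis using less(1)[of j] l less(2) by simp
          next
            case 3
            then show ?thesis by (simp add: moment_rate_monom_large)
          qed
        qed
      qed (use deg in auto)
      finally show "moment_rate m a a' (monom 1 l) = 0"
        using a1 coeff_power_of_coeff_0(2)[OF p0, of l] by (simp add: p_def coeff_coeff_poly)
    qed
  qed
  moreover have "moment_rate m a a' (monom 1 0) = 2 * of_real q"
    using rate[of 0] by simp
  ultimately show ?thesis by auto
qed

text \<open>
  Testing with \<open>g = (\<Sum>l\<le>m. cnj z ^ l * X ^ l)\<close> collects the terms \<open>i \<le> n\<close> of the double sum for the
  left-hand side at \<open>z\<close>, and testing with \<open>g = 1\<close> the diagonal ones.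
\<close>

lemma moment_rate_imp_PG:
  assumes a1: "a 1 \<noteq> 0"
    and rate: "\<And>k. k \<le> m \<Longrightarrow> moment_rate m a a' (coeff_poly m a ^ k) = (if k = 0 then 2 * of_real q else 0)"
    and z: "cmod z = 1"
  shows "Re (poly (coeff_poly m a') z * cnj (z * poly (pderiv (coeff_poly m a)) z)) = q"
proof -
  have L: "moment_rate m a a' g = 2 * of_real q * coeff g 0" for g
  proof -
    have "moment_rate m a a' g = (\<Sum>l\<le>degree g. if l = 0 then 2 * of_real q * coeff g 0 else 0)"
      by (subst moment_rate_monoms, rule sum.cong)
         (auto simp: moment_rate_monom[OF a1 rate])
    then show ?thesis by simp
  qed
  have zk: "z ^ k * cnj z ^ k = 1" for k using z by (rule unit_power_mult_cnj)
  define d where "d = coeff_poly m a'"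
  define v where "v = theta_poly (coeff_poly m a)"
  define g where "g = (\<Sum>l\<le>m. monom (cnj z ^ l) l)"
  have cg: "coeff g l = (if l \<le> m then cnj z ^ l else 0)" for l
    by (simp add: g_def coeff_sum sum.delta if_distrib cong: if_cong)
  define U where "U n = coeff d n * z ^ n" for n
  define V where "V n = coeff v n * z ^ n" for n
  have d0: "coeff d 0 = 0" "coeff v 0 = 0" by (simp_all add: d_def v_def coeff_coeff_poly coeff_theta_poly)
  \<comment> \<open>On the circle \<open>cnj z\<close> inverts z, so the weight
    \<open>cnj z ^ (n - i)\<close> splits as \<open>cnj z ^ n * z ^ i\<close>. The cutoff at m in g
    is not felt, as 1 <= i <= n <= m + 1.\<close>
  have cgp: "coeff (g * p) n = cnj z ^ n * (\<Sum>i=1..n. coeff p i * z ^ i)"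
    if p0: "coeff p 0 = 0" and n: "n \<in> {1..m+1}" for p n
  proof -
    have "coeff (g * p) n = (\<Sum>i\<le>n. coeff p i * coeff g (n - i))"
      by (simp only: mult.commute[of g] coeff_mult)
    also have "\<dots> = (\<Sum>i=1..n. coeff p i * coeff g (n - i))"
      using p0 by (intro sum.mono_neutral_right) (auto simp: not_less_eq_eq)
    also have "\<dots> = (\<Sum>i=1..n. cnj z ^ n * (coeff p i * z ^ i))"
    proof (rule sum.cong)
      fix i assume i: "i \<in> {1..n}"
      then have "cnj z ^ n = cnj z ^ (n - i) * cnj z ^ i" by (simp flip: power_add)
      then have "cnj z ^ n * z ^ i = cnj z ^ (n - i)"
        using zk[of i] by (simp add: mult.assoc mult.commute)
      moreover have "n - i \<le> m" using i n by auto
      ultimately show "coeff p i * coeff g (n - i) = cnj z ^ n * (coeff p i * z ^ i)"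
        by (simp add: cg mult_ac)
    qed simp
    finally show ?thesis by (simp add: sum_distrib_left)
  qed
  define f where "f i n = Re (U i * cnj (V n) + V i * cnj (U n))" for i n
  have fs: "f i n = f n i" for i n by (simp add: f_def algebra_simps)
  have "2 * of_real q = moment_rate m a a' g" by (simp add: L cg)
  also have "\<dots> = (\<Sum>n=1..m+1. (\<Sum>i=1..n. U i) * cnj (V n) + (\<Sum>i=1..n. V i) * cnj (U n))"
    unfolding moment_rate_def
  proof (rule sum.cong)
    fix n assume n: "n \<in> {1..m+1}"
    show "coeff (g * coeff_poly m a') n * cnj (of_nat n * a n)
          + coeff (g * theta_poly (coeff_poly m a)) n * cnj (a' n)
        = (\<Sum>i=1..n. U i) * cnj (V n) + (\<Sum>i=1..n. V i) * cnj (U n)"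
      using cgp[OF d0(1) n] cgp[OF d0(2) n] n
      by (simp add: U_def V_def d_def v_def coeff_theta_poly coeff_coeff_poly mult_ac)
  qed simp
  also have "\<dots> = (\<Sum>n=1..m+1. \<Sum>i=1..n. U i * cnj (V n) + V i * cnj (U n))"
    by (simp only: sum_distrib_right sum.distrib)
  finally have half: "(\<Sum>n=1..m+1. \<Sum>i=1..n. f i n) = 2 * q"
    unfolding f_def Re_sum [symmetric] by (metis Re_complex_of_real of_real_mult of_real_numeral)
  have "2 * of_real q = moment_rate m a a' (monom 1 0)" by (simp add: L)
  also have "\<dots> = (\<Sum>n=1..m+1. U n * cnj (V n) + V n * cnj (U n))"
    unfolding moment_rate_def
  proof (rule sum.cong)
    fix n assume n: "n \<in> {1..m+1}"
    have "U n * cnj (V n) = coeff d n * cnj (coeff v n)" "V n * cnj (U n) = coeff v n * cnj (coeff d n)"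
      using zk[of n] by (simp_all add: U_def V_def mult_ac)
    then show "coeff (monom 1 0 * coeff_poly m a') n * cnj (of_nat n * a n)
          + coeff (monom 1 0 * theta_poly (coeff_poly m a)) n * cnj (a' n)
        = U n * cnj (V n) + V n * cnj (U n)"
      using n by (simp add: d_def v_def coeff_theta_poly coeff_coeff_poly)
  qed simp
  finally have diag: "(\<Sum>n=1..m+1. f n n) = 2 * q"
    unfolding f_def Re_sum [symmetric] by (metis Re_complex_of_real of_real_mult of_real_numeral)
  have pz: "poly d z = (\<Sum>n=1..m+1. U n)" "poly v z = (\<Sum>n=1..m+1. V n)"
  proof -
    have *: "poly p z = (\<Sum>n=1..m+1. coeff p n * z ^ n)" if "degree p \<le> m + 1" "coeff p 0 = 0" for p
    proof -
      have "poly p z = (\<Sum>n\<le>m+1. coeff p n * z ^ n)"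
        unfolding poly_altdef using that by (intro sum.mono_neutral_left) (auto simp: coeff_eq_0)
      also have "\<dots> = (\<Sum>n=1..m+1. coeff p n * z ^ n)"
        using that by (intro sum.mono_neutral_right) (auto simp: not_less_eq_eq)
      finally show ?thesis .
    qed
    show "poly d z = (\<Sum>n=1..m+1. U n)" "poly v z = (\<Sum>n=1..m+1. V n)"
      unfolding U_def V_def using degree_coeff_poly[of m a'] degree_theta_coeff_poly[of m a] d0
      by (intro *; simp add: d_def v_def)+
  qed
  have "2 * Re (poly d z * cnj (poly v z)) = Re (poly d z * cnj (poly v z) + poly v z * cnj (poly d z))"
    by (simp add: algebra_simps)
  also have "\<dots> = (\<Sum>n=1..m+1. \<Sum>i=1..m+1. f i n)"
    unfolding pz f_def Re_sum [symmetric] by (simp only: cnj_sum sum_distrib_left sum_distrib_right sum.distrib)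
  \<comment> \<open>Twice the triangle minus the diagonal: 2 * 2 q - 2 q.\<close>
  also have "\<dots> = 2 * q" unfolding sum_symmetric[of f, OF fs] half diag by simp
  finally show ?thesis by (simp add: d_def v_def poly_theta_poly)
qed

section \<open>The moments as contour integrals\<close>

lemma higher_deriv_poly: "(deriv ^^ n) (poly p) = poly ((pderiv ^^ n) p)" for p :: "complex poly"
proof (induction n)
  case (Suc n)
  have "deriv (poly q) = poly (pderiv q)" for q :: "complex poly"
    by (rule ext) (intro DERIV_imp_deriv poly_DERIV)
  then show ?case using Suc by simp
qed simp

text \<open>The term z^(-n) of f* picks, by Cauchy's formula for the derivative of order n - 1, the
  coefficient n - 1 of f^k f'.\<close>

lemma harmonic_moment_polynomial_map: "harmonic_moment k (polynomial_map m a) = moment m k a"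
proof -
  define p where "p = coeff_poly m a"
  define g where "g = p ^ k * pderiv p"
  have pp: "polynomial_map m a = poly p" by (rule ext) (simp add: p_def poly_coeff_poly)
  have I: "((\<lambda>z. poly g z / z ^ n) has_contour_integral (2 * of_real pi * \<i> * coeff g (n - 1))) (circlepath 0 1)"
    if "n \<ge> 1" for n
  proof -
    have "((\<lambda>u. poly g u / (u - 0) ^ Suc (n - 1)) has_contour_integral
        ((2 * pi * \<i>) / (fact (n - 1)) * (deriv ^^ (n - 1)) (poly g) 0)) (circlepath 0 1)"
      by (intro Cauchy_has_contour_integral_higher_derivative_circlepath holomorphic_intros continuous_intros) auto
    moreover have "(deriv ^^ (n - 1)) (poly g) 0 = fact (n - 1) * coeff g (n - 1)"
      by (simp add: higher_deriv_poly poly_0_coeff_0 coeff_higher_pderiv pochhammer_fact [symmetric])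
    ultimately show ?thesis using that by (simp add: mult.assoc)
  qed
  have "((\<lambda>z. \<Sum>n=1..m+1. cnj (a n) * (poly g z / z ^ n)) has_contour_integral
      (\<Sum>n=1..m+1. cnj (a n) * (2 * of_real pi * \<i> * coeff g (n - 1)))) (circlepath 0 1)"
    by (intro has_contour_integral_sum has_contour_integral_lmul I) auto
  also have "?this \<longleftrightarrow> ((\<lambda>z. poly p z ^ k * cnj (poly p (1 / cnj z)) * deriv (poly p) z) has_contour_integral
      (\<Sum>n=1..m+1. cnj (a n) * (2 * of_real pi * \<i> * coeff g (n - 1)))) (circlepath 0 1)"
  proof (rule has_contour_integral_cong)
    fix z :: complex
    have dp: "deriv (poly p) z = poly (pderiv p) z" by (intro DERIV_imp_deriv poly_DERIV)
    have "cnj (poly p (1 / cnj z)) = (\<Sum>n=1..m+1. cnj (a n) * (1 / z ^ n))"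
      by (simp add: p_def poly_coeff_poly polynomial_map_def power_one_over field_simps del: sum.cl_ivl_Suc)
    then show "(\<Sum>n=1..m+1. cnj (a n) * (poly g z / z ^ n)) = poly p z ^ k * cnj (poly p (1 / cnj z)) * deriv (poly p) z"
      by (simp add: dp g_def sum_distrib_left sum_distrib_right mult_ac del: sum.cl_ivl_Suc)
  qed (rule refl)+
  finally have "harmonic_moment k (poly p) = (\<Sum>n=1..m+1. cnj (a n) * coeff g (n - 1))"
    unfolding harmonic_moment_def
    by (subst contour_integral_unique, assumption) (simp add: sum_distrib_left field_simps del: sum.cl_ivl_Suc)
  also have "\<dots> = moment m k a"
    unfolding moment_def sum_divide_distrib
  proof (rule sum.cong)
    fix n assume n: "n \<in> {1..m+1}"
    have "pderiv (p ^ Suc k) = smult (of_nat (Suc k)) g" by (simp only: pderiv_power_Suc g_def mult_smult_left)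
    then have "of_nat (Suc k) * coeff g (n - 1) = of_nat n * coeff (p ^ Suc k) n"
      using n by (metis coeff_pderiv coeff_smult Suc_pred' atLeastAtMost_iff less_eq_Suc_le One_nat_def)
    then show "cnj (a n) * coeff g (n - 1) = of_nat n * coeff (coeff_poly m a ^ (k + 1)) n * cnj (a n) / of_nat (k + 1)"
      by (simp add: p_def field_simps del: of_nat_Suc)
  qed simp
  finally show ?thesis by (simp add: pp)
qed

section \<open>Roots of perturbations of a binomial\<close>

lemma has_vector_derivative_iff_quotient:
  fixes f :: "real \<Rightarrow> 'a::real_normed_vector"
  shows "(f has_vector_derivative D) (at x within S)
    \<longleftrightarrow> ((\<lambda>y. (f y - f x) /\<^sub>R (y - x)) \<longlongrightarrow> D) (at x within S)"
proof -
  have "((\<lambda>y. (1 / norm (y - x)) *\<^sub>R (f y - (f x + (y - x) *\<^sub>R D))) \<longlongrightarrow> 0) (at x within S)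
    \<longleftrightarrow> ((\<lambda>y. (f y - f x) /\<^sub>R (y - x) - D) \<longlongrightarrow> 0) (at x within S)"
  proof (rule tendsto_norm_zero_iff [symmetric, THEN trans, OF trans, OF _ tendsto_norm_zero_iff])
    show "((\<lambda>y. norm ((1 / norm (y - x)) *\<^sub>R (f y - (f x + (y - x) *\<^sub>R D)))) \<longlongrightarrow> 0) (at x within S)
      \<longleftrightarrow> ((\<lambda>y. norm ((f y - f x) /\<^sub>R (y - x) - D)) \<longlongrightarrow> 0) (at x within S)"
    proof (rule filterlim_cong[OF refl refl])
      have "norm ((1 / norm (y - x)) *\<^sub>R (f y - (f x + (y - x) *\<^sub>R D))) = norm ((f y - f x) /\<^sub>R (y - x) - D)"
        if "y \<noteq> x" for y
      proof -
        have "(f y - f x) /\<^sub>R (y - x) - D = (1 / (y - x)) *\<^sub>R (f y - (f x + (y - x) *\<^sub>R D))"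
          unfolding diff_diff_eq [symmetric] scaleR_diff_right [of _ "f y - f x"] using that by (simp add: divide_inverse)
        then show ?thesis by (simp add: divide_inverse)
      qed
      then show "\<forall>\<^sub>F y in at x within S. norm ((1 / norm (y - x)) *\<^sub>R (f y - (f x + (y - x) *\<^sub>R D)))
          = norm ((f y - f x) /\<^sub>R (y - x) - D)"
        by (simp add: eventually_at_filter)
    qed
  qed
  then show ?thesis
    by (simp add: has_vector_derivative_def has_derivative_within bounded_linear_scaleR_left LIM_zero_iff)
qed

text \<open>f' / a_1 takes this form in the rescaled variable, with A = (m+1) cnj M_m. At g = 0 its
  zeros are the m-th roots of -1 / A, the limits of the rescaled zeros.\<close>

definition perturbed_poly :: "nat \<Rightarrow> complex \<Rightarrow> (nat \<Rightarrow> complex) \<Rightarrow> complex \<Rightarrow> complex" where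
  "perturbed_poly m A g z = 1 + (\<Sum>i=1..<m. g i * z ^ i) + A * z ^ m"

lemma perturbed_poly_factorization:
  assumes "A \<noteq> 0" "m \<ge> 1"
  shows "\<exists>z. \<forall>\<zeta>. perturbed_poly m A g \<zeta> = A * (\<Prod>k=1..m. \<zeta> - z k)"
proof -
  define p where "p = 1 + (\<Sum>i=1..<m. monom (g i) i) + monom A m"
  have pz: "poly p \<zeta> = perturbed_poly m A g \<zeta>" for \<zeta>
    by (simp add: p_def perturbed_poly_def poly_sum poly_monom)
  have c: "coeff p n = (if n = 0 then 1 else if n < m then g n else if n = m then A else 0)" for n
  proof -
    have "coeff (\<Sum>i=1..<m. monom (g i) i) n = (\<Sum>i=1..<m. if i = n then g i else 0)"
      by (simp add: coeff_sum)
    also have "\<dots> = (if n \<in> {1..<m} then g n else 0)" by (subst sum.delta) auto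
    finally show ?thesis using assms by (auto simp: p_def coeff_1)
  qed
  have deg: "degree p = m"
    using assms by (intro antisym degree_le le_degree) (auto simp: c)
  have "p \<noteq> 0" using c[of m] assms by auto
  from alg_closed_imp_factorization[OF this]
  obtain B where B: "size B = degree p" "p = smult (lead_coeff p) (\<Prod>x\<in>#B. [:-x, 1:])" by blast
  obtain xs where xs: "mset xs = B" using ex_mset by blast
  define z where "z k = xs ! (k - 1)" for k
  have len: "length xs = m" using B(1) xs deg by auto
  show ?thesis
  proof (intro exI[of _ z] allI)
    fix \<zeta>
    have "poly (\<Prod>x\<leftarrow>xs. [:-x, 1:]) \<zeta> = (\<Prod>x\<leftarrow>xs. \<zeta> - x)"
      by (induction xs) (auto simp: algebra_simps)
    also have "\<dots> = (\<Prod>i<m. \<zeta> - xs ! i)"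
      by (simp add: prod.list_conv_set_nth len atLeast0LessThan)
    also have "\<dots> = (\<Prod>k=1..m. \<zeta> - z k)"
      by (rule prod.reindex_bij_witness[of _ "\<lambda>k. k - 1" Suc]) (auto simp: z_def)
    finally have "poly (\<Prod>x\<in>#B. [:-x, 1:]) \<zeta> = (\<Prod>k=1..m. \<zeta> - z k)"
      by (simp add: xs [symmetric] mset_map [symmetric] prod_mset_prod_list del: mset_map)
    then show "perturbed_poly m A g \<zeta> = A * (\<Prod>k=1..m. \<zeta> - z k)"
      using B(2) c[of m] assms by (metis deg pz poly_smult less_irrefl not_one_le_zero)
  qed
qed

text \<open>A product of m distances bounded by e^m has a factor at most e, so the z nearest to w_k
  is within e. As the w are more than 2 e apart, no z is nearest to two of them, and the
  nearest-point choice is a permutation.\<close>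

lemma roots_matching:
  fixes w z :: "nat \<Rightarrow> complex"
  assumes sep: "\<And>k l. k \<in> {1..m} \<Longrightarrow> l \<in> {1..m} \<Longrightarrow> k \<noteq> l \<Longrightarrow> \<sigma> \<le> cmod (w k - w l)"
    and e: "0 \<le> e" "e < \<sigma> / 2"
    and small: "\<And>k. k \<in> {1..m} \<Longrightarrow> cmod (\<Prod>j=1..m. w k - z j) \<le> e ^ m"
  shows "\<exists>\<pi>. bij_betw \<pi> {1..m} {1..m} \<and>
     (\<forall>k\<in>{1..m}. cmod (w k - z (\<pi> k)) ^ m \<le> cmod (\<Prod>j=1..m. w k - z j))"
proof -
  have "\<exists>j\<in>{1..m}. cmod (w k - z j) ^ m \<le> cmod (\<Prod>j=1..m. w k - z j)" if k: "k \<in> {1..m}" for k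
  proof -
    have ne: "finite {1..m}" "{1..m} \<noteq> {}" using k by auto
    define j where "j = arg_min_on (\<lambda>j. cmod (w k - z j)) {1..m}"
    have j: "j \<in> {1..m}" "\<And>i. i \<in> {1..m} \<Longrightarrow> cmod (w k - z j) \<le> cmod (w k - z i)"
      unfolding j_def using arg_min_if_finite(1)[OF ne]
        arg_min_least[OF ne, where f = "\<lambda>j. cmod (w k - z j)"] by simp_all
    have "cmod (w k - z j) ^ m = (\<Prod>i=1..m. cmod (w k - z j))" by simp
    also have "\<dots> \<le> (\<Prod>i=1..m. cmod (w k - z i))"
      using j by (intro prod_mono) auto
    finally show ?thesis using j(1) by (auto simp: prod_norm)
  qed
  then obtain \<pi> where \<pi>: "\<And>k. k \<in> {1..m} \<Longrightarrow> \<pi> k \<in> {1..m} \<and> cmod (w k - z (\<pi> k)) ^ m \<le> cmod (\<Prod>j=1..m. w k - z j)"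
    by metis
  have near: "cmod (w k - z (\<pi> k)) \<le> e" if k: "k \<in> {1..m}" for k
  proof -
    have "cmod (w k - z (\<pi> k)) ^ m \<le> e ^ m" using \<pi>[OF k] small[OF k] by linarith
    moreover have "m > 0" using k by auto
    ultimately show ?thesis using e(1) by simp
  qed
  have "inj_on \<pi> {1..m}"
  proof (rule inj_onI, rule ccontr)
    fix k l assume kl: "k \<in> {1..m}" "l \<in> {1..m}" "\<pi> k = \<pi> l" "k \<noteq> l"
    have "cmod (w k - w l) \<le> cmod (w k - z (\<pi> k)) + cmod (w l - z (\<pi> l))"
      using norm_triangle_ineq4[of "w k - z (\<pi> k)" "w l - z (\<pi> l)"] kl(3) by simp
    also have "\<dots> \<le> e + e" using near[OF kl(1)] near[OF kl(2)] by (rule add_mono)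
    finally show False using sep[OF kl(1,2,4)] e by simp
  qed
  moreover have "\<pi> ` {1..m} \<subseteq> {1..m}" using \<pi> by blast
  ultimately have "bij_betw \<pi> {1..m} {1..m}"
    by (simp add: bij_betw_def endo_inj_surj)
  then show ?thesis using \<pi> by blast
qed

text \<open>The nearest-root matching does not depend on e, so one numbering of the roots serves
  every admissible e. The same labels can therefore be used for \<epsilon>-closeness and for
  convergence.\<close>

lemma perturbed_poly_roots:
  assumes A: "A \<noteq> 0" and m: "m \<ge> 1" and sep: "\<And>k l. k \<in> {1..m} \<Longrightarrow> l \<in> {1..m} \<Longrightarrow> k \<noteq> l \<Longrightarrow> \<sigma> \<le> cmod (w k - w l)"
  shows "\<exists>z. (\<forall>\<zeta>. perturbed_poly m A g \<zeta> = A * (\<Prod>k=1..m. \<zeta> - z k)) \<and>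
    (\<forall>e. 0 \<le> e \<and> e < \<sigma> / 2 \<and> (\<forall>k\<in>{1..m}. cmod (perturbed_poly m A g (w k)) \<le> cmod A * e ^ m) \<longrightarrow>
      (\<forall>k\<in>{1..m}. cmod (w k - z k) \<le> e))"
proof -
  obtain z where z: "\<And>\<zeta>. perturbed_poly m A g \<zeta> = A * (\<Prod>k=1..m. \<zeta> - z k)"
    using perturbed_poly_factorization[OF A m] by blast
  have P: "cmod (perturbed_poly m A g (w k)) \<le> cmod A * x \<longleftrightarrow> cmod (\<Prod>j=1..m. w k - z j) \<le> x" for k x
    using A by (simp add: z norm_mult)
  show ?thesis
  proof (cases "\<exists>e. 0 \<le> e \<and> e < \<sigma> / 2 \<and> (\<forall>k\<in>{1..m}. cmod (perturbed_poly m A g (w k)) \<le> cmod A * e ^ m)")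
    case False
    then show ?thesis using z by blast
  next
    case True
    then obtain e0 where e0: "0 \<le> e0" "e0 < \<sigma> / 2" "\<And>k. k \<in> {1..m} \<Longrightarrow> cmod (\<Prod>j=1..m. w k - z j) \<le> e0 ^ m"
      unfolding P by blast
    obtain \<pi> where \<pi>: "bij_betw \<pi> {1..m} {1..m}"
      "\<And>k. k \<in> {1..m} \<Longrightarrow> cmod (w k - z (\<pi> k)) ^ m \<le> cmod (\<Prod>j=1..m. w k - z j)"
      using roots_matching[where w = w and z = z and m = m and \<sigma> = \<sigma> and e = e0, OF sep e0] by blast
    show ?thesis
    proof (intro exI[of _ "\<lambda>k. z (\<pi> k)"] conjI allI impI ballI)
      fix \<zeta>
      have "(\<Prod>k=1..m. \<zeta> - z (\<pi> k)) = (\<Prod>k=1..m. \<zeta> - z k)"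
        using \<pi>(1) by (rule prod.reindex_bij_betw)
      then show "perturbed_poly m A g \<zeta> = A * (\<Prod>k=1..m. \<zeta> - z (\<pi> k))" by (simp add: z)
    next
      fix e k assume e: "0 \<le> e \<and> e < \<sigma> / 2 \<and> (\<forall>k\<in>{1..m}. cmod (perturbed_poly m A g (w k)) \<le> cmod A * e ^ m)"
        and k: "k \<in> {1..m}"
      then have "cmod (w k - z (\<pi> k)) ^ m \<le> e ^ m" using \<pi>(2)[OF k] unfolding P by (meson order.trans)
      then show "cmod (w k - z (\<pi> k)) \<le> e" using m e by simp
    qed
  qed
qed

lemma roots_separation:
  assumes "m \<ge> 1"
  obtains d :: real where "0 < d" "d \<le> 1"
    "\<And>u v :: complex. u ^ m = v ^ m \<Longrightarrow> u \<noteq> v \<Longrightarrow> d * cmod u \<le> cmod (u - v)"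
proof -
  \<comment> \<open>Dividing by u reduces to the distances from 1 of the other m-th roots of unity.
    Inserting 1 keeps the set nonempty when m = 1 and gives d <= 1.\<close>
  define S where "S = insert 1 ((\<lambda>\<xi>. cmod (1 - \<xi>)) ` ({\<xi> :: complex. \<xi> ^ m = 1} - {1}))"
  have fin: "finite S" 
    unfolding S_def using assms by (intro finite.insertI finite_imageI finite_Diff finite_roots_unity) auto
  have "S \<noteq> {}" by (simp add: S_def)
  define d where "d = Min S"
  show thesis
  proof (rule that[of d])
    show "0 < d" unfolding d_def using fin by (subst Min_gr_iff) (auto simp: S_def)
    show "d \<le> 1" unfolding d_def using fin by (intro Min_le) (auto simp: S_def)
    fix u v :: complex assume uv: "u ^ m = v ^ m" "u \<noteq> v"
    show "d * cmod u \<le> cmod (u - v)"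
    proof (cases "u = 0")
      case False
      have "(v / u) ^ m = 1" using False by (simp add: power_divide uv(1) [symmetric])
      then have "d \<le> cmod (1 - v / u)" unfolding d_def using fin uv False
        by (intro Min_le) (auto simp: S_def)
      then have "d * cmod u \<le> cmod (1 - v / u) * cmod u" by (intro mult_right_mono) auto
      also have "\<dots> = cmod (u - v)" using False by (simp add: norm_mult [symmetric] left_diff_distrib)
      finally show ?thesis .
    qed simp
  qed
qed

text \<open>Gives bounds for the modulus of the limit points from |w_k|^m = 1 / |A| without taking
  m-th roots.\<close>

lemma power_bounds:
  fixes x c :: real
  assumes "x ^ m = c" "x \<ge> 0" "m \<ge> 1"
  shows "min 1 c \<le> x" "x \<le> max 1 c"
proof -
  show "min 1 c \<le> x"
  proof (cases "x < 1")
    case True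
    then have "x ^ m \<le> x ^ 1" using assms by (intro power_decreasing) auto
    then show ?thesis using assms by auto
  qed auto
  show "x \<le> max 1 c"
  proof (cases "x > 1")
    case True
    then have "x ^ 1 \<le> x ^ m" using assms by (intro power_increasing) auto
    then show ?thesis using assms by auto
  qed auto
qed

lemma perturbed_sum_bound:
  fixes z :: complex
  assumes "\<And>i. i \<in> {1..<m} \<Longrightarrow> cmod (g i) \<le> x" "cmod z \<le> W" "1 \<le> W" "0 \<le> x"
  shows "cmod (\<Sum>i=1..<m. g i * z ^ i) \<le> real m * (x * W ^ m)"
proof -
  have "cmod (\<Sum>i=1..<m. g i * z ^ i) \<le> (\<Sum>i=1..<m. x * W ^ m)"
  proof (rule sum_norm_le)
    fix i assume i: "i \<in> {1..<m}"
    have "cmod z ^ i \<le> W ^ i" using assms by (intro power_mono) auto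
    also have "\<dots> \<le> W ^ m" using i assms by (intro power_increasing) auto
    finally show "cmod (g i * z ^ i) \<le> x * W ^ m"
      unfolding norm_mult norm_power using assms i by (intro mult_mono) auto
  qed
  also have "\<dots> \<le> real m * (x * W ^ m)"
    using assms by (simp add: mult_right_mono)
  finally show ?thesis .
qed

text \<open>
  Comparing the factorizations at two parameters gives
  \<open>(Z k s - Z k s') * A * (\<Prod>j\<noteq>k. Z k s - Z j s') = (\<Sum>i. (g i s' - g i s) * Z k s ^ i)\<close>,
  and the product over \<open>j \<noteq> k\<close> stays away from \<open>0\<close>; this replaces the implicit function theorem.
\<close>

lemma separated_roots_derivative:
  assumes m: "m \<ge> 1" and A: "A \<noteq> 0" and I: "open I" "s \<in> I"
    and fac: "\<And>s \<zeta>. s \<in> I \<Longrightarrow> perturbed_poly m A (\<lambda>i. g i s) \<zeta> = A * (\<Prod>k=1..m. \<zeta> - Z k s)"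
    and near: "\<And>s k. s \<in> I \<Longrightarrow> k \<in> {1..m} \<Longrightarrow> cmod (Z k s - w k) \<le> \<sigma> / 4"
    and sep: "\<And>k l. k \<in> {1..m} \<Longrightarrow> l \<in> {1..m} \<Longrightarrow> k \<noteq> l \<Longrightarrow> \<sigma> \<le> cmod (w k - w l)"
    and \<sigma>: "\<sigma> > 0"
    and g': "\<And>i. i \<in> {1..<m} \<Longrightarrow> (g i has_vector_derivative g' i) (at s)"
    and k: "k \<in> {1..m}"
  shows "\<exists>D. (Z k has_vector_derivative D) (at s) \<and>
     cmod D \<le> cmod (\<Sum>i=1..<m. g' i * Z k s ^ i) / (cmod A * (\<sigma> / 2) ^ (m - 1))"
proof -
  let ?K = "{1..m}"
  define E where "E x l t = (\<Sum>i=1..<m. (g i t - g i x) * Z l x ^ i)" for x l t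
  define R where "R x l t = A * (\<Prod>j\<in>?K-{l}. Z l x - Z j t)" for x l t
  have ER: "E s l t = (Z l s - Z l t) * R s l t" if t: "t \<in> I" and l: "l \<in> ?K" for l t
  proof -
    have "A * (\<Prod>j=1..m. Z l s - Z j s) = 0" using l by (auto intro!: prod_zero)
    then have "E s l t = perturbed_poly m A (\<lambda>i. g i t) (Z l s) - perturbed_poly m A (\<lambda>i. g i s) (Z l s)"
      by (simp add: E_def perturbed_poly_def sum_subtractf left_diff_distrib)
    also have "\<dots> = A * (\<Prod>j=1..m. Z l s - Z j t)"
      using fac[OF t] fac[OF I(2)] \<open>A * (\<Prod>j=1..m. Z l s - Z j s) = 0\<close> by simp
    also have "(\<Prod>j=1..m. Z l s - Z j t) = (Z l s - Z l t) * (\<Prod>j\<in>?K-{l}. Z l s - Z j t)"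
      using l by (simp add: prod.remove)
    finally show ?thesis by (simp add: R_def)
  qed
  \<comment> \<open>The separation \<sigma> of the reference points loses at most \<sigma>/4 at each
    end, leaving \<sigma>/2 for every factor.\<close>
  have Rlow: "cmod A * (\<sigma> / 2) ^ (m - 1) \<le> cmod (R s l t)" if t: "t \<in> I" and l: "l \<in> ?K" for l t
  proof -
    have "(\<sigma> / 2) ^ (m - 1) = (\<Prod>j\<in>?K-{l}. \<sigma> / 2)" using l by simp
    also have "\<dots> \<le> (\<Prod>j\<in>?K-{l}. cmod (Z l s - Z j t))"
    proof (rule prod_mono, intro conjI)
      fix j assume j: "j \<in> ?K - {l}"
      have "cmod (w l - w j) \<le> cmod (Z l s - Z j t) + cmod ((Z l s - w l) - (Z j t - w j))"
        using norm_triangle_ineq4[of "Z l s - Z j t" "(Z l s - w l) - (Z j t - w j)"] by simp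
      also have "\<dots> \<le> cmod (Z l s - Z j t) + (cmod (Z l s - w l) + cmod (Z j t - w j))"
        by (intro add_left_mono norm_triangle_ineq4)
      finally show "\<sigma> / 2 \<le> cmod (Z l s - Z j t)"
        using sep[of l j] near[OF I(2) l] near[OF t, of j] l j by auto
    qed (use \<sigma> in auto)
    finally show ?thesis by (simp add: R_def norm_mult prod_norm [symmetric] mult_left_mono)
  qed
  define c where "c = cmod A * (\<sigma> / 2) ^ (m - 1)"
  have c: "c > 0" using A \<sigma> by (simp add: c_def)
  have R0: "R s l t \<noteq> 0" if "t \<in> I" "l \<in> ?K" for l t
    using Rlow[OF that] c unfolding c_def by fastforce
  have ev: "\<forall>\<^sub>F t in at s. t \<in> I" using I by (simp add: eventually_at_topological) blast
  \<comment> \<open>Continuity of all roots comes first, from |Z_l(s) - Z_l(t)| c <= |E|: the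
    difference quotient of one root contains the others through R, whose limit is needed.\<close>
  have cont: "(Z l \<longlongrightarrow> Z l s) (at s)" if l: "l \<in> ?K" for l
  proof -
    have "(g i \<longlongrightarrow> g i s) (at s)" if "i \<in> {1..<m}" for i
      using has_vector_derivative_continuous[OF g'[OF that]] by (simp add: isCont_def)
    then have "(E s l \<longlongrightarrow> (\<Sum>i=1..<m. (g i s - g i s) * Z l s ^ i)) (at s)"
      unfolding E_def by (intro tendsto_intros)
    then have "((\<lambda>t. cmod (E s l t) / c) \<longlongrightarrow> 0) (at s)"
      by (intro tendsto_divide_zero tendsto_norm_zero) simp
    moreover have "\<forall>\<^sub>F t in at s. cmod (Z l t - Z l s) \<le> cmod (E s l t) / c"
      using ev
    proof eventually_elim
      case (elim t)
      have "cmod (Z l s - Z l t) * c \<le> cmod (Z l s - Z l t) * cmod (R s l t)"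
        using Rlow[OF elim l] by (intro mult_left_mono) (auto simp: c_def)
      also have "\<dots> = cmod (E s l t)" by (simp add: ER[OF elim l] norm_mult)
      finally show ?case using c by (simp add: pos_le_divide_eq norm_minus_commute)
    qed
    ultimately have "((\<lambda>t. Z l t - Z l s) \<longlongrightarrow> 0) (at s)"
      by (rule Lim_null_comparison[rotated])
    then show ?thesis by (simp add: LIM_zero_iff)
  qed
  define D where "D = - (\<Sum>i=1..<m. g' i * Z k s ^ i) / R s k s"
  have "((\<lambda>t. - ((\<Sum>i=1..<m. ((g i t - g i s) /\<^sub>R (t - s)) * Z k s ^ i)) / R s k t) \<longlongrightarrow> D) (at s)"
    unfolding D_def
  proof (intro tendsto_intros)
    show "((\<lambda>t. (g i t - g i s) /\<^sub>R (t - s)) \<longlongrightarrow> g' i) (at s)" if "i \<in> {1..<m}" for i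
      using g'[OF that] by (simp add: has_vector_derivative_iff_quotient)
    show "(R s k \<longlongrightarrow> R s k s) (at s)"
      unfolding R_def by (intro tendsto_intros cont) auto
    show "R s k s \<noteq> 0" by (rule R0[OF I(2) k])
  qed
  then have "((\<lambda>t. (Z k t - Z k s) /\<^sub>R (t - s)) \<longlongrightarrow> D) (at s)"
  proof (rule Lim_transform_eventually)
    show "\<forall>\<^sub>F t in at s. - ((\<Sum>i=1..<m. ((g i t - g i s) /\<^sub>R (t - s)) * Z k s ^ i)) / R s k t
       = (Z k t - Z k s) /\<^sub>R (t - s)"
      using ev
    proof eventually_elim
      case (elim t)
      have "(\<Sum>i=1..<m. ((g i t - g i s) /\<^sub>R (t - s)) * Z k s ^ i) = E s k t /\<^sub>R (t - s)"
        by (simp add: E_def scaleR_right.sum)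
      also have "\<dots> = ((Z k s - Z k t) /\<^sub>R (t - s)) * R s k t"
        by (simp add: ER[OF elim k])
      finally have "- (\<Sum>i=1..<m. ((g i t - g i s) /\<^sub>R (t - s)) * Z k s ^ i) / R s k t = - ((Z k s - Z k t) /\<^sub>R (t - s))"
        using R0[OF elim k] by (simp add: scaleR_conv_of_real)
      also have "\<dots> = (Z k t - Z k s) /\<^sub>R (t - s)" by (simp flip: scaleR_minus_right)
      finally show ?case .
    qed
  qed
  then have "(Z k has_vector_derivative D) (at s)"
    by (simp add: has_vector_derivative_iff_quotient)
  moreover have "cmod D \<le> cmod (\<Sum>i=1..<m. g' i * Z k s ^ i) / c"
    unfolding D_def norm_divide norm_minus_cancel
    using Rlow[OF I(2) k] c by (intro divide_left_mono mult_pos_pos) (auto simp: c_def R0[OF I(2) k])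
  ultimately show ?thesis unfolding c_def by blast
qed

definition root_family :: "nat \<Rightarrow> real \<Rightarrow> real \<Rightarrow> real \<Rightarrow> real \<Rightarrow> real \<Rightarrow> complex \<Rightarrow> (nat \<Rightarrow> real \<Rightarrow> complex) \<Rightarrow>
    (nat \<Rightarrow> real \<Rightarrow> complex) \<Rightarrow> (nat \<Rightarrow> complex) \<Rightarrow> (nat \<Rightarrow> real \<Rightarrow> complex) \<Rightarrow> bool" where
  "root_family m A0 K s1 l0 \<sigma> A g g' w Z \<longleftrightarrow>
     A0 \<le> cmod A \<and>
     (\<forall>i\<in>{1..<m}. \<forall>s\<in>{0<..<s1}. (g i has_vector_derivative g' i s) (at s) \<and>
        cmod (g i s) \<le> K * s \<and> cmod (g' i s) \<le> K) \<and>
     (\<forall>k\<in>{1..m}. w k ^ m = - 1 / A \<and> l0 \<le> cmod (w k)) \<and>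
     (\<forall>k\<in>{1..m}. \<forall>l\<in>{1..m}. k \<noteq> l \<longrightarrow> \<sigma> \<le> cmod (w k - w l)) \<and>
     (\<forall>s\<in>{0<..<s1}. \<forall>\<zeta>. perturbed_poly m A (\<lambda>i. g i s) \<zeta> = A * (\<Prod>k=1..m. \<zeta> - Z k s)) \<and>
     (\<forall>s\<in>{0<..<s1}. \<forall>e. 0 \<le> e \<and> e < \<sigma> / 2 \<and>
        (\<forall>k\<in>{1..m}. cmod (perturbed_poly m A (\<lambda>i. g i s) (w k)) \<le> cmod A * e ^ m) \<longrightarrow>
        (\<forall>k\<in>{1..m}. cmod (w k - Z k s) \<le> e))"

text \<open>The family is quantified inside, so s2 depends only on the constants. The last conjunct
  bounds the logarithmic derivative of the root by \<kappa> / s, which is what the motion away from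
  the origin requires.\<close>

definition roots_controlled ::
    "nat \<Rightarrow> real \<Rightarrow> real \<Rightarrow> real \<Rightarrow> real \<Rightarrow> real \<Rightarrow> real \<Rightarrow> real \<Rightarrow> real \<Rightarrow> bool" where
  "roots_controlled m A0 K s1 l0 \<sigma> \<epsilon> \<kappa> s2 \<longleftrightarrow>
    (\<forall>A g g' w Z. root_family m A0 K s1 l0 \<sigma> A g g' w Z \<longrightarrow>
      (\<forall>s k. 0 < s \<and> s < s2 \<and> k \<in> {1..m} \<longrightarrow>
        cmod (Z k s - w k) < \<epsilon> \<and> cmod (Z k s - w k) \<le> \<sigma> / 8 \<and> Z k s \<noteq> 0 \<and>
        (\<exists>D. (Z k has_vector_derivative D) (at s) \<and> s * cmod D < \<kappa> * cmod (Z k s))))"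

lemma roots_controlled_exists:
  fixes A0 K s1 \<epsilon> \<sigma> l0 \<kappa> :: real
  assumes m: "m \<ge> 1" and A0: "A0 > 0" and K: "K > 0" and s1: "s1 > 0" and \<epsilon>: "\<epsilon> > 0"
    and \<sigma>: "\<sigma> > 0" "\<sigma> \<le> l0" and \<kappa>: "\<kappa> > 0"
  shows "\<exists>s2. 0 < s2 \<and> s2 \<le> s1 \<and> roots_controlled m A0 K s1 l0 \<sigma> \<epsilon> \<kappa> s2"
proof -
  \<comment> \<open>The first summand bounds the limit points, since |w_k|^m = 1 / |A| <= 1 / A0;
    the extra \<sigma> covers the nearby roots.\<close>
  define W where "W = max 1 (1 / A0) + \<sigma>"
  have W1: "W \<ge> 1" using \<sigma> by (simp add: W_def)
  define e where "e = min (\<epsilon> / 2) (\<sigma> / 8)"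
  have e: "e > 0" "e < \<epsilon>" "e \<le> \<sigma> / 8" using \<epsilon> \<sigma> by (auto simp: e_def)
  define C where "C = real m * (K * W ^ m)"
  have C: "C > 0" using m K W1 by (simp add: C_def)
  define C2 where "C2 = C / (A0 * (\<sigma> / 2) ^ (m - 1))"
  have C2: "C2 > 0" using C A0 \<sigma> by (simp add: C2_def)
  \<comment> \<open>The second entry makes the polynomial at w_k at most |A| e^m, as the matching
    demands. The third gives s |Z'| <= \<kappa> l0 / 2, while |Z| > l0 / 2.\<close>
  define s2 where "s2 = min s1 (min (A0 * e ^ m / C) (\<kappa> * (l0 / 2) / C2))"
  have l0: "l0 > 0" using \<sigma> by simp
  have s2: "0 < s2" "s2 \<le> s1" using s1 A0 e C C2 \<kappa> l0 by (auto simp: s2_def)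
  have est: "\<forall>s k. 0 < s \<and> s < s2 \<and> k \<in> {1..m} \<longrightarrow>
        cmod (Z k s - w k) < \<epsilon> \<and> cmod (Z k s - w k) \<le> \<sigma> / 8 \<and> Z k s \<noteq> 0 \<and>
        (\<exists>D. (Z k has_vector_derivative D) (at s) \<and> s * cmod D < \<kappa> * cmod (Z k s))"
    if fam: "root_family m A0 K s1 l0 \<sigma> A g g' w Z" for A g g' w Z
  proof -
    have AA: "A0 \<le> cmod A"
      and gd: "\<And>i s. i \<in> {1..<m} \<Longrightarrow> 0 < s \<Longrightarrow> s < s1 \<Longrightarrow> (g i has_vector_derivative g' i s) (at s)"
      and gb: "\<And>i s. i \<in> {1..<m} \<Longrightarrow> 0 < s \<Longrightarrow> s < s1 \<Longrightarrow> cmod (g i s) \<le> K * s \<and> cmod (g' i s) \<le> K"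
      and w: "\<And>k. k \<in> {1..m} \<Longrightarrow> w k ^ m = - 1 / A \<and> l0 \<le> cmod (w k)"
      and sep: "\<And>k l. k \<in> {1..m} \<Longrightarrow> l \<in> {1..m} \<Longrightarrow> k \<noteq> l \<Longrightarrow> \<sigma> \<le> cmod (w k - w l)"
      and fac: "\<And>s \<zeta>. 0 < s \<Longrightarrow> s < s1 \<Longrightarrow> perturbed_poly m A (\<lambda>i. g i s) \<zeta> = A * (\<Prod>k=1..m. \<zeta> - Z k s)"
      and mat: "\<And>s e. 0 < s \<Longrightarrow> s < s1 \<Longrightarrow> 0 \<le> e \<and> e < \<sigma> / 2 \<and>
         (\<forall>k\<in>{1..m}. cmod (perturbed_poly m A (\<lambda>i. g i s) (w k)) \<le> cmod A * e ^ m) \<longrightarrow>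
         (\<forall>k\<in>{1..m}. cmod (w k - Z k s) \<le> e)"
      using fam unfolding root_family_def by simp_all
    have A: "A \<noteq> 0" using AA A0 by auto
    have wW: "cmod (w k) \<le> max 1 (1 / A0)" if k: "k \<in> {1..m}" for k
    proof -
      have "cmod (w k) ^ m = 1 / cmod A" using w[OF k] by (simp add: norm_power [symmetric] norm_divide)
      then have "cmod (w k) \<le> max 1 (1 / cmod A)" using m by (intro power_bounds(2)) auto
      also have "\<dots> \<le> max 1 (1 / A0)" using AA A0 by (intro max.mono order.refl frac_le) auto
      finally show ?thesis .
    qed
    have near: "cmod (Z k s - w k) \<le> e" if s: "0 < s" "s < s2" and k: "k \<in> {1..m}" for s k
    proof -
      have ss: "s < s1" using s s2 by simp
      have "cmod (perturbed_poly m A (\<lambda>i. g i s) (w k)) \<le> cmod A * e ^ m" if k: "k \<in> {1..m}" for k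
      proof -
        have "perturbed_poly m A (\<lambda>i. g i s) (w k) = (\<Sum>i=1..<m. g i s * w k ^ i)"
          using w[OF k] A by (simp add: perturbed_poly_def)
        also have "cmod \<dots> \<le> real m * (K * s * W ^ m)"
          using gb[OF _ s(1) ss] wW[OF k] W1 K s \<sigma> by (intro perturbed_sum_bound) (auto simp: W_def)
        also have "\<dots> = C * s" by (simp add: C_def)
        also have "\<dots> \<le> C * (A0 * e ^ m / C)" using s C by (intro mult_left_mono) (auto simp: s2_def)
        also have "\<dots> = A0 * e ^ m" using C by simp
        also have "\<dots> \<le> cmod A * e ^ m" using AA e by (intro mult_right_mono) auto
        finally show ?thesis .
      qed
      then show ?thesis using mat[OF s(1) ss, of e] e \<sigma> k by (simp add: norm_minus_commute)
    qed
    show ?thesis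
    proof (intro allI impI; elim conjE)
      fix s k assume s: "0 < s" "s < s2" and k: "k \<in> {1..m}"
      have n: "cmod (Z k s - w k) \<le> e" by (rule near[OF s k])
      have "cmod (w k) \<le> cmod (Z k s) + cmod (Z k s - w k)"
        using norm_triangle_ineq4[of "Z k s" "Z k s - w k"] by simp
      then have Zl: "l0 / 2 < cmod (Z k s)" using w[OF k] n e \<sigma> by linarith
      have "cmod (Z k s) \<le> cmod (w k) + cmod (Z k s - w k)"
        by (rule norm_triangle_sub)
      then have ZW: "cmod (Z k s) \<le> W" using wW[OF k] n e \<sigma> unfolding W_def by linarith
      obtain D where D: "(Z k has_vector_derivative D) (at s)"
        "cmod D \<le> cmod (\<Sum>i=1..<m. g' i s * Z k s ^ i) / (cmod A * (\<sigma> / 2) ^ (m - 1))"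
      proof -
        have "\<exists>D. (Z k has_vector_derivative D) (at s) \<and>
          cmod D \<le> cmod (\<Sum>i=1..<m. g' i s * Z k s ^ i) / (cmod A * (\<sigma> / 2) ^ (m - 1))"
        proof (rule separated_roots_derivative[OF m A, of "{0<..<s2}" s g Z w \<sigma>])
          show "cmod (Z j t - w j) \<le> \<sigma> / 4" if "t \<in> {0<..<s2}" "j \<in> {1..m}" for t j
            using near[of t j] that e \<sigma> by auto
        qed (use s s2 fac sep \<sigma> gd k in auto)
        then show thesis using that by blast
      qed
      have "cmod (\<Sum>i=1..<m. g' i s * Z k s ^ i) \<le> C"
        unfolding C_def using gb s s2 ZW W1 K by (intro perturbed_sum_bound) auto
      then have "cmod D \<le> C / (A0 * (\<sigma> / 2) ^ (m - 1))"
        using AA A0 \<sigma> C by (intro order.trans[OF D(2)] frac_le mult_right_mono mult_pos_pos) auto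
      then have "s * cmod D \<le> s * C2" using s by (intro mult_left_mono) (auto simp: C2_def)
      also have "\<dots> \<le> \<kappa> * (l0 / 2) / C2 * C2" using s C2 by (intro mult_right_mono) (auto simp: s2_def)
      also have "\<dots> = \<kappa> * (l0 / 2)" using C2 by simp
      also have "\<dots> < \<kappa> * cmod (Z k s)" using Zl \<kappa> by (intro mult_strict_left_mono) auto
      finally have "s * cmod D < \<kappa> * cmod (Z k s)" .
      moreover have "Z k s \<noteq> 0" using Zl l0 by auto
      ultimately show "cmod (Z k s - w k) < \<epsilon> \<and> cmod (Z k s - w k) \<le> \<sigma> / 8 \<and> Z k s \<noteq> 0 \<and>
        (\<exists>D. (Z k has_vector_derivative D) (at s) \<and> s * cmod D < \<kappa> * cmod (Z k s))"
        using n e D(1) by auto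
    qed
  qed
  show ?thesis unfolding roots_controlled_def using s2 est by blast
qed

section \<open>Energy along the branch\<close>

text \<open>M_0 = a_1^2 + N_0 along the curve, where a_1^2 = 1 / y and |a_j|^2 = |c_j|^2
  y^j.\<close>

definition branch_energy :: "nat \<Rightarrow> (nat \<Rightarrow> real \<Rightarrow> complex) \<Rightarrow> real \<Rightarrow> real" where
  "branch_energy m c y = 1 / y + (\<Sum>j=2..m+1. real j * ((cmod (c j y))\<^sup>2 * y ^ j))"

definition branch_energy_deriv ::
    "nat \<Rightarrow> (nat \<Rightarrow> real \<Rightarrow> complex) \<Rightarrow> (nat \<Rightarrow> real \<Rightarrow> complex) \<Rightarrow> real \<Rightarrow> real" where
  "branch_energy_deriv m c c' y = - 1 / y\<^sup>2 +
     (\<Sum>j=2..m+1. real j * (2 * Re (c' j y * cnj (c j y)) * y ^ j + (cmod (c j y))\<^sup>2 * (real j * y ^ (j - 1))))"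

lemma has_real_derivative_cmod_square:
  assumes "(f has_vector_derivative f') (at y within S)"
  shows "((\<lambda>y. (cmod (f y))\<^sup>2) has_real_derivative 2 * Re (f' * cnj (f y))) (at y within S)"
proof -
  have d: "((\<lambda>y. Re (f y)) has_real_derivative Re f') (at y within S)" "((\<lambda>y. Im (f y)) has_real_derivative Im f') (at y within S)"
    using assms by (auto simp: has_vector_derivative_complex_iff)
  show ?thesis
    unfolding cmod_power2 using DERIV_add[OF DERIV_power[OF d(1), of 2] DERIV_power[OF d(2), of 2]]
    by (simp add: algebra_simps)
qed

lemma branch_energy_has_real_derivative:
  assumes "\<And>j. j \<in> {2..m+1} \<Longrightarrow> (c j has_vector_derivative c' j y) (at y)" "y \<noteq> 0"
  shows "(branch_energy m c has_real_derivative branch_energy_deriv m c c' y) (at y)"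
proof -
  have "((\<lambda>y. 1 / y) has_real_derivative - 1 / y\<^sup>2) (at y)"
    using assms(2) by (auto intro!: derivative_eq_intros simp: power2_eq_square divide_inverse)
  moreover have "((\<lambda>y. real j * ((cmod (c j y))\<^sup>2 * y ^ j)) has_real_derivative
      real j * (2 * Re (c' j y * cnj (c j y)) * y ^ j + (cmod (c j y))\<^sup>2 * (real j * y ^ (j - 1)))) (at y)"
    if "j \<in> {2..m+1}" for j
    by (rule derivative_eq_intros has_real_derivative_cmod_square[OF assms(1)[OF that]] refl)+
       (simp add: algebra_simps)
  ultimately show ?thesis
    unfolding branch_energy_def branch_energy_deriv_def by (intro DERIV_add DERIV_sum) auto
qed

text \<open>The sum is bounded by a constant C independent of y, and y C < 1 gives C < 1 / y <= 1 /
  y^2.\<close>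

lemma branch_energy_deriv_neg:
  assumes K: "K \<ge> 0" and c: "\<And>j. j \<in> {2..m+1} \<Longrightarrow> cmod (c j y) \<le> K \<and> cmod (c' j y) \<le> K"
    and y: "0 < y" "y < 1" "y * ((real (m+1))\<^sup>2 * (2 * K\<^sup>2 + K\<^sup>2 * real (m+1))) < 1"
  shows "branch_energy_deriv m c c' y < 0"
proof -
  define C where "C = (real (m+1))\<^sup>2 * (2 * K\<^sup>2 + K\<^sup>2 * real (m+1))"
  have "(\<Sum>j=2..m+1. real j * (2 * Re (c' j y * cnj (c j y)) * y ^ j + (cmod (c j y))\<^sup>2 * (real j * y ^ (j - 1))))
      \<le> (\<Sum>j=2..m+1. real (m+1) * (2 * K\<^sup>2 + K\<^sup>2 * real (m+1)))"
  proof (rule sum_mono)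
    fix j assume j: "j \<in> {2..m+1}"
    have "Re (c' j y * cnj (c j y)) \<le> cmod (c' j y) * cmod (c j y)"
      using complex_Re_le_cmod[of "c' j y * cnj (c j y)"] by (simp add: norm_mult)
    also have "\<dots> \<le> K * K" using c[OF j] K by (intro mult_mono) auto
    finally have "Re (c' j y * cnj (c j y)) \<le> K\<^sup>2" by (simp add: power2_eq_square)
    then have "2 * Re (c' j y * cnj (c j y)) * y ^ j \<le> 2 * K\<^sup>2 * y ^ j"
      using y by (intro mult_right_mono) auto
    also have "\<dots> \<le> 2 * K\<^sup>2 * 1"
      using y by (intro mult_left_mono power_le_one) auto
    finally have 1: "2 * Re (c' j y * cnj (c j y)) * y ^ j \<le> 2 * K\<^sup>2 * 1" .
    have 2: "(cmod (c j y))\<^sup>2 * (real j * y ^ (j - 1)) \<le> K\<^sup>2 * (real (m+1) * 1)"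
      using c[OF j] j y by (intro mult_mono power_mono power_le_one) auto
    show "real j * (2 * Re (c' j y * cnj (c j y)) * y ^ j + (cmod (c j y))\<^sup>2 * (real j * y ^ (j - 1)))
       \<le> real (m+1) * (2 * K\<^sup>2 + K\<^sup>2 * real (m+1))"
    proof -
      have "real j * (2 * Re (c' j y * cnj (c j y)) * y ^ j + (cmod (c j y))\<^sup>2 * (real j * y ^ (j - 1)))
        \<le> real j * (2 * K\<^sup>2 + K\<^sup>2 * real (m+1))" using 1 2 by (intro mult_left_mono) auto
      also have "\<dots> \<le> real (m+1) * (2 * K\<^sup>2 + K\<^sup>2 * real (m+1))" using j by (intro mult_right_mono) auto
      finally show ?thesis .
    qed
  qed
  also have "\<dots> \<le> real (m+1) * (real (m+1) * (2 * K\<^sup>2 + K\<^sup>2 * real (m+1)))"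
    unfolding sum_constant by (intro mult_right_mono) auto
  also have "\<dots> = C" by (simp add: C_def power2_eq_square)
  also have "C < 1 / y" using y by (simp add: C_def field_simps)
  also have "1 / y \<le> 1 / y\<^sup>2" using y by (intro divide_left_mono) (auto simp: power2_eq_square)
  finally show ?thesis by (simp add: branch_energy_deriv_def)
qed

text \<open>Cauchy's estimate on a disc of radius \<rho>/4, which stays inside the domain because
  |y| < \<rho>/2. It bounds the derivative of the branch uniformly in the moments.\<close>

lemma bounded_holomorphic_deriv_bound:
  assumes "c holomorphic_on ball 0 \<rho>" "\<And>y. cmod y < \<rho> \<Longrightarrow> cmod (c y) \<le> L" "cmod y < \<rho> / 2" "\<rho> > 0"
  shows "cmod (deriv c y) \<le> 4 * L / \<rho>"
proof -
  have sub: "cball y (\<rho> / 4) \<subseteq> ball 0 \<rho>"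
  proof
    fix x assume "x \<in> cball y (\<rho> / 4)"
    then have "cmod (x - y) \<le> \<rho> / 4" by (simp add: dist_norm norm_minus_commute)
    then show "x \<in> ball 0 \<rho>" using norm_triangle_sub[of x y] assms(3,4) by simp
  qed
  have "cmod ((deriv ^^ 1) c y) \<le> fact 1 * L / (\<rho> / 4) ^ 1"
  proof (rule Cauchy_inequality)
    show "c holomorphic_on ball y (\<rho> / 4)"
      using assms(1) sub ball_subset_cball by (meson holomorphic_on_subset order.trans)
    show "continuous_on (cball y (\<rho> / 4)) c"
      using assms(1) sub by (meson holomorphic_on_imp_continuous_on continuous_on_subset)
    show "cmod (c x) \<le> L" if "cmod (y - x) = \<rho> / 4" for x
      using that sub by (intro assms(2)) (auto simp: dist_norm subset_iff)
  qed (use assms in auto)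
  then show ?thesis by (simp add: mult.commute)
qed

text \<open>
  Scaled coefficients \<open>c\<close> of the polynomials with moments \<open>\<mu>\<close>, as functions of \<open>y = 1 / a\<^sub>1\<^sup>2\<close>:
  such a polynomial has \<open>a\<^sub>j = c j y / a\<^sub>1 ^ j\<close>, that is \<open>a\<^sub>j = c j y * sqrt y ^ j\<close>, for \<open>j \<ge> 2\<close>.
\<close>

definition moment_branch :: "nat \<Rightarrow> real \<Rightarrow> real \<Rightarrow> real \<Rightarrow> (nat \<Rightarrow> complex) \<Rightarrow>
    (nat \<Rightarrow> real \<Rightarrow> complex) \<Rightarrow> (nat \<Rightarrow> real \<Rightarrow> complex) \<Rightarrow> bool" where
  "moment_branch m M y1 K \<mu> c c' \<longleftrightarrow>
     (\<forall>j\<in>{2..m+1}. continuous_on {0<..<y1} (c' j) \<and>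
        (\<forall>y\<in>{0<..<y1}. (c j has_vector_derivative c' j y) (at y) \<and>
          cmod (c j y) \<le> 2 * M \<and> cmod (c' j y) \<le> K)) \<and>
     (\<forall>y\<in>{0<..<y1}. c (m+1) y = cnj (\<mu> m) \<and> branch_energy_deriv m c c' y < 0) \<and>
     (\<forall>a r. r > 0 \<and> 1 / r\<^sup>2 < y1 \<and> a 1 = of_real r \<longrightarrow>
        (\<forall>j\<in>{2..m+1}. a j = c j (1 / r\<^sup>2) / of_real r ^ j) \<longleftrightarrow>
        (\<forall>k\<in>{1..m}. moment m k a = \<mu> k) \<and> (\<forall>j\<in>{2..m+1}. r ^ j * cmod (a j) \<le> 2 * M))"

lemma moment_branch_exists:
  assumes m: "m \<ge> 1" and M: "M > 0"
  obtains y1 K where "0 < y1" "y1 \<le> 1" "0 < K" "2 * M \<le> K" "y1 * (2 * M * (real (m+1))\<^sup>2) < 1"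
    "\<And>\<mu>. (\<And>k. k \<in> {1..m} \<Longrightarrow> cmod (\<mu> k) \<le> M) \<Longrightarrow> \<exists>c c'. moment_branch m M y1 K \<mu> c c'"
proof -
  let ?J = "{2..m+1}"
  obtain \<rho> where \<rho>: "contraction_radius m M \<rho>" using contraction_radius_exists[OF M] by blast
  note \<rho>' = contraction_radius_pos[OF \<rho>]
  \<comment> \<open>The second summand is the Cauchy bound 4 (2 M) / \<rho> for c'; with the first,
    K bounds c as well.\<close>
  define K where "K = 2 * M + 8 * M / \<rho>"
  have K: "K > 0" "2 * M \<le> K" using M \<rho>' by (auto simp: K_def intro!: add_pos_pos)
  define C0 where "C0 = (real (m+1))\<^sup>2 * (2 * K\<^sup>2 + K\<^sup>2 * real (m+1))"
  define D0 where "D0 = 2 * M * (real (m+1))\<^sup>2"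
  have C0: "C0 \<ge> 0" "D0 \<ge> 0" using M by (auto simp: C0_def D0_def)
  \<comment> \<open>\<rho>/2 is for Cauchy's estimate, C0 for the monotonicity of the energy, D0 for
    local univalence on the closed disk; the summand 1 makes the last two inequalities
    strict.\<close>
  define y1 where "y1 = min (\<rho> / 2) (1 / (C0 + D0 + 1))"
  have y1: "0 < y1" "y1 \<le> 1" "y1 \<le> \<rho> / 2" "y1 * (C0 + D0 + 1) \<le> 1"
  proof -
    have "y1 * (C0 + D0 + 1) \<le> 1 / (C0 + D0 + 1) * (C0 + D0 + 1)"
      using C0 by (intro mult_right_mono) (auto simp: y1_def)
    then show "y1 * (C0 + D0 + 1) \<le> 1" using C0 by simp
  qed (use \<rho>' C0 in \<open>auto simp: y1_def\<close>)
  have y1C2: "y1 * D0 < 1" "y1 * C0 < 1"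
  proof -
    have "y1 * (C0 + D0 + 1) = y1 * C0 + y1 * D0 + y1" by (simp add: algebra_simps)
    moreover have "0 \<le> y1 * C0" "0 \<le> y1 * D0" using y1 C0 by auto
    ultimately show "y1 * D0 < 1" "y1 * C0 < 1" using y1 by linarith+
  qed
  show thesis
  proof (rule that[OF y1(1,2) K])
    show "y1 * (2 * M * (real (m+1))\<^sup>2) < 1" using y1C2 by (simp add: D0_def)
    fix \<mu> assume \<mu>: "\<And>k. k \<in> {1..m} \<Longrightarrow> cmod (\<mu> k) \<le> M"
    have \<mu>': "\<forall>k\<in>{1..m}. cmod (\<mu> k) \<le> M" using \<mu> by blast
    obtain C where C12: "\<forall>j\<in>?J. C j holomorphic_on ball 0 \<rho> \<and> (\<forall>y. cmod y < \<rho> \<longrightarrow> cmod (C j y) \<le> 2 * M)"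
      and C3: "\<forall>y. cmod y < \<rho> \<longrightarrow> C (m+1) y = cnj (\<mu> m)"
      and C4: "\<forall>a r. r > 0 \<and> 1 / r\<^sup>2 < \<rho> \<and> a 1 = of_real r \<and> (\<forall>k\<in>{1..m}. moment m k a = \<mu> k) \<and>
       (\<forall>j\<in>?J. r ^ j * cmod (a j) \<le> 2 * M) \<longrightarrow>
       (\<forall>j\<in>?J. a j = C j (of_real (1 / r\<^sup>2)) / of_real r ^ j)"
      and C5: "\<forall>a r. r > 0 \<and> 1 / r\<^sup>2 < \<rho> \<and> a 1 = of_real r \<and>
       (\<forall>j\<in>?J. a j = C j (of_real (1 / r\<^sup>2)) / of_real r ^ j) \<longrightarrow>
       (\<forall>k\<in>{1..m}. moment m k a = \<mu> k)"
      using coefficient_branch[OF \<rho> m M \<mu>'] by (elim exE conjE) (rule that)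
    have C1: "C j holomorphic_on ball 0 \<rho>" if "j \<in> ?J" for j using C12 that by blast
    have C2: "cmod (C j y) \<le> 2 * M" if "j \<in> ?J" "cmod y < \<rho>" for j y using C12 that by blast
    define c where "c j y = C j (complex_of_real y)" for j y
    define c' where "c' j y = deriv (C j) (complex_of_real y)" for j y
    have yin: "cmod (complex_of_real y) < \<rho> / 2" "cmod (complex_of_real y) < \<rho>" if "y \<in> {0<..<y1}" for y
      using that y1 by auto
    have cd: "(c j has_vector_derivative c' j y) (at y)" if "j \<in> ?J" "y \<in> {0<..<y1}" for j y
      unfolding c_def c'_def
      by (rule has_vector_derivative_real_field, rule holomorphic_derivI[OF C1[OF that(1)]]) (use yin that in auto)
    have cb: "cmod (c j y) \<le> 2 * M" "cmod (c' j y) \<le> K" if "j \<in> ?J" "y \<in> {0<..<y1}" for j y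
    proof -
      show "cmod (c j y) \<le> 2 * M" using C2 that yin by (auto simp: c_def)
      have "cmod (c' j y) \<le> 4 * (2 * M) / \<rho>" unfolding c'_def
        using C1[OF that(1)] C2[OF that(1)] yin[OF that(2)] \<rho>' by (intro bounded_holomorphic_deriv_bound) auto
      then show "cmod (c' j y) \<le> K" using M by (simp add: K_def)
    qed
    have cc: "continuous_on {0<..<y1} (c' j)" if "j \<in> ?J" for j
      unfolding c'_def
    proof (rule continuous_on_compose2[of "ball 0 \<rho>" "deriv (C j)"])
      show "continuous_on (ball 0 \<rho>) (deriv (C j))"
        using C1[OF that] by (intro holomorphic_on_imp_continuous_on holomorphic_deriv) auto
    qed (use yin in \<open>auto intro!: continuous_intros\<close>)
    have neg: "branch_energy_deriv m c c' y < 0" if y: "y \<in> {0<..<y1}" for y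
    proof (rule branch_energy_deriv_neg[of K])
      show "y * ((real (m+1))\<^sup>2 * (2 * K\<^sup>2 + K\<^sup>2 * real (m+1))) < 1"
      proof -
        have "y * ((real (m+1))\<^sup>2 * (2 * K\<^sup>2 + K\<^sup>2 * real (m+1))) \<le> y1 * ((real (m+1))\<^sup>2 * (2 * K\<^sup>2 + K\<^sup>2 * real (m+1)))"
          using y by (intro mult_right_mono) auto
        then show ?thesis using y1C2(2) unfolding C0_def by linarith
      qed
    qed (use y y1 K cb[OF _ y] in \<open>auto intro: order.trans\<close>)
    have iff: "(\<forall>j\<in>?J. a j = c j (1 / r\<^sup>2) / of_real r ^ j) \<longleftrightarrow>
        (\<forall>k\<in>{1..m}. moment m k a = \<mu> k) \<and> (\<forall>j\<in>?J. r ^ j * cmod (a j) \<le> 2 * M)"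
      if r: "r > 0" "1 / r\<^sup>2 < y1" "a 1 = of_real r" for a r
    proof -
      have r2: "1 / r\<^sup>2 < \<rho>" "1 / r\<^sup>2 \<in> {0<..<y1}" using r y1 \<rho>' by auto
      show ?thesis
      proof (intro iffI conjI)
        assume *: "\<forall>j\<in>?J. a j = c j (1 / r\<^sup>2) / of_real r ^ j"
        show "\<forall>k\<in>{1..m}. moment m k a = \<mu> k"
          using C5[THEN spec, of a, THEN spec, of r] r r2(1) * unfolding c_def by blast
        show "\<forall>j\<in>?J. r ^ j * cmod (a j) \<le> 2 * M"
          using * cb(1)[OF _ r2(2)] r(1) by (auto simp: norm_divide norm_power)
      next
        assume "(\<forall>k\<in>{1..m}. moment m k a = \<mu> k) \<and> (\<forall>j\<in>?J. r ^ j * cmod (a j) \<le> 2 * M)"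
        then show "\<forall>j\<in>?J. a j = c j (1 / r\<^sup>2) / of_real r ^ j"
          using C4[THEN spec, of a, THEN spec, of r] r r2(1) unfolding c_def by blast
      qed
    qed
    show "\<exists>c c'. moment_branch m M y1 K \<mu> c c'"
      unfolding moment_branch_def
    proof (rule exI[of _ c], rule exI[of _ c'], intro conjI)
      show "\<forall>j\<in>?J. continuous_on {0<..<y1} (c' j) \<and>
        (\<forall>y\<in>{0<..<y1}. (c j has_vector_derivative c' j y) (at y) \<and>
          cmod (c j y) \<le> 2 * M \<and> cmod (c' j y) \<le> K)"
        using cd cb cc by blast
      show "\<forall>y\<in>{0<..<y1}. c (m+1) y = cnj (\<mu> m) \<and> branch_energy_deriv m c c' y < 0"
      proof
        fix y assume y: "y \<in> {0<..<y1}"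
        show "c (m+1) y = cnj (\<mu> m) \<and> branch_energy_deriv m c c' y < 0"
          using neg[OF y] C3[rule_format, OF yin(2)[OF y]] by (simp add: c_def)
      qed
      show "\<forall>a r. r > 0 \<and> 1 / r\<^sup>2 < y1 \<and> a 1 = of_real r \<longrightarrow>
        (\<forall>j\<in>?J. a j = c j (1 / r\<^sup>2) / of_real r ^ j) \<longleftrightarrow>
        (\<forall>k\<in>{1..m}. moment m k a = \<mu> k) \<and> (\<forall>j\<in>?J. r ^ j * cmod (a j) \<le> 2 * M)"
      proof (intro allI impI)
        fix a :: "nat \<Rightarrow> complex" and r assume H: "r > 0 \<and> 1 / r\<^sup>2 < y1 \<and> a 1 = complex_of_real r"
        show "(\<forall>j\<in>?J. a j = c j (1 / r\<^sup>2) / of_real r ^ j) \<longleftrightarrow>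
          (\<forall>k\<in>{1..m}. moment m k a = \<mu> k) \<and> (\<forall>j\<in>?J. r ^ j * cmod (a j) \<le> 2 * M)"
          by (rule iff[where a = a and r = r, OF H[THEN conjunct1] H[THEN conjunct2, THEN conjunct1] H[THEN conjunct2, THEN conjunct2]])
      qed
    qed
  qed
qed

text \<open>On S the function y equals G o E, where G is the differentiable inverse of the
  decreasing h, so the regularity of y follows from that of E. This covers the existence proof,
  where y is merely picked by the intermediate value theorem.\<close>

lemma implicit_time_derivative:
  fixes h h' y E :: "real \<Rightarrow> real"
  assumes h: "\<And>x. x \<in> {0<..<y1} \<Longrightarrow> (h has_real_derivative h' x) (at x)"
    and neg: "\<And>x. x \<in> {0<..<y1} \<Longrightarrow> h' x < 0"
    and y: "\<And>t. t \<in> S \<Longrightarrow> y t \<in> {0<..<y1} \<and> h (y t) = E t"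
    and E: "(E has_real_derivative e) (at t within S)" and t: "t \<in> S"
  shows "(y has_real_derivative e / h' (y t)) (at t within S)"
proof -
  have dec: "h u > h v" if "u \<in> {0<..<y1}" "v \<in> {0<..<y1}" "u < v" for u v
  proof (rule DERIV_neg_imp_decreasing[OF that(3)])
    fix x assume "u \<le> x" "x \<le> v"
    then have "x \<in> {0<..<y1}" using that by auto
    then show "\<exists>D. (h has_real_derivative D) (at x) \<and> D < 0" using h neg by blast
  qed
  have inj: "inj_on h {0<..<y1}"
    using dec by (intro inj_onI) (metis linorder_neqE less_irrefl)
  define G where "G = the_inv_into {0<..<y1} h"
  have G: "G (h x) = x" if "x \<in> {0<..<y1}" for x
    unfolding G_def using inj that by (rule the_inv_into_f_f)
  have n: "h' (y t) \<noteq> 0" using neg y[OF t] by fastforce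
  have "(G has_derivative (*) (1 / h' (y t))) (at (h (y t)))"
  proof (rule has_derivative_inverse_strong[where f = h and S = "{0<..<y1}" and f' = "(*) (h' (y t))"])
    show "continuous_on {0<..<y1} h" using h by (intro DERIV_continuous_on[of _ _ h']) (auto intro: has_field_derivative_at_within)
    show "(h has_derivative (*) (h' (y t))) (at (y t))" using h y[OF t] by (simp add: has_field_derivative_def)
  qed (use G y[OF t] n in auto)
  then have GD: "(G has_real_derivative 1 / h' (y t)) (at (E t))"
    using y[OF t] by (simp add: has_field_derivative_def)
  have "((\<lambda>t. G (E t)) has_real_derivative (1 / h' (y t)) * e) (at t within S)"
    by (rule DERIV_chain2[OF GD E])
  then have "((\<lambda>t. G (E t)) has_real_derivative e / h' (y t)) (at t within S)" by simp
  then show ?thesis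
    by (rule has_field_derivative_transform_within[OF _ zero_less_one t]) (use G y in force)
qed

section \<open>Solutions stay on the branch\<close>

lemma deriv_polynomial_family:
  "deriv (\<lambda>z. polynomial_family m a z t) \<zeta> = poly (pderiv (coeff_poly m (\<lambda>j. a j t))) \<zeta>"
  unfolding polynomial_family_def poly_coeff_poly [symmetric] by (intro DERIV_imp_deriv poly_DERIV)

lemma moment_cong:
  assumes "\<And>j. j \<in> {1..m+1} \<Longrightarrow> a j = b j"
  shows "moment m k a = moment m k b"
proof -
  have "coeff_poly m a = coeff_poly m b" unfolding coeff_poly_def using assms by (intro sum.cong) auto
  then show ?thesis unfolding moment_def using assms by (intro arg_cong2[of _ _ _ _ "(/)"] sum.cong) auto
qed

lemma N0_cong:
  assumes "\<And>j. j \<in> {2..m+1} \<Longrightarrow> a j = b j"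
  shows "N0 m a = N0 m b"
  unfolding N0_def using assms by (intro sum.cong) auto

text \<open>A solution is given through its values, differentiable in t for each fixed \<zeta>.
  Writing a coefficient as a finite mean of values transfers differentiability to it; m + 2 points
  suffice for degree m + 1.\<close>

lemma coefficient_eq_unity_mean:
  assumes "j \<in> {1..m+1}"
  shows "a j t = unity_mean (m + 2) (\<lambda>z. polynomial_family m a z t * cnj (z ^ j))"
proof -
  have "unity_mean (m + 2) (\<lambda>z. poly (coeff_poly m (\<lambda>j. a j t)) z * cnj (poly (monom 1 j) z))
      = (\<Sum>n<m+2. coeff (coeff_poly m (\<lambda>j. a j t)) n * cnj (coeff (monom 1 j) n))"
    using assms degree_coeff_poly[of m "\<lambda>j. a j t"]
    by (intro unity_mean_poly_mult_cnj) (auto simp: degree_monom_eq)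
  also have "\<dots> = (\<Sum>n<m+2. if n = j then a j t else 0)"
    using assms by (intro sum.cong) (auto simp: coeff_coeff_poly)
  also have "\<dots> = a j t" using assms by (subst sum.delta) auto
  finally show ?thesis by (simp add: polynomial_family_def poly_coeff_poly poly_monom)
qed

lemma within_atLeast_neq_bot: "0 \<le> t \<Longrightarrow> at t within {0..} \<noteq> (bot :: real filter)"
  unfolding trivial_limit_within
  using islimpt_subset[OF islimpt_greaterThanLessThan1[of t "t + 1"], of "{0..}"]
  by (simp add: subset_iff)

lemma polynomial_family_has_vector_derivative:
  assumes "\<And>j. j \<in> {1..m+1} \<Longrightarrow> (a j has_vector_derivative a' j) (at t within S)"
  shows "((\<lambda>s. polynomial_family m a \<zeta> s) has_vector_derivative poly (coeff_poly m a') \<zeta>) (at t within S)"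
  unfolding polynomial_family_def polynomial_map_def poly_coeff_poly
  by (intro has_vector_derivative_sum has_vector_derivative_mult_left assms)

lemma solution_coefficients:
  assumes sol: "locally_univalent_solution q {0..} (polynomial_family m a)" and t: "t \<ge> 0"
  obtains a' where "\<And>j. j \<in> {1..m+1} \<Longrightarrow> (a j has_vector_derivative a' j) (at t within {0..})"
    "\<And>z. cmod z = 1 \<Longrightarrow> Re (poly (coeff_poly m a') z * cnj (z * poly (pderiv (coeff_poly m (\<lambda>j. a j t))) z)) = q t"
proof -
  have "\<exists>d. (a j has_vector_derivative d) (at t within {0..})" if j: "j \<in> {1..m+1}" for j
  proof -
    define \<xi> where "\<xi> i = cis (2 * pi * real i / real (m + 2))" for i
    have "((\<lambda>s. polynomial_family m a (\<xi> i) s) has_vector_derivative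
        vector_derivative (\<lambda>s. polynomial_family m a (\<xi> i) s) (at t within {0..})) (at t within {0..})" for i
      using sol t unfolding locally_univalent_solution_def vector_derivative_works [symmetric]
      by (auto simp: \<xi>_def)
    then have "((\<lambda>s. (\<Sum>i<m+2. polynomial_family m a (\<xi> i) s * cnj (\<xi> i ^ j)) / of_nat (m + 2)) has_vector_derivative
      (\<Sum>i<m+2. vector_derivative (\<lambda>s. polynomial_family m a (\<xi> i) s) (at t within {0..}) * cnj (\<xi> i ^ j)) / of_nat (m + 2))
      (at t within {0..})"
      by (intro has_vector_derivative_divide has_vector_derivative_sum has_vector_derivative_mult_left)
    moreover have "a j = (\<lambda>s. (\<Sum>i<m+2. polynomial_family m a (\<xi> i) s * cnj (\<xi> i ^ j)) / of_nat (m + 2))"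
      using coefficient_eq_unity_mean[OF j, of a] by (auto simp: unity_mean_def \<xi>_def fun_eq_iff)
    ultimately show ?thesis by auto
  qed
  then obtain a' where a': "\<And>j. j \<in> {1..m+1} \<Longrightarrow> (a j has_vector_derivative a' j) (at t within {0..})"
    by metis
  show thesis
  proof (rule that[OF a'])
    fix z :: complex assume z: "cmod z = 1"
    have "vector_derivative (\<lambda>s. polynomial_family m a z s) (at t within {0..}) = poly (coeff_poly m a') z"
      by (rule vector_derivative_within[OF within_atLeast_neq_bot[OF t] polynomial_family_has_vector_derivative[OF a']])
    then show "Re (poly (coeff_poly m a') z * cnj (z * poly (pderiv (coeff_poly m (\<lambda>j. a j t))) z)) = q t"
      using sol[unfolded locally_univalent_solution_def, THEN conjunct2, THEN conjunct2, THEN conjunct2, rule_format, of t z]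
        t z by (simp add: deriv_polynomial_family)
  qed
qed

lemma solution_a1:
  assumes sol: "locally_univalent_solution q {0..} (polynomial_family m a)" and t: "t \<ge> 0"
  shows "a 1 t = of_real (Re (a 1 t))" "Re (a 1 t) > 0"
proof -
  have "deriv (\<lambda>z. polynomial_family m a z t) 0 = a 1 t"
    by (simp add: deriv_polynomial_family poly_0_coeff_0 coeff_pderiv coeff_coeff_poly)
  then have "a 1 t \<in> \<real> \<and> Re (a 1 t) > 0"
    using sol t unfolding locally_univalent_solution_def by (metis atLeast_iff)
  then show "a 1 t = of_real (Re (a 1 t))" "Re (a 1 t) > 0" by (auto simp: of_real_Re)
qed

text \<open>The rate is 2 q times the constant coefficient of f^k, which vanishes for k >= 1 because
  f(0) = 0.\<close>

lemma solution_moment_derivative: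
  assumes sol: "locally_univalent_solution q {0..} (polynomial_family m a)" and t: "t \<ge> 0"
  shows "((\<lambda>t. moment m k (\<lambda>j. a j t)) has_vector_derivative (if k = 0 then 2 * of_real (q t) else 0)) (at t within {0..})"
proof -
  obtain a' where a': "\<And>j. j \<in> {1..m+1} \<Longrightarrow> (a j has_vector_derivative a' j) (at t within {0..})"
    "\<And>z. cmod z = 1 \<Longrightarrow> Re (poly (coeff_poly m a') z * cnj (z * poly (pderiv (coeff_poly m (\<lambda>j. a j t))) z)) = q t"
    using solution_coefficients[OF sol t] by blast
  have "moment_rate m (\<lambda>j. a j t) a' (coeff_poly m (\<lambda>j. a j t) ^ k) = 2 * of_real (q t) * coeff (coeff_poly m (\<lambda>j. a j t) ^ k) 0"
    by (rule PG_imp_moment_rate[OF a'(2)])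
  also have "\<dots> = (if k = 0 then 2 * of_real (q t) else 0)"
    by (simp add: coeff_0_power coeff_coeff_poly)
  finally show ?thesis
    using moment_has_vector_derivative[of m a a' t "{0..}" k, OF a'(1)] by simp
qed

lemma solution_moment_constant:
  assumes sol: "locally_univalent_solution q {0..} (polynomial_family m a)" and t: "t \<ge> 0" and k: "k \<ge> 1"
  shows "moment m k (\<lambda>j. a j t) = moment m k (\<lambda>j. a j 0)"
proof -
  obtain c where "\<And>t. t \<in> {0..} \<Longrightarrow> moment m k (\<lambda>j. a j t) = c"
    by (rule has_vector_derivative_zero_constant[of "{0..}" "\<lambda>t. moment m k (\<lambda>j. a j t)"])
       (use solution_moment_derivative[OF sol, of _ k] k in auto)
  then show ?thesis using t by simp
qed

lemma solution_energy:
  assumes sol: "locally_univalent_solution q {0..} (polynomial_family m a)" and t: "t \<ge> 0"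
  defines "E \<equiv> \<lambda>t. (Re (a 1 t))\<^sup>2 + N0 m (\<lambda>j. a j t)"
  shows "(E has_real_derivative 2 * q t) (at t within {0..})"
    and "E t = E 0 + 2 * integral {0..t} q"
proof -
  have mE: "moment m 0 (\<lambda>j. a j t) = of_real (E t)" if "t \<ge> 0" for t
    unfolding E_def using solution_a1[OF sol that] by (intro moment_0) auto
  have D: "(E has_real_derivative 2 * q t) (at t within {0..})" if t: "t \<ge> 0" for t
  proof -
    have "((\<lambda>t. Re (moment m 0 (\<lambda>j. a j t))) has_real_derivative Re (2 * of_real (q t))) (at t within {0..})"
      using solution_moment_derivative[OF sol t, of 0] by (simp add: has_vector_derivative_complex_iff)
    then have "((\<lambda>t. Re (moment m 0 (\<lambda>j. a j t))) has_real_derivative 2 * q t) (at t within {0..})" by simp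
    then show ?thesis
      by (rule has_field_derivative_transform_within[OF _ zero_less_one]) (use t mE in auto)
  qed
  then show "(E has_real_derivative 2 * q t) (at t within {0..})" using t by blast
  have "((\<lambda>t. 2 * q t) has_integral (E t - E 0)) {0..t}"
  proof (rule fundamental_theorem_of_calculus[OF t])
    fix x assume "x \<in> {0..t}"
    then show "(E has_vector_derivative 2 * q x) (at x within {0..t})"
      using D[of x] by (auto simp: has_real_derivative_iff_has_vector_derivative intro: has_vector_derivative_within_subset)
  qed
  then have "E t - E 0 = integral {0..t} (\<lambda>t. 2 * q t)" by (rule integral_unique [symmetric])
  then show "E t = E 0 + 2 * integral {0..t} q" by simp
qed

lemma moment_branch_energy:
  assumes r: "r > 0" and a: "\<And>j. j \<in> {2..m+1} \<Longrightarrow> a j = c j (1 / r\<^sup>2) / of_real r ^ j"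
  shows "r\<^sup>2 + N0 m a = branch_energy m c (1 / r\<^sup>2)"
proof -
  have "N0 m a = (\<Sum>j=2..m+1. real j * ((cmod (c j (1 / r\<^sup>2)))\<^sup>2 * (1 / r\<^sup>2) ^ j))"
    unfolding N0_def
  proof (rule sum.cong)
    fix j assume "j \<in> {2..m+1}"
    then have "(cmod (a j))\<^sup>2 = (cmod (c j (1 / r\<^sup>2)))\<^sup>2 * (1 / r\<^sup>2) ^ j"
      using r by (simp add: a norm_divide norm_power power_divide power_one_over power_mult [symmetric] mult.commute)
    then show "real j * (cmod (a j))\<^sup>2 = real j * ((cmod (c j (1 / r\<^sup>2)))\<^sup>2 * (1 / r\<^sup>2) ^ j)" by simp
  qed simp
  then show ?thesis by (simp add: branch_energy_def)
qed

lemma admissible_source_integral_nonneg: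
  assumes "admissible_source q"
  shows "0 \<le> integral {0..t} q"
proof -
  have "continuous_on {0..} q" and qp: "\<And>t. t \<ge> 0 \<Longrightarrow> q t > 0"
    using assms by (simp_all add: admissible_source_def)
  then have "q integrable_on {0..t}"
    by (intro integrable_continuous_real) (auto elim: continuous_on_subset)
  then show ?thesis
    by (rule Henstock_Kurzweil_Integration.integral_nonneg) (simp add: qp less_imp_le)
qed

lemma moment_boundD:
  assumes "moment_bound m a M"
  shows "k \<in> {1..m} \<Longrightarrow> cmod (moment m k a) \<le> M" "N0 m a \<le> M\<^sup>2"
proof -
  show "k \<in> {1..m} \<Longrightarrow> cmod (moment m k a) \<le> M"
    using assms by (simp add: moment_bound_def harmonic_moment_polynomial_map)
  show "N0 m a \<le> M\<^sup>2"
    using assms by (simp add: moment_bound_def sqrt_le_D)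
qed

lemma a_priori_radiusD:
  assumes "a_priori_radius m M R" "r \<ge> R" "a 1 = of_real r" "N0 m a \<le> (2 * M)\<^sup>2"
    "\<And>k. k \<in> {1..m} \<Longrightarrow> cmod (moment m k a) \<le> M"
  shows "\<forall>j\<in>{2..m+1}. r ^ j * cmod (a j) \<le> 2 * M" "N0 m a < M\<^sup>2"
  using assms(1)[unfolded a_priori_radius_def, THEN conjunct2, THEN spec, of a, THEN spec, of r] assms(2-)
  by blast+

text \<open>A continuity argument: N_0 starts at or below M^2, and at a time where it equals M^2 the
  a priori bound would make it smaller. The bound stays applicable because M_0 = a_1^2 + N_0 never
  decreases, which keeps a_1 large.\<close>

lemma solution_on_branch:
  assumes M: "M > 0" and R: "a_priori_radius m M R" and y1: "0 < y1" "y1 \<le> 1"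
    and q: "admissible_source q" and sol: "global_polynomial_solution q m a0 a"
    and mb: "moment_bound m a0 M" and r0: "Re (a0 1) > R + 2 * M + 1 / y1"
    and br: "moment_branch m M y1 K (\<lambda>k. moment m k a0) c c'" and t: "t \<ge> 0"
  shows "Re (a 1 t) > 0" "a 1 t = of_real (Re (a 1 t))" "1 / (Re (a 1 t))\<^sup>2 < y1"
    "\<forall>j\<in>{2..m+1}. a j t = c j (1 / (Re (a 1 t))\<^sup>2) / of_real (Re (a 1 t)) ^ j"
proof -
  have lus: "locally_univalent_solution q {0..} (polynomial_family m a)" and init: "\<And>j. j \<in> {1..m+1} \<Longrightarrow> a j 0 = a0 j"
    using sol by (auto simp: global_polynomial_solution_def)
  note a1 = solution_a1[OF lus]
  define n where "n t = N0 m (\<lambda>j. a j t)" for t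
  define r where "r t = Re (a 1 t)" for t
  have R1: "R \<ge> 1" using R by (simp add: a_priori_radius_def)
  have mom: "moment m k (\<lambda>j. a j t) = moment m k a0" if "t \<ge> 0" "k \<ge> 1" for k t
    using solution_moment_constant[OF lus that] moment_cong[of m "\<lambda>j. a j 0" a0 k] init by simp
  have mom_le: "cmod (moment m k (\<lambda>j. a j t)) \<le> M" if "t \<ge> 0" "k \<in> {1..m}" for t k
    using moment_boundD(1)[OF mb that(2)] mom[of t k] that by simp
  have "n 0 = N0 m a0" unfolding n_def using init by (intro N0_cong) auto
  then have n0: "n 0 \<le> M\<^sup>2" using moment_boundD(2)[OF mb] by simp
  have energy: "(r 0)\<^sup>2 + n 0 \<le> (r t)\<^sup>2 + n t" if t: "t \<ge> 0" for t
    using solution_energy(2)[OF lus t] admissible_source_integral_nonneg[OF q, of t] by (simp add: n_def r_def)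
  have r0': "r 0 > R + 2 * M + 1 / y1" using r0 init[of 1] by (simp add: r_def)
  \<comment> \<open>Growth of N_0 up to 4 M^2 can lower a_1^2 by at most 4 M^2. The summand 2 M of
    the threshold pays for this, since X^2 + (2 M)^2 <= (X + 2 M)^2 for X >= 0.\<close>
  have rt: "r t > R + 1 / y1" if t: "t \<ge> 0" and n: "n t \<le> (2 * M)\<^sup>2" for t
  proof -
    have "n 0 \<ge> 0" by (simp add: n_def N0_def sum_nonneg)
    then have "(r 0)\<^sup>2 \<le> (r t)\<^sup>2 + (2 * M)\<^sup>2" using energy[OF t] n by linarith
    moreover have "(R + 1 / y1 + 2 * M)\<^sup>2 < (r 0)\<^sup>2"
      using r0' R1 M y1 by (intro power_strict_mono) auto
    moreover have "(R + 1 / y1)\<^sup>2 + (2 * M)\<^sup>2 \<le> (R + 1 / y1 + 2 * M)\<^sup>2"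
      using R1 M y1 by (simp add: power2_sum)
    ultimately have "(R + 1 / y1)\<^sup>2 < (r t)\<^sup>2" by linarith
    then show ?thesis by (rule power2_less_imp_less) (use a1(2)[OF t] in \<open>simp add: r_def\<close>)
  qed
  have ap: "(\<forall>j\<in>{2..m+1}. r t ^ j * cmod (a j t) \<le> 2 * M) \<and> n t < M\<^sup>2" if t: "t \<ge> 0" and n: "n t \<le> (2 * M)\<^sup>2" for t
  proof -
    have "1 / y1 > 0" using y1 by simp
    then have "r t \<ge> R" using rt[OF t n] by linarith
    moreover have "a 1 t = of_real (r t)" using a1(1)[OF t] by (simp add: r_def)
    ultimately show ?thesis
      using a_priori_radiusD[where r = "r t" and a = "\<lambda>j. a j t", OF R] mom_le[OF t] n unfolding n_def by blast
  qed
  have M2: "M\<^sup>2 \<le> (2 * M)\<^sup>2" by (simp add: power_mult_distrib)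
  have nt: "n t < M\<^sup>2" if t: "t \<ge> 0" for t
  proof (rule ccontr)
    assume "\<not> n t < M\<^sup>2"
    moreover have "continuous_on {0..t} n"
      unfolding n_def N0_def
    proof (intro continuous_intros)
      fix j assume j: "j \<in> {2..m+1}"
      show "continuous_on {0..t} (a j)"
        unfolding continuous_on_eq_continuous_within
      proof
        fix x assume x: "x \<in> {0..t}"
        then have "0 \<le> x" by simp
        then obtain a' where "\<And>j. j \<in> {1..m+1} \<Longrightarrow> (a j has_vector_derivative a' j) (at x within {0..})"
          using solution_coefficients[OF lus] by metis
        then have "(a j has_vector_derivative a' j) (at x within {0..})" using j by auto
        then have "continuous (at x within {0..}) (a j)" by (rule has_vector_derivative_continuous)
        then show "continuous (at x within {0..t}) (a j)" by (rule continuous_within_subset) auto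
      qed
    qed
    ultimately obtain s where s: "0 \<le> s" "n s = M\<^sup>2"
      using IVT'[of n 0 "M\<^sup>2" t] n0 t by auto
    then show False using ap[OF s(1)] M2 by simp
  qed
  have nt': "n t \<le> (2 * M)\<^sup>2" using nt[OF t] M2 by linarith
  show pos: "Re (a 1 t) > 0" and re: "a 1 t = of_real (Re (a 1 t))" using a1[OF t] by auto
  show y: "1 / (Re (a 1 t))\<^sup>2 < y1"
  proof -
    have "1 / y1 > 0" using y1 by simp
    then have "1 / y1 < r t" "1 \<le> r t" using rt[OF t nt'] R1 by linarith+
    then have "1 / y1 < r t * r t" using mult_left_mono[of 1 "r t" "r t"] by linarith
    then show ?thesis using y1 pos by (simp add: r_def power2_eq_square field_simps)
  qed
  have "\<forall>k\<in>{1..m}. moment m k (\<lambda>j. a j t) = moment m k a0" using mom[OF t] by simp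
  then show "\<forall>j\<in>{2..m+1}. a j t = c j (1 / (Re (a 1 t))\<^sup>2) / of_real (Re (a 1 t)) ^ j"
    using br[unfolded moment_branch_def, THEN conjunct2, THEN conjunct2, THEN spec, of "\<lambda>j. a j t", THEN spec, of "Re (a 1 t)"]
      pos re y ap[OF t nt'] by (simp add: r_def)
qed

lemma continuous_on_branch_energy_deriv:
  assumes "moment_branch m M y1 K \<mu> c c'"
  shows "continuous_on {0<..<y1} (branch_energy_deriv m c c')"
proof -
  have c: "continuous_on {0<..<y1} (c j)" "continuous_on {0<..<y1} (c' j)" if "j \<in> {2..m+1}" for j
  proof -
    have "\<forall>y\<in>{0<..<y1}. isCont (c j) y"
      using assms that unfolding moment_branch_def by (blast intro: has_vector_derivative_continuous)
    then show "continuous_on {0<..<y1} (c j)" by (simp add: continuous_at_imp_continuous_on)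
  qed (use assms that in \<open>auto simp: moment_branch_def\<close>)
  show ?thesis
    unfolding branch_energy_deriv_def
    by (intro continuous_intros c) auto
qed

lemma branch_time_derivative:
  assumes br: "moment_branch m M y1 K \<mu> c c'"
    and y: "\<And>t. t \<in> S \<Longrightarrow> y t \<in> {0<..<y1} \<and> branch_energy m c (y t) = E t"
    and E: "(E has_real_derivative e) (at t within S)" and t: "t \<in> S"
  shows "(y has_real_derivative e / branch_energy_deriv m c c' (y t)) (at t within S)"
proof (rule implicit_time_derivative[where h = "branch_energy m c" and h' = "branch_energy_deriv m c c'", OF _ _ y E t])
  show "(branch_energy m c has_real_derivative branch_energy_deriv m c c' x) (at x)" if "x \<in> {0<..<y1}" for x
    using br that unfolding moment_branch_def by (intro branch_energy_has_real_derivative) auto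
  show "branch_energy_deriv m c c' x < 0" if "x \<in> {0<..<y1}" for x
    using br that unfolding moment_branch_def by auto
qed

lemma branch_energy_strict_antimono:
  assumes br: "moment_branch m M y1 K \<mu> c c'" and "0 < u" "u < v" "v < y1"
  shows "branch_energy m c v < branch_energy m c u"
proof (rule DERIV_neg_imp_decreasing[OF assms(3)])
  fix x assume "u \<le> x" "x \<le> v"
  then have x: "x \<in> {0<..<y1}" using assms by auto
  then have "(branch_energy m c has_real_derivative branch_energy_deriv m c c' x) (at x)"
    using br unfolding moment_branch_def by (intro branch_energy_has_real_derivative) auto
  then show "\<exists>D. (branch_energy m c has_real_derivative D) (at x) \<and> D < 0"
    using br x unfolding moment_branch_def by blast
qed

section \<open>Existence\<close>

definition branch_curve :: "(nat \<Rightarrow> real \<Rightarrow> complex) \<Rightarrow> nat \<Rightarrow> real \<Rightarrow> complex" where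
  "branch_curve c j y = (if j = 1 then of_real (1 / sqrt y) else c j y * of_real (sqrt y ^ j))"

lemma branch_curve_has_vector_derivative:
  assumes br: "moment_branch m M y1 K \<mu> c c'" and j: "j \<in> {1..m+1}"
  shows "\<exists>G'. continuous_on {0<..<y1} G' \<and>
    (\<forall>y\<in>{0<..<y1}. (branch_curve c j has_vector_derivative G' y) (at y))"
proof (cases "j = 1")
  case True
  show ?thesis
  proof (intro exI[of _ "\<lambda>y. of_real (- (inverse (sqrt y) / 2) / (sqrt y)\<^sup>2)"] conjI ballI)
    show "continuous_on {0<..<y1} (\<lambda>y. complex_of_real (- (inverse (sqrt y) / 2) / (sqrt y)\<^sup>2))"
      by (intro continuous_intros) auto
    fix y assume y: "y \<in> {0<..<y1}"
    have "((\<lambda>y. 1 / sqrt y) has_real_derivative - (inverse (sqrt y) / 2) / (sqrt y)\<^sup>2) (at y)"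
      using y by (auto intro!: derivative_eq_intros simp: power2_eq_square)
    then show "(branch_curve c j has_vector_derivative of_real (- (inverse (sqrt y) / 2) / (sqrt y)\<^sup>2)) (at y)"
      unfolding branch_curve_def True by (simp only: if_True refl) (rule has_vector_derivative_of_real)
  qed
next
  case False
  then have j2: "j \<in> {2..m+1}" using j by auto
  define S where "S y = real j * sqrt y ^ (j - 1) * (inverse (sqrt y) / 2)" for y
  have cd: "(c j has_vector_derivative c' j y) (at y)" if "y \<in> {0<..<y1}" for y
    using br j2 that unfolding moment_branch_def by blast
  then have cc: "continuous_on {0<..<y1} (c j)"
    by (intro continuous_at_imp_continuous_on ballI has_vector_derivative_continuous)
  show ?thesis
  proof (intro exI[of _ "\<lambda>y. c j y * of_real (S y) + c' j y * of_real (sqrt y ^ j)"] conjI ballI)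
    have "continuous_on {0<..<y1} (c' j)" using br j2 unfolding moment_branch_def by blast
    then show "continuous_on {0<..<y1} (\<lambda>y. c j y * of_real (S y) + c' j y * of_real (sqrt y ^ j))"
      unfolding S_def by (intro continuous_intros cc) auto
    fix y assume y: "y \<in> {0<..<y1}"
    have "((\<lambda>y. sqrt y ^ j) has_real_derivative S y) (at y)"
      using y unfolding S_def by (auto intro!: derivative_eq_intros)
    then have "((\<lambda>y. c j y * of_real (sqrt y ^ j)) has_vector_derivative
        c j y * of_real (S y) + c' j y * of_real (sqrt y ^ j)) (at y)"
      using cd[OF y] by (intro has_vector_derivative_mult has_vector_derivative_of_real)
    moreover have "branch_curve c j = (\<lambda>y. c j y * of_real (sqrt y ^ j))"
      using False by (simp add: branch_curve_def fun_eq_iff)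
    ultimately show "(branch_curve c j has_vector_derivative c j y * of_real (S y) + c' j y * of_real (sqrt y ^ j)) (at y)"
      by simp
  qed
qed

lemma branch_curve_moments:
  assumes br: "moment_branch m M y1 K \<mu> c c'" and y: "0 < y" "y < y1"
  shows "\<forall>k\<in>{1..m}. moment m k (\<lambda>j. branch_curve c j y) = \<mu> k"
    "moment m 0 (\<lambda>j. branch_curve c j y) = of_real (branch_energy m c y)"
    "\<forall>j\<in>{2..m+1}. (1 / sqrt y) ^ j * cmod (branch_curve c j y) \<le> 2 * M"
proof -
  define r where "r = 1 / sqrt y"
  have r: "r > 0" "1 / r\<^sup>2 = y" using y by (auto simp: r_def power_divide)
  have a: "branch_curve c j y = c j (1 / r\<^sup>2) / of_real r ^ j" if "j \<in> {2..m+1}" for j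
    using that y unfolding r(2) by (simp add: branch_curve_def r_def power_divide)
  have a1: "branch_curve c 1 y = of_real r" by (simp add: branch_curve_def r_def)
  have "(\<forall>k\<in>{1..m}. moment m k (\<lambda>j. branch_curve c j y) = \<mu> k) \<and> (\<forall>j\<in>{2..m+1}. r ^ j * cmod (branch_curve c j y) \<le> 2 * M)"
    using br[unfolded moment_branch_def, THEN conjunct2, THEN conjunct2, THEN spec, of "\<lambda>j. branch_curve c j y", THEN spec, of r]
      r y a a1 by simp
  then show "\<forall>k\<in>{1..m}. moment m k (\<lambda>j. branch_curve c j y) = \<mu> k"
    "\<forall>j\<in>{2..m+1}. (1 / sqrt y) ^ j * cmod (branch_curve c j y) \<le> 2 * M" by (auto simp: r_def)
  show "moment m 0 (\<lambda>j. branch_curve c j y) = of_real (branch_energy m c y)"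
    using moment_0[of "\<lambda>j. branch_curve c j y" r m, OF a1] moment_branch_energy[where r = r and a = "\<lambda>j. branch_curve c j y" and c = c and m = m, OF r(1) a]
    by (simp only: r(2))
qed

text \<open>The term a_1 = r dominates f' on the closed disk: the others add up to at most (m+1)^2 *
  2 M / r = r * y * 2 M (m+1)^2 < r.\<close>

lemma branch_curve_locally_univalent:
  assumes br: "moment_branch m M y1 K \<mu> c c'" and y1: "y1 \<le> 1" "y1 * (2 * M * (real (m+1))\<^sup>2) < 1"
    and M: "M > 0" and y: "0 < y" "y < y1" and z: "cmod z \<le> 1"
  shows "poly (pderiv (coeff_poly m (\<lambda>j. branch_curve c j y))) z \<noteq> 0"
proof -
  define r where "r = 1 / sqrt y"
  have r: "r > 0" "r\<^sup>2 * y = 1" using y by (auto simp: r_def power_divide)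
  have r1: "r \<ge> 1" using y y1 real_sqrt_le_1_iff[of y] by (simp add: r_def)
  define a where "a j = branch_curve c j y" for j
  have aj: "cmod (a j) \<le> 2 * M / r" if j: "j \<in> {2..m+1}" for j
  proof -
    have "r * cmod (a j) \<le> r ^ j * cmod (a j)"
      using j r1 power_increasing[of 1 j r] by (intro mult_right_mono) auto
    also have "\<dots> \<le> 2 * M" using branch_curve_moments(3)[OF br y] j by (simp add: a_def r_def)
    finally show ?thesis using r by (simp add: field_simps)
  qed
  have "poly (pderiv (coeff_poly m a)) z = of_real r + (\<Sum>j=2..m+1. of_nat j * a j * z ^ (j - 1))"
    unfolding poly_pderiv_coeff_poly
    by (subst sum.atLeast_Suc_atMost) (simp_all add: a_def branch_curve_def r_def numeral_2_eq_2 del: sum.cl_ivl_Suc)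
  moreover have "cmod (\<Sum>j=2..m+1. of_nat j * a j * z ^ (j - 1)) < r"
  proof -
    have "cmod (\<Sum>j=2..m+1. of_nat j * a j * z ^ (j - 1)) \<le> (\<Sum>j=2..m+1. real (m+1) * (2 * M / r) * 1)"
    proof (rule sum_norm_le)
      fix j assume j: "j \<in> {2..m+1}"
      have "real j * cmod (a j) * cmod z ^ (j - 1) \<le> real (m+1) * (2 * M / r) * 1"
        using aj[OF j] j z M r by (intro mult_mono power_le_one) auto
      then show "cmod (of_nat j * a j * z ^ (j - 1)) \<le> real (m+1) * (2 * M / r) * 1"
        by (simp only: norm_mult norm_power norm_of_nat)
    qed
    also have "\<dots> \<le> real (m+1) * (real (m+1) * (2 * M / r) * 1)"
      unfolding sum_constant using M r by (intro mult_right_mono) auto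
    also have "\<dots> = r * (y * (2 * M * (real (m+1))\<^sup>2))"
    proof -
      have "2 * M / r = 2 * M * (r * y)" using r by (simp add: field_simps power2_eq_square)
      then show ?thesis by (simp add: power2_eq_square)
    qed
    also have "\<dots> \<le> r * (y1 * (2 * M * (real (m+1))\<^sup>2))"
      using r y M by (intro mult_left_mono mult_right_mono) auto
    also have "\<dots> < r * 1" using y1 r by (intro mult_strict_left_mono) auto
    finally show ?thesis by simp
  qed
  ultimately have "cmod (of_real r - poly (pderiv (coeff_poly m a)) z) < cmod (of_real r)"
    using r by simp
  then show ?thesis unfolding a_def by auto
qed

lemma has_real_derivative_integral_atLeast:
  assumes "continuous_on {0..} q" "0 \<le> t"
  shows "((\<lambda>t. integral {0..t} q) has_real_derivative q t) (at t within {0..})"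
proof -
  have "((\<lambda>t. integral {0..t} q) has_real_derivative q t) (at t within {0..t+1})"
    using assms by (intro integral_has_real_derivative continuous_on_subset[OF assms(1)]) auto
  moreover have "at t within {0..t+1} = at t within {0..}"
    by (rule at_within_nhd[of _ "{..<t+1}"]) auto
  ultimately show ?thesis by simp
qed

lemma branch_initial_value:
  assumes M: "M > 0" and R: "a_priori_radius m M R" and y1: "0 < y1" "y1 \<le> 1"
    and init: "initial_data m a0" and mb: "moment_bound m a0 M" and r0: "Re (a0 1) > R + 2 * M + 1 / y1"
    and br: "moment_branch m M y1 K (\<lambda>k. moment m k a0) c c'"
  shows "1 / (Re (a0 1))\<^sup>2 < y1" "\<And>j. j \<in> {1..m+1} \<Longrightarrow> a0 j = branch_curve c j (1 / (Re (a0 1))\<^sup>2)"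
proof -
  define r where "r = Re (a0 1)"
  have r: "r > 0" "a0 1 = of_real r" using init by (auto simp: initial_data_def r_def of_real_Re)
  have R1: "R \<ge> 1" using R by (simp add: a_priori_radius_def)
  have "1 / y1 > 0" using y1 by simp
  then have r1: "r \<ge> R" "r \<ge> 1" "1 / y1 < r" using r0 R1 M unfolding r_def by linarith+
  have "1 / y1 < r * r" using mult_left_mono[of 1 r r] r1 by linarith
  then have y: "1 / r\<^sup>2 < y1" using y1 r by (simp add: power2_eq_square field_simps)
  then show "1 / (Re (a0 1))\<^sup>2 < y1" by (simp add: r_def)
  have "N0 m a0 \<le> M\<^sup>2" by (rule moment_boundD(2)[OF mb])
  also have "M\<^sup>2 \<le> (2 * M)\<^sup>2" by (simp add: power_mult_distrib)
  finally have "\<forall>j\<in>{2..m+1}. r ^ j * cmod (a0 j) \<le> 2 * M"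
    using a_priori_radiusD(1)[where r = r and a = a0, OF R r1(1) r(2)] moment_boundD(1)[OF mb] by blast
  then have *: "\<forall>j\<in>{2..m+1}. a0 j = c j (1 / r\<^sup>2) / of_real r ^ j"
    using br[unfolded moment_branch_def, THEN conjunct2, THEN conjunct2, THEN spec, of a0, THEN spec, of r] r y by simp
  fix j assume j: "j \<in> {1..m+1}"
  have "sqrt (1 / r\<^sup>2) = 1 / r" using r by (simp add: real_sqrt_divide)
  then show "a0 j = branch_curve c j (1 / (Re (a0 1))\<^sup>2)"
    using * r j unfolding r_def[symmetric] by (auto simp: branch_curve_def power_divide)
qed

text \<open>The parameter Y(t) is picked from h(Y) = E(t) by the intermediate value theorem and
  differentiated implicitly. The moments along the resulting curve have known values, hence known
  rates, and \<open>moment_rate_imp_PG\<close> converts these into the Polubarinova-Galin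
  equation.\<close>

lemma solution_exists:
  assumes M: "M > 0" and R: "a_priori_radius m M R"
    and y1: "0 < y1" "y1 \<le> 1" "y1 * (2 * M * (real (m+1))\<^sup>2) < 1"
    and q: "admissible_source q" and init: "initial_data m a0"
    and mb: "moment_bound m a0 M" and r0: "Re (a0 1) > R + 2 * M + 1 / y1"
    and br: "moment_branch m M y1 K (\<lambda>k. moment m k a0) c c'"
  shows "\<exists>a. global_polynomial_solution q m a0 a"
proof -
  let ?J = "{1..m+1}"
  have qc: "continuous_on {0..} q" and qp: "\<And>t. t \<ge> 0 \<Longrightarrow> q t > 0"
    using q by (simp_all add: admissible_source_def)
  define y0 where "y0 = 1 / (Re (a0 1))\<^sup>2"
  note y0a0 = branch_initial_value[OF M R y1(1,2) init mb r0 br, folded y0_def]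
  have y0: "0 < y0" "y0 < y1"
    using y0a0(1) init by (simp_all add: y0_def initial_data_def)
  have a0: "\<And>j. j \<in> ?J \<Longrightarrow> a0 j = branch_curve c j y0" by (rule y0a0(2))
  define h where "h = branch_energy m c"
  define h' where "h' = branch_energy_deriv m c c'"
  define E where "E t = h y0 + 2 * integral {0..t} q" for t
  have hd: "(h has_real_derivative h' x) (at x)" and h'neg: "h' x < 0" if "x \<in> {0<..<y1}" for x
  proof -
    show "(h has_real_derivative h' x) (at x)" unfolding h_def h'_def
      using br that unfolding moment_branch_def by (intro branch_energy_has_real_derivative) auto
    show "h' x < 0" using br that unfolding moment_branch_def h'_def by blast
  qed
  have hlow: "h x \<ge> 1 / x" if "x > 0" for x
    using that by (simp add: h_def branch_energy_def sum_nonneg)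
  have "\<exists>x. 0 < x \<and> x \<le> y0 \<and> h x = E t" if t: "t \<ge> 0" for t
  proof -
    have E0: "h y0 \<le> E t"
      using admissible_source_integral_nonneg[OF q, of t] by (simp add: E_def)
    have "1 / y0 > 0" using y0 by simp
    then have Ep: "E t > 0" using E0 hlow[OF y0(1)] by linarith
    \<comment> \<open>A left end point for the intermediate value theorem: h(u) >= 1 / u >= E(t) >=
      h(y0).\<close>
    define u where "u = min y0 (1 / E t)"
    have u: "0 < u" "u \<le> y0" using y0 Ep by (auto simp: u_def)
    have "E t = 1 / (1 / E t)" by simp
    also have "\<dots> \<le> 1 / u" using u Ep by (intro divide_left_mono) (auto simp: u_def)
    also have "\<dots> \<le> h u" using hlow u by simp
    finally have "E t \<le> h u" .
    moreover have "continuous_on {u..y0} h"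
    proof (intro continuous_at_imp_continuous_on ballI)
      fix x assume "x \<in> {u..y0}"
      then have "x \<in> {0<..<y1}" using u y0 by auto
      then show "isCont h x" by (rule DERIV_isCont[OF hd])
    qed
    ultimately have "\<exists>x. u \<le> x \<and> x \<le> y0 \<and> h x = E t"
      using IVT2'[of h y0 "E t" u] E0 u by blast
    then show ?thesis using u(1) by (meson less_le_trans)
  qed
  then obtain Y where Y: "\<And>t. t \<ge> 0 \<Longrightarrow> 0 < Y t \<and> Y t \<le> y0 \<and> h (Y t) = E t"
    by metis
  have Yin: "Y t \<in> {0<..<y1}" if "t \<ge> 0" for t using Y[OF that] y0 by auto
  \<comment> \<open>Y was picked separately at each time; strict monotonicity of the energy pins
    down its initial value.\<close>
  have Y0: "Y 0 = y0"
    using Y[of 0] branch_energy_strict_antimono[OF br, of "Y 0" y0] y0 by (auto simp: h_def E_def less_le)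
  define v where "v t = 2 * q t / h' (Y t)" for t
  have Yd: "(Y has_real_derivative v t) (at t within {0..})" if t: "t \<ge> 0" for t
    unfolding v_def h'_def
  proof (rule branch_time_derivative[OF br, where E = E])
    show "(E has_real_derivative 2 * q t) (at t within {0..})"
      unfolding E_def using has_real_derivative_integral_atLeast[OF qc t]
      by (auto intro!: derivative_eq_intros)
  qed (use t Y Yin in \<open>auto simp: h_def\<close>)
  have "\<exists>G'. \<forall>j\<in>?J. continuous_on {0<..<y1} (G' j) \<and>
      (\<forall>y\<in>{0<..<y1}. (branch_curve c j has_vector_derivative G' j y) (at y))"
    by (intro bchoice ballI branch_curve_has_vector_derivative[OF br])
  then obtain G' where G': "\<forall>j\<in>?J. continuous_on {0<..<y1} (G' j) \<and>
      (\<forall>y\<in>{0<..<y1}. (branch_curve c j has_vector_derivative G' j y) (at y))" ..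
  have G'c: "continuous_on {0<..<y1} (G' j)" if "j \<in> ?J" for j using G' that by blast
  have G'd: "(branch_curve c j has_vector_derivative G' j y) (at y)" if "j \<in> ?J" "y \<in> {0<..<y1}" for j y
    using G' that by blast
  define a where "a j t = branch_curve c j (Y t)" for j t
  define a' where "a' j t = v t *\<^sub>R G' j (Y t)" for j t
  have ad: "(a j has_vector_derivative a' j t) (at t within {0..})" if j: "j \<in> ?J" and t: "t \<ge> 0" for j t
  proof -
    have "(Y has_vector_derivative v t) (at t within {0..})"
      using Yd[OF t] by (simp add: has_real_derivative_iff_has_vector_derivative)
    then have "(branch_curve c j \<circ> Y has_vector_derivative v t *\<^sub>R G' j (Y t)) (at t within {0..})"
      using has_vector_derivative_at_within[OF G'd[OF j Yin[OF t]]] by (rule vector_diff_chain_within)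
    moreover have "branch_curve c j \<circ> Y = a j" by (auto simp: a_def)
    ultimately show ?thesis by (simp add: a'_def)
  qed
  have fd: "((\<lambda>s. polynomial_family m a \<zeta> s) has_vector_derivative poly (coeff_poly m (\<lambda>j. a' j t)) \<zeta>) (at t within {0..})"
    if "t \<ge> 0" for t \<zeta>
    using ad that by (intro polynomial_family_has_vector_derivative) auto
  have vd: "vector_derivative (\<lambda>s. polynomial_family m a \<zeta> s) (at t within {0..}) = poly (coeff_poly m (\<lambda>j. a' j t)) \<zeta>"
    if "t \<ge> 0" for t \<zeta>
    by (rule vector_derivative_within[OF within_atLeast_neq_bot[OF that] fd[OF that]])
  have a1: "a 1 t = of_real (1 / sqrt (Y t))" for t by (simp add: a_def branch_curve_def)
  \<comment> \<open>The moment is differentiated twice: through its coefficients, and through its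
    prescribed value (E for k = 0, a constant otherwise). Uniqueness of the derivative equates the
    results.\<close>
  have rate: "moment_rate m (\<lambda>j. a j t) (\<lambda>j. a' j t) (coeff_poly m (\<lambda>j. a j t) ^ k) = (if k = 0 then 2 * of_real (q t) else 0)"
    if t: "t \<ge> 0" and k: "k \<le> m" for t k
  proof -
    have 1: "((\<lambda>t. moment m k (\<lambda>j. a j t)) has_vector_derivative
        moment_rate m (\<lambda>j. a j t) (\<lambda>j. a' j t) (coeff_poly m (\<lambda>j. a j t) ^ k)) (at t within {0..})"
      using ad t by (intro moment_has_vector_derivative) auto
    have 2: "((\<lambda>t. if k = 0 then of_real (E t) else moment m k a0) has_vector_derivative
        (if k = 0 then 2 * of_real (q t) else 0)) (at t within {0..})"
    proof (cases "k = 0")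
      case True
      have "(E has_real_derivative 2 * q t) (at t within {0..})"
        unfolding E_def using has_real_derivative_integral_atLeast[OF qc t]
        by (auto intro!: derivative_eq_intros)
      from has_vector_derivative_of_real[OF this] show ?thesis using True by simp
    qed simp
    have "((\<lambda>t. moment m k (\<lambda>j. a j t)) has_vector_derivative
        (if k = 0 then 2 * of_real (q t) else 0)) (at t within {0..})"
    proof (rule has_vector_derivative_transform_within[OF 2 zero_less_one])
      fix s :: real assume s: "s \<in> {0..}"
      then show "(if k = 0 then of_real (E s) else moment m k a0) = moment m k (\<lambda>j. a j s)"
        using branch_curve_moments(1,2)[OF br, of "Y s"] Yin[of s] Y[of s] k by (auto simp: a_def h_def)
    qed (use t in auto)
    then show ?thesis
      by (rule vector_derivative_unique_within[OF within_atLeast_neq_bot[OF t] 1])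
  qed
  have "locally_univalent_solution q {0..} (polynomial_family m a)"
    unfolding locally_univalent_solution_def
  proof (intro conjI ballI)
    fix t :: real assume t: "t \<in> {0..}"
    have "polynomial_family m a z t = poly (coeff_poly m (\<lambda>j. a j t)) z" for z
      by (simp add: polynomial_family_def poly_coeff_poly)
    then show "(\<lambda>z. polynomial_family m a z t) analytic_on cball 0 1"
      by (simp add: analytic_on_holomorphic) (intro exI[of _ UNIV] conjI holomorphic_intros; simp)
    show "polynomial_family m a 0 t = 0"
      by (simp add: polynomial_family_def polynomial_map_def)
    have d0: "deriv (\<lambda>z. polynomial_family m a z t) 0 = of_real (1 / sqrt (Y t))"
      by (simp add: deriv_polynomial_family poly_0_coeff_0 coeff_pderiv coeff_coeff_poly a1[unfolded One_nat_def])
    show "deriv (\<lambda>z. polynomial_family m a z t) 0 \<in> \<real>" unfolding d0 by simp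
    show "0 < Re (deriv (\<lambda>z. polynomial_family m a z t) 0)" unfolding d0 using Yin[of t] t by simp
    fix \<zeta> :: complex assume z: "\<zeta> \<in> cball 0 1"
    show "deriv (\<lambda>z. polynomial_family m a z t) \<zeta> \<noteq> 0"
      unfolding deriv_polynomial_family a_def
      using branch_curve_locally_univalent[OF br y1(2,3) M, of "Y t" \<zeta>] Yin[of t] t z by simp
  next
    fix \<zeta> :: complex and t :: real assume t: "t \<in> {0..}"
    then show "(\<lambda>s. polynomial_family m a \<zeta> s) differentiable (at t within {0..})"
      using fd[of t \<zeta>] by (auto intro: differentiableI_vector)
  next
    have Yc: "continuous_on {0..} Y"
      unfolding continuous_on_eq_continuous_within using Yd by (auto intro: DERIV_continuous)
    have h'c: "continuous_on {0..} (\<lambda>t. h' (Y t))"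
      unfolding h'_def using Yin by (intro continuous_on_compose2[OF continuous_on_branch_energy_deriv[OF br] Yc]) auto
    have a'c: "continuous_on {0..} (a' j)" if "j \<in> ?J" for j
      unfolding a'_def v_def
    proof (intro continuous_intros qc h'c)
      show "continuous_on {0..} (\<lambda>t. G' j (Y t))"
        using Yin by (intro continuous_on_compose2[OF G'c[OF that] Yc]) auto
      show "\<forall>t\<in>{0..}. h' (Y t) \<noteq> 0"
      proof
        fix t :: real assume "t \<in> {0..}"
        then show "h' (Y t) \<noteq> 0" using h'neg[OF Yin, of t] by simp
      qed
    qed
    have "continuous_on (cball 0 1 \<times> {0..}) (\<lambda>x. \<Sum>j=1..m+1. a' j (snd x) * fst x ^ j)"
      by (intro continuous_intros continuous_on_compose2[OF a'c]) auto
    then show "continuous_on (cball 0 1 \<times> {0..}) (\<lambda>(\<zeta>, t). vector_derivative (\<lambda>s. polynomial_family m a \<zeta> s) (at t within {0..}))"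
      by (rule continuous_on_eq) (auto simp: vd poly_coeff_poly polynomial_map_def)
  next
    fix t :: real and \<zeta> :: complex assume t: "t \<in> {0..}" and z: "\<zeta> \<in> sphere 0 1"
    have "a 1 t \<noteq> 0" using Yin[of t] t unfolding a1 by simp
    then have "Re (poly (coeff_poly m (\<lambda>j. a' j t)) \<zeta> * cnj (\<zeta> * poly (pderiv (coeff_poly m (\<lambda>j. a j t))) \<zeta>)) = q t"
      using rate t z by (intro moment_rate_imp_PG) auto
    then show "Re (vector_derivative (\<lambda>s. polynomial_family m a \<zeta> s) (at t within {0..}) * cnj (\<zeta> * deriv (\<lambda>z. polynomial_family m a z t) \<zeta>)) = q t"
      using t by (simp add: vd deriv_polynomial_family)
  qed
  moreover have "\<forall>j\<in>?J. a j 0 = a0 j" by (simp add: a_def Y0 a0)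
  ultimately show ?thesis unfolding global_polynomial_solution_def by blast
qed

section \<open>Motion of the zeros\<close>

text \<open>In powers of r the exponents are 1 - 2 (m-i) / m - i (m+2) / m + (i+1) = 0 for every i.
  So a single rescaling by u turns each coefficient of f' / a_1 into a scaled coefficient times
  s^(m-i).\<close>

lemma rescaling_exponents:
  assumes m: "m \<ge> 1" and r: "r > 0" and s: "s = (1 / r\<^sup>2) powr (1 / real m)"
    and u: "u = r powr (- ((real m + 2) / real m))"
  shows "s > 0" "s ^ m = 1 / r\<^sup>2" "i \<le> m \<Longrightarrow> r * s ^ (m - i) * u ^ i * r ^ (i + 1) = 1"
proof -
  show s0: "s > 0" using r s by simp
  have sr: "s = r powr (- 2 / real m)"
  proof -
    have "1 / r\<^sup>2 = r powr (- 2)"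
      using r by (simp add: powr_minus powr_numeral divide_inverse)
    then show ?thesis by (simp add: s powr_powr)
  qed
  have sn: "s ^ n = r powr (- 2 / real m * real n)" for n
    using r by (simp add: sr powr_realpow [symmetric] powr_powr)
  have un: "u ^ n = r powr (- ((real m + 2) / real m) * real n)" for n
    using r by (simp add: u powr_realpow [symmetric] powr_powr)
  show "s ^ m = 1 / r\<^sup>2"
  proof -
    have e: "- 2 / real m * real m = - 2" using m by simp
    show ?thesis unfolding sn e using r by (simp add: powr_minus powr_numeral divide_inverse)
  qed
  assume i: "i \<le> m"
  have "r * s ^ (m - i) * u ^ i * r ^ (i + 1)
    = r powr (1 + (- 2 / real m * real (m - i)) + (- ((real m + 2) / real m) * real i) + real (i + 1))"
    unfolding powr_add using r by (simp only: sn un powr_one powr_realpow)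
  also have "1 + (- 2 / real m * real (m - i)) + (- ((real m + 2) / real m) * real i) + real (i + 1) = 0"
    using m i by (simp add: of_nat_diff field_simps)
  finally show "r * s ^ (m - i) * u ^ i * r ^ (i + 1) = 1" using r by simp
qed

text \<open>The coefficient g_i of the rescaled f' / a_1. The factor s^(m-i) makes it O(s) for i <
  m; for i = m it is the constant (m+1) cnj M_m.\<close>

definition zero_coeff :: "nat \<Rightarrow> (nat \<Rightarrow> real \<Rightarrow> complex) \<Rightarrow> nat \<Rightarrow> real \<Rightarrow> complex" where
  "zero_coeff m c i s = of_nat (i + 1) * c (i + 1) (s ^ m) * of_real (s ^ (m - i))"

definition zero_coeff_deriv :: "nat \<Rightarrow> (nat \<Rightarrow> real \<Rightarrow> complex) \<Rightarrow> (nat \<Rightarrow> real \<Rightarrow> complex) \<Rightarrow> nat \<Rightarrow> real \<Rightarrow> complex" where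
  "zero_coeff_deriv m c c' i s = of_nat (i + 1) *
     (c (i + 1) (s ^ m) * of_real (real (m - i) * s ^ (m - i - 1)) +
      (real m * s ^ (m - 1)) *\<^sub>R c' (i + 1) (s ^ m) * of_real (s ^ (m - i)))"

lemma pderiv_rescaled:
  assumes m: "m \<ge> 1" and r: "r > 0" and s: "s = (1 / r\<^sup>2) powr (1 / real m)"
    and u: "u = r powr (- ((real m + 2) / real m))"
    and a1: "a 1 = of_real r" and a: "\<forall>j\<in>{2..m+1}. a j = c j (1 / r\<^sup>2) / of_real r ^ j"
    and top: "c (m+1) (1 / r\<^sup>2) = cnj \<mu>"
  shows "poly (pderiv (coeff_poly m a)) \<zeta>
    = of_real r * perturbed_poly m (of_nat (m+1) * cnj \<mu>) (\<lambda>i. zero_coeff m c i s) (\<zeta> * of_real u)"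
proof -
  note E = rescaling_exponents[OF m r s u]
  have trm: "of_nat (i + 1) * a (i + 1) * \<zeta> ^ i = of_real r * (zero_coeff m c i s * (\<zeta> * of_real u) ^ i)"
    if i: "i \<in> {1..m}" for i
  proof -
    have c: "c (i + 1) (s ^ m) = a (i + 1) * of_real (r ^ (i + 1))"
      using a i r unfolding E(2) by (simp del: power_Suc)
    have eq: "of_real r * (zero_coeff m c i s * (\<zeta> * of_real u) ^ i)
       = of_nat (i + 1) * a (i + 1) * \<zeta> ^ i * of_real (r * s ^ (m - i) * u ^ i * r ^ (i + 1))"
      unfolding zero_coeff_def c power_mult_distrib of_real_mult of_real_power by (simp only: mult_ac)
    have "r * s ^ (m - i) * u ^ i * r ^ (i + 1) = 1" using E(3)[of i] i by simp
    then show ?thesis unfolding eq by simp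
  qed
  have "poly (pderiv (coeff_poly m a)) \<zeta> = (\<Sum>i=0..m. of_nat (i + 1) * a (i + 1) * \<zeta> ^ i)"
    unfolding poly_pderiv_coeff_poly
    by (rule sum.reindex_bij_witness[of _ Suc "\<lambda>j. j - 1"]) auto
  also have "\<dots> = a 1 + (\<Sum>i=1..m. of_nat (i + 1) * a (i + 1) * \<zeta> ^ i)"
    by (subst sum.atLeast_Suc_atMost) simp_all
  also have "\<dots> = of_real r + (\<Sum>i=1..m. of_real r * (zero_coeff m c i s * (\<zeta> * of_real u) ^ i))"
    unfolding a1 by (intro arg_cong2[of _ _ _ _ "(+)"] refl sum.cong trm) auto
  also have "\<dots> = of_real r * (1 + (\<Sum>i=1..m. zero_coeff m c i s * (\<zeta> * of_real u) ^ i))"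
    by (simp only: sum_distrib_left distrib_left mult_1_right)
  also have "(\<Sum>i=1..m. zero_coeff m c i s * (\<zeta> * of_real u) ^ i)
     = (\<Sum>i=1..<m. zero_coeff m c i s * (\<zeta> * of_real u) ^ i) + zero_coeff m c m s * (\<zeta> * of_real u) ^ m"
    using m by (subst sum.last_plus) (auto simp: add.commute atLeastLessThanSuc_atLeastAtMost[symmetric])
  also have "zero_coeff m c m s = of_nat (m+1) * cnj \<mu>"
    unfolding zero_coeff_def E(2) top by simp
  finally show ?thesis by (simp add: perturbed_poly_def add.assoc)
qed

lemma zero_coeff_estimates:
  assumes br: "moment_branch m M y1 K \<mu> c c'" and y1: "y1 \<le> 1" and K: "2 * M \<le> K" "0 < K"
    and i: "i \<in> {1..<m}" and s: "s \<in> {0<..<y1}"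
  shows "(zero_coeff m c i has_vector_derivative zero_coeff_deriv m c c' i s) (at s)"
    "cmod (zero_coeff m c i s) \<le> (2 * (real (m+1))\<^sup>2 * K) * s"
    "cmod (zero_coeff_deriv m c c' i s) \<le> 2 * (real (m+1))\<^sup>2 * K"
proof -
  have s1: "s < 1" "s > 0" using s y1 by auto
  \<comment> \<open>As s < 1, the argument s^m of the branch stays in the interval where the branch
    is defined.\<close>
  have "s ^ m \<le> s ^ 1" using i s1 by (intro power_decreasing) auto
  then have sm: "s ^ m \<in> {0<..<y1}" using s by auto
  have i2: "i + 1 \<in> {2..m+1}" using i by auto
  have cd: "(c (i + 1) has_vector_derivative c' (i + 1) (s ^ m)) (at (s ^ m))"
    and cb': "cmod (c (i + 1) (s ^ m)) \<le> 2 * M" "cmod (c' (i + 1) (s ^ m)) \<le> K"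
    using br i2 sm unfolding moment_branch_def by blast+
  then have cb: "cmod (c (i + 1) (s ^ m)) \<le> K" "cmod (c' (i + 1) (s ^ m)) \<le> K" using K by linarith+
  have "((\<lambda>s. s ^ m) has_vector_derivative real m * s ^ (m - 1)) (at s)"
    unfolding has_real_derivative_iff_has_vector_derivative [symmetric] by (auto intro!: derivative_eq_intros)
  from vector_diff_chain_within[OF this has_vector_derivative_at_within[OF cd]]
  have "((\<lambda>s. c (i + 1) (s ^ m)) has_vector_derivative (real m * s ^ (m - 1)) *\<^sub>R c' (i + 1) (s ^ m)) (at s)"
    by (simp add: o_def)
  moreover have "((\<lambda>s. s ^ (m - i)) has_real_derivative real (m - i) * s ^ (m - i - 1)) (at s)"
    by (auto intro!: derivative_eq_intros)
  ultimately have "((\<lambda>s. of_nat (i + 1) * (c (i + 1) (s ^ m) * of_real (s ^ (m - i)))) has_vector_derivative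
     zero_coeff_deriv m c c' i s) (at s)"
    unfolding zero_coeff_deriv_def
    by (intro has_vector_derivative_mult_right has_vector_derivative_mult has_vector_derivative_of_real)
  moreover have "zero_coeff m c i = (\<lambda>s. of_nat (i + 1) * (c (i + 1) (s ^ m) * of_real (s ^ (m - i))))"
    by (simp add: zero_coeff_def fun_eq_iff)
  ultimately show "(zero_coeff m c i has_vector_derivative zero_coeff_deriv m c c' i s) (at s)" by simp
  have im: "real (i + 1) \<le> real (m+1)" using i by simp
  have p: "s ^ n \<le> 1" for n using s1 by (intro power_le_one) auto
  have m1: "real (m+1) * 1 \<le> real (m+1) * real (m+1)" by (intro mult_left_mono) auto
  have "cmod (zero_coeff m c i s) = real (i + 1) * cmod (c (i + 1) (s ^ m)) * s ^ (m - i)"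
    using s1 by (simp only: zero_coeff_def norm_mult norm_of_nat norm_of_real abs_of_pos zero_less_power)
  also have "\<dots> \<le> real (m+1) * K * s ^ 1"
    using im cb s1 K i by (intro mult_mono power_decreasing) auto
  also have "\<dots> \<le> (2 * (real (m+1))\<^sup>2 * K) * s"
    unfolding power_one_right using m1 s1 K by (intro mult_right_mono) (auto simp: power2_eq_square)
  finally show "cmod (zero_coeff m c i s) \<le> (2 * (real (m+1))\<^sup>2 * K) * s" .
  have "cmod (zero_coeff_deriv m c c' i s) \<le> real (i + 1) *
     (cmod (c (i + 1) (s ^ m)) * (real (m - i) * s ^ (m - i - 1)) +
      (real m * s ^ (m - 1)) * cmod (c' (i + 1) (s ^ m)) * s ^ (m - i))"
    unfolding zero_coeff_deriv_def norm_mult norm_of_nat using s1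
    by (intro mult_left_mono order.trans[OF norm_triangle_ineq]) (auto simp: norm_mult norm_power)
  also have "\<dots> \<le> real (m+1) * (K * (real (m+1) * 1) + (real (m+1) * 1) * K * 1)"
    using im cb s1 K by (intro mult_mono add_mono p) (auto intro!: mult_nonneg_nonneg add_nonneg_nonneg)
  also have "\<dots> = 2 * (real (m+1))\<^sup>2 * K" by (simp add: power2_eq_square)
  finally show "cmod (zero_coeff_deriv m c c' i s) \<le> 2 * (real (m+1))\<^sup>2 * K" .
qed

text \<open>f^(m+1) starts at degree m + 1, so only the last term of the sum survives.\<close>

lemma moment_top:
  "moment m m a = a 1 ^ (m+1) * cnj (a (m+1))"
proof -
  have "(\<Sum>n=1..m+1. of_nat n * coeff (coeff_poly m a ^ (m+1)) n * cnj (a n))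
     = (\<Sum>n\<in>{m+1}. of_nat n * coeff (coeff_poly m a ^ (m+1)) n * cnj (a n))"
    by (rule sum.mono_neutral_right)
       (auto simp: coeff_power_of_coeff_0(1) coeff_coeff_poly simp del: power_Suc)
  also have "\<dots> = of_nat (m+1) * (a 1 ^ (m+1) * cnj (a (m+1)))"
    using coeff_power_of_coeff_0(2)[of "coeff_poly m a" "m+1"] by (simp add: coeff_coeff_poly)
  finally show ?thesis unfolding moment_def by (simp del: of_nat_Suc of_nat_add)
qed

text \<open>ln |Z| is differentiated as half of ln |Z|^2; its slope is at most |Z'| / |Z| < \<kappa>
  / s. For \<kappa> = (m+2) / 2 the difference is ln |\<omega>|, since the zero is \<omega> = Z /
  s^\<kappa>.\<close>

lemma log_modulus_derivative:
  assumes D: "(Z has_vector_derivative D) (at s)" and s: "s > 0" and Z: "Z s \<noteq> 0" and le: "s * cmod D < \<kappa> * cmod (Z s)"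
  shows "\<exists>L. ((\<lambda>s. ln (cmod (Z s)) - \<kappa> * ln s) has_real_derivative L) (at s) \<and> L < 0"
proof -
  have Zp: "cmod (Z s) > 0" using Z by simp
  have "((\<lambda>s. ln ((cmod (Z s))\<^sup>2) / 2) has_real_derivative (1 / (cmod (Z s))\<^sup>2 * (2 * Re (D * cnj (Z s)))) / 2) (at s)"
    by (intro DERIV_cdivide DERIV_chain2[OF DERIV_ln_divide] has_real_derivative_cmod_square[OF D]) (use Zp in simp)
  moreover have "ln ((cmod x)\<^sup>2) / 2 = ln (cmod x)" for x
    by (cases "x = 0") (simp_all add: ln_realpow)
  ultimately have 1: "((\<lambda>s. ln (cmod (Z s))) has_real_derivative (1 / (cmod (Z s))\<^sup>2 * (2 * Re (D * cnj (Z s)))) / 2) (at s)"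
    by simp
  have 2: "((\<lambda>s. \<kappa> * ln s) has_real_derivative \<kappa> * (1 / s)) (at s)"
    using s by (intro DERIV_cmult DERIV_ln_divide)
  have "Re (D * cnj (Z s)) \<le> cmod D * cmod (Z s)"
    using complex_Re_le_cmod[of "D * cnj (Z s)"] by (simp add: norm_mult)
  then have "(1 / (cmod (Z s))\<^sup>2) * Re (D * cnj (Z s)) \<le> (1 / (cmod (Z s))\<^sup>2) * (cmod D * cmod (Z s))"
    by (rule mult_left_mono) simp
  then have "(1 / (cmod (Z s))\<^sup>2 * (2 * Re (D * cnj (Z s)))) / 2 \<le> (1 / (cmod (Z s))\<^sup>2) * (cmod D * cmod (Z s))"
    by (simp only: mult.left_commute[of _ 2] nonzero_mult_div_cancel_left zero_neq_numeral not_False_eq_True)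
  also have "\<dots> = cmod D / cmod (Z s)" using Zp by (simp add: power2_eq_square)
  also have "\<dots> < \<kappa> * (1 / s)" using le s Zp by (simp add: field_simps)
  finally have "(1 / (cmod (Z s))\<^sup>2 * (2 * Re (D * cnj (Z s)))) / 2 - \<kappa> * (1 / s) < 0" by simp
  then show ?thesis using DERIV_diff[OF 1 2] by blast
qed

lemma nth_roots_enumeration:
  assumes "m \<ge> 1" "x \<noteq> 0"
  shows "\<exists>w. bij_betw w {1..m} {z :: complex. z ^ m = x}"
proof -
  have "finite {z. z ^ m = x}" "card {z. z ^ m = x} = m"
    using assms by (auto simp: card_nth_roots finite_nth_roots)
  then show ?thesis using ex_bij_betw_nat_finite_1 by metis
qed

text \<open>Everything follows from h(y(t)) = E(t) with h strictly decreasing: E' = 2 q > 0 gives y'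
  < 0, and E -> infinity pushes y below any x > 0, as soon as E(t) exceeds h(x).\<close>

lemma solution_time:
  assumes M: "M > 0" and R: "a_priori_radius m M R" and y1: "0 < y1" "y1 \<le> 1"
    and q: "admissible_source q" and sol: "global_polynomial_solution q m a0 a"
    and mb: "moment_bound m a0 M" and r0: "Re (a0 1) > R + 2 * M + 1 / y1"
    and br: "moment_branch m M y1 K (\<lambda>k. moment m k a0) c c'"
  defines "y \<equiv> \<lambda>t. 1 / (Re (a 1 t))\<^sup>2"
  shows "\<And>t. t \<ge> 0 \<Longrightarrow> y t \<in> {0<..<y1}"
    and "\<And>t. t \<ge> 0 \<Longrightarrow> \<exists>v<0. (y has_real_derivative v) (at t within {0..})"
    and "(y \<longlongrightarrow> 0) at_top"
    and "\<And>t. t \<ge> 0 \<Longrightarrow> y t \<le> y 0"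
proof -
  have lus: "locally_univalent_solution q {0..} (polynomial_family m a)"
    using sol by (simp add: global_polynomial_solution_def)
  have qc: "continuous_on {0..} q" and qp: "\<And>t. t \<ge> 0 \<Longrightarrow> q t > 0"
    and Q: "filterlim (\<lambda>t. integral {0..t} q) at_top at_top"
    using q by (simp_all add: admissible_source_def)
  note on = solution_on_branch[OF M R y1 q sol mb r0 br]
  show yin: "y t \<in> {0<..<y1}" if "t \<ge> 0" for t
    using on(1,3)[OF that] by (simp add: y_def)
  define E where "E t = (Re (a 1 t))\<^sup>2 + N0 m (\<lambda>j. a j t)" for t
  define h where "h = branch_energy m c"
  have hE: "h (y t) = E t" if "t \<ge> 0" for t
    unfolding h_def E_def y_def using on(1,4)[OF that] by (intro moment_branch_energy [symmetric]) auto
  have E: "(E has_real_derivative 2 * q t) (at t within {0..})" "E t = E 0 + 2 * integral {0..t} q" if "t \<ge> 0" for t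
    using solution_energy[OF lus that] unfolding E_def by auto
  have anti: "h u > h v" if "0 < u" "u < v" "v < y1" for u v
    using branch_energy_strict_antimono[OF br that] by (simp add: h_def)
  show "\<exists>v<0. (y has_real_derivative v) (at t within {0..})" if t: "t \<ge> 0" for t
  proof (intro exI conjI)
    show "(y has_real_derivative 2 * q t / branch_energy_deriv m c c' (y t)) (at t within {0..})"
      by (rule branch_time_derivative[OF br _ E(1)[OF t]]) (use t yin hE in \<open>auto simp: h_def\<close>)
    have "branch_energy_deriv m c c' (y t) < 0" using br yin[OF t] unfolding moment_branch_def by blast
    then show "2 * q t / branch_energy_deriv m c c' (y t) < 0" using qp[OF t] by (simp add: divide_pos_neg)
  qed
  show "(y \<longlongrightarrow> 0) at_top"
  proof (rule tendstoI)
    fix e :: real assume e: "e > 0"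
    define x where "x = min (e / 2) (y1 / 2)"
    have x: "0 < x" "x < e" "x < y1" using e y1 by (auto simp: x_def)
    have "\<forall>\<^sub>F t in at_top. integral {0..t} q \<ge> (h x - E 0) / 2 + 1"
      using Q by (simp add: filterlim_at_top)
    then show "\<forall>\<^sub>F t in at_top. dist (y t) 0 < e"
      using eventually_ge_at_top[of 0]
    proof eventually_elim
      case (elim t)
      have "h x < h (y t)"
        using elim(1) by (simp add: hE[OF elim(2)] E(2)[OF elim(2)] field_simps)
      then have "y t \<le> x" using anti[of x "y t"] x yin[of t] elim(2) by fastforce
      then show ?case using x yin[of t] elim(2) by simp
    qed
  qed
  show "y t \<le> y 0" if t: "t \<ge> 0" for t
  proof (rule ccontr)
    assume "\<not> y t \<le> y 0"
    then have "h (y t) < h (y 0)" using anti[of "y 0" "y t"] yin[of 0] yin[OF t] by simp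
    moreover note admissible_source_integral_nonneg[OF q, of t]
    ultimately show False using hE[of 0] hE[OF t] E(2)[OF t] by simp
  qed
qed

lemma zero_motion:
  fixes m :: nat and M \<delta> \<epsilon> s2 y1 K d :: real
  assumes m: "m \<ge> 1" and M: "M > 0" and R: "a_priori_radius m M R" and y1: "0 < y1" "y1 \<le> 1"
    and K: "2 * M \<le> K" "0 < K"
    and q: "admissible_source q" and sol: "global_polynomial_solution q m a0 a" and init: "initial_data m a0"
    and mb: "moment_bound m a0 M" and r0: "Re (a0 1) > R + 2 * M + 1 / y1"
    and br: "moment_branch m M y1 K (\<lambda>k. moment m k a0) c c'"
    and d: "0 < d" "d \<le> 1" "\<forall>u v :: complex. u ^ m = v ^ m \<and> u \<noteq> v \<longrightarrow> d * cmod u \<le> cmod (u - v)"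
  defines "l0 \<equiv> min 1 (1 / (real (m+1) * M))" and "K' \<equiv> 2 * (real (m+1))\<^sup>2 * K" and "\<kappa> \<equiv> (real m + 2) / 2"
  assumes s2: "0 < s2" "s2 \<le> y1" and \<delta>: "\<delta> > 0"
    and est: "roots_controlled m (real (m+1) * \<delta>) K' y1 l0 (d * l0) \<epsilon> \<kappa> s2"
  shows "\<exists>\<omega> \<omega>h. zeros_of_derivative m a \<omega> \<and> limit_zeros m a0 \<omega>h \<and>
    (\<forall>k\<in>{1..m}. ((\<lambda>t. cmod (rescaled_zero m a \<omega> k t - \<omega>h k)) \<longlongrightarrow> 0) at_top) \<and>
    (cmod (harmonic_moment m (polynomial_map m a0)) \<ge> \<delta> \<and> Re (a0 1) > 1 + 1 / s2 ^ m \<longrightarrow>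
      (\<forall>k\<in>{1..m}. continuous_on {0..} (\<omega> k)) \<and>
      (\<forall>k\<in>{1..m}. \<forall>t\<ge>0. cmod (rescaled_zero m a \<omega> k t - \<omega>h k) < \<epsilon>) \<and>
      (\<forall>t\<ge>0. inj_on (\<lambda>k. \<omega> k t) {1..m}) \<and>
      (\<forall>k\<in>{1..m}. moves_away_from_origin (\<omega> k)))"
proof -
  define \<mu> where "\<mu> = moment m m a0"
  define A where "A = of_nat (m+1) * cnj \<mu>"
  \<comment> \<open>From |A| <= (m+1) M every limit point has modulus at least l0, and d is the
    relative separation of m-th roots, so distinct limit points are at least d * l0 apart.\<close>
  define \<sigma> where "\<sigma> = d * l0"
  have a01: "a0 1 = of_real (Re (a0 1))" "Re (a0 1) > 0" and top0: "a0 (m+1) \<noteq> 0"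
    using init by (auto simp: initial_data_def of_real_Re)
  have "a0 1 \<noteq> 0" using a01(2) by auto
  then have \<mu>0: "\<mu> \<noteq> 0" using top0 unfolding \<mu>_def moment_top by simp
  have A0: "A \<noteq> 0" using \<mu>0 unfolding A_def by (simp del: of_nat_add of_nat_Suc)
  have Acmod: "cmod A = real (m+1) * cmod \<mu>" unfolding A_def by (simp only: norm_mult norm_of_nat complex_mod_cnj)
  have "cmod \<mu> \<le> M" unfolding \<mu>_def using m by (intro moment_boundD(1)[OF mb]) simp
  then have AM: "cmod A \<le> real (m+1) * M" unfolding Acmod by (intro mult_left_mono) auto
  have l0: "l0 > 0" using M by (simp add: l0_def)
  have \<sigma>0: "\<sigma> > 0" "\<sigma> \<le> l0" using d l0 by (auto simp: \<sigma>_def mult_left_le_one_le)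
  have K'0: "K' > 0" using K by (simp add: K'_def)
  have \<kappa>0: "\<kappa> > 0" by (simp add: \<kappa>_def)
  obtain w where w: "bij_betw w {1..m} {z. z ^ m = - 1 / A}"
    using nth_roots_enumeration[OF m, of "- 1 / A"] A0 by auto
  have wr: "w k ^ m = - 1 / A" if "k \<in> {1..m}" for k
    using w that by (auto simp: bij_betw_def)
  have wl: "l0 \<le> cmod (w k)" if k: "k \<in> {1..m}" for k
  proof -
    have "cmod (w k) ^ m = 1 / cmod A" using wr[OF k] by (simp add: norm_power [symmetric] norm_divide)
    then have "min 1 (1 / cmod A) \<le> cmod (w k)" using m by (intro power_bounds(1)) auto
    moreover have "1 / (real (m+1) * M) \<le> 1 / cmod A" using AM A0 by (intro divide_left_mono) (auto simp: M)
    ultimately show ?thesis unfolding l0_def by linarith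
  qed
  have sep: "\<sigma> \<le> cmod (w k - w l)" if kl: "k \<in> {1..m}" "l \<in> {1..m}" "k \<noteq> l" for k l
  proof -
    have "w k \<noteq> w l" using inj_onD[OF bij_betw_imp_inj_on[OF w], of k l] kl by blast
    then have "d * cmod (w k) \<le> cmod (w k - w l)" using wr[OF kl(1)] wr[OF kl(2)] by (intro d(3)[rule_format]) simp
    moreover have "d * l0 \<le> d * cmod (w k)" using wl[OF kl(1)] d by (intro mult_left_mono) auto
    ultimately show ?thesis by (simp add: \<sigma>_def)
  qed
  define g where "g = zero_coeff m c"
  define g' where "g' = zero_coeff_deriv m c c'"
  \<comment> \<open>The roots are numbered at each s separately, by matching them with the w where
    this is possible. Continuity is not built in; it follows for small s from
    \<open>roots_controlled\<close>.\<close>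
  have "\<exists>z. (\<forall>\<zeta>. perturbed_poly m A (\<lambda>i. g i s) \<zeta> = A * (\<Prod>k=1..m. \<zeta> - z k)) \<and>
    (\<forall>e. 0 \<le> e \<and> e < \<sigma> / 2 \<and> (\<forall>k\<in>{1..m}. cmod (perturbed_poly m A (\<lambda>i. g i s) (w k)) \<le> cmod A * e ^ m) \<longrightarrow>
      (\<forall>k\<in>{1..m}. cmod (w k - z k) \<le> e))" for s
    by (rule perturbed_poly_roots[OF A0 m sep])
  then obtain z where z: "\<And>s. (\<forall>\<zeta>. perturbed_poly m A (\<lambda>i. g i s) \<zeta> = A * (\<Prod>k=1..m. \<zeta> - z s k)) \<and>
    (\<forall>e. 0 \<le> e \<and> e < \<sigma> / 2 \<and> (\<forall>k\<in>{1..m}. cmod (perturbed_poly m A (\<lambda>i. g i s) (w k)) \<le> cmod A * e ^ m) \<longrightarrow>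
      (\<forall>k\<in>{1..m}. cmod (w k - z s k) \<le> e))"
    by metis
  define Z where "Z k s = z s k" for k s
  have fac: "perturbed_poly m A (\<lambda>i. g i s) \<zeta> = A * (\<Prod>k=1..m. \<zeta> - Z k s)" for s \<zeta>
    using z unfolding Z_def by blast
  \<comment> \<open>The lower bound A1 is left open: it becomes |A| in the proof of convergence and
    (m+1) \<delta> for the uniform statements.\<close>
  have fam: "root_family m A1 K' y1 l0 \<sigma> A g g' w Z" if "A1 \<le> cmod A" for A1
    unfolding root_family_def
  proof (intro conjI that)
    show "\<forall>i\<in>{1..<m}. \<forall>s\<in>{0<..<y1}. (g i has_vector_derivative g' i s) (at s) \<and> cmod (g i s) \<le> K' * s \<and> cmod (g' i s) \<le> K'"
      unfolding g_def g'_def K'_def by (intro ballI conjI zero_coeff_estimates[OF br y1(2) K])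
    show "\<forall>s\<in>{0<..<y1}. \<forall>e. 0 \<le> e \<and> e < \<sigma> / 2 \<and>
        (\<forall>k\<in>{1..m}. cmod (perturbed_poly m A (\<lambda>i. g i s) (w k)) \<le> cmod A * e ^ m) \<longrightarrow>
        (\<forall>k\<in>{1..m}. cmod (w k - Z k s) \<le> e)"
      using z unfolding Z_def by blast
  qed (use wr wl sep fac in \<open>blast+\<close>)
  define r where "r t = Re (a 1 t)" for t
  define y where "y t = 1 / (r t)\<^sup>2" for t
  define s where "s t = y t powr (1 / real m)" for t
  define u where "u t = r t powr (- ((real m + 2) / real m))" for t
  note time = solution_time[OF M R y1 q sol mb r0 br, folded r_def, folded y_def]
  note on = solution_on_branch[OF M R y1 q sol mb r0 br, folded r_def, folded y_def]
  have s_pos: "s t > 0" and s_pow: "s t ^ m = y t" if "t \<ge> 0" for t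
    using rescaling_exponents(1,2)[OF m on(1)[OF that], where s = "s t"] by (auto simp: s_def y_def)
  have u_pos: "u t > 0" if "t \<ge> 0" for t using on(1)[OF that] by (simp add: u_def)
  define \<omega> where "\<omega> k t = Z k (s t) * of_real (1 / u t)" for k t
  have resc: "rescaled_zero m a \<omega> k t = Z k (s t)" if t: "t \<ge> 0" for k t
  proof -
    have "rescaled_zero m a \<omega> k t = Z k (s t) * (of_real (1 / u t) * of_real (u t))"
      by (simp add: rescaled_zero_def \<omega>_def u_def r_def mult.assoc)
    also have "complex_of_real (1 / u t) * of_real (u t) = 1" using u_pos[OF t] by simp
    finally show ?thesis by simp
  qed
  have zeros: "zeros_of_derivative m a \<omega>"
    unfolding zeros_of_derivative_def
  proof (intro allI impI conjI)
    fix t :: real assume t: "t \<ge> 0"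
    have ct: "c (m+1) (y t) = cnj \<mu>" using br time(1)[OF t] unfolding moment_branch_def \<mu>_def by blast
    have am: "a (m+1) t = cnj \<mu> / of_real (r t) ^ (m+1)"
      using on(4)[OF t] m ct by simp
    show am0: "a (m+1) t \<noteq> 0" using am \<mu>0 on(1)[OF t] by simp
    fix \<zeta>
    have "deriv (\<lambda>z. polynomial_family m a z t) \<zeta>
        = of_real (r t) * perturbed_poly m A (\<lambda>i. g i (s t)) (\<zeta> * of_real (u t))"
      unfolding deriv_polynomial_family A_def g_def
      by (rule pderiv_rescaled[where a = "\<lambda>j. a j t", OF m on(1)[OF t]])
         (use on(2,4)[OF t] ct in \<open>auto simp: s_def u_def y_def\<close>)
    also have "\<dots> = of_real (r t) * (A * (\<Prod>k=1..m. \<zeta> * of_real (u t) - Z k (s t)))" by (simp only: fac)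
    also have "(\<Prod>k=1..m. \<zeta> * of_real (u t) - Z k (s t)) = (\<Prod>k=1..m. of_real (u t) * (\<zeta> - \<omega> k t))"
      using u_pos[OF t] by (intro prod.cong) (auto simp: \<omega>_def field_simps)
    also have "\<dots> = of_real (u t ^ m) * (\<Prod>k=1..m. \<zeta> - \<omega> k t)"
      by (simp only: prod.distrib prod_constant card_atLeastAtMost diff_Suc_Suc of_real_power diff_Suc_1 minus_nat.diff_0)
    also have "of_real (r t) * (A * (of_real (u t ^ m) * (\<Prod>k=1..m. \<zeta> - \<omega> k t)))
       = of_nat (m+1) * a (m+1) t * (\<Prod>k=1..m. \<zeta> - \<omega> k t) * of_real (r t * u t ^ m * r t ^ (m+1))"
      using on(1)[OF t] unfolding am A_def by (simp add: field_simps)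
    also have "r t * u t ^ m * r t ^ (m+1) = 1"
      using rescaling_exponents(3)[OF m on(1)[OF t], of "s t" "u t" m] by (simp add: s_def u_def y_def)
    finally show "deriv (\<lambda>z. polynomial_family m a z t) \<zeta> = of_nat (m+1) * a (m+1) t * (\<Prod>k=1..m. \<zeta> - \<omega> k t)"
      by simp
  qed
  have lim: "limit_zeros m a0 w"
    using w unfolding limit_zeros_def harmonic_moment_polynomial_map A_def \<mu>_def .
  have conv: "((\<lambda>t. cmod (rescaled_zero m a \<omega> k t - w k)) \<longlongrightarrow> 0) at_top" if k: "k \<in> {1..m}" for k
  proof (rule tendstoI)
    fix e :: real assume e: "e > 0"
    \<comment> \<open>The data are fixed here, so |A| itself can serve as the lower bound, and e is
      arbitrary.\<close>
    have "cmod A > 0" using A0 by simp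
    from roots_controlled_exists[OF m this K'0 y1(1) e \<sigma>0 \<kappa>0]
    obtain s3 where s3': "0 < s3" "roots_controlled m (cmod A) K' y1 l0 \<sigma> e \<kappa> s3" by blast
    then have s3: "0 < s3" "\<forall>s k. 0 < s \<and> s < s3 \<and> k \<in> {1..m} \<longrightarrow> cmod (Z k s - w k) < e"
      using fam[OF order.refl] unfolding roots_controlled_def by blast+
    have "\<forall>\<^sub>F t in at_top. y t < s3 ^ m"
      using time(3) s3(1) by (intro order_tendstoD(2)[of _ 0]) auto
    then show "\<forall>\<^sub>F t in at_top. dist (cmod (rescaled_zero m a \<omega> k t - w k)) 0 < e"
      using eventually_ge_at_top[of 0]
    proof eventually_elim
      case (elim t)
      have "s t ^ m < s3 ^ m" using elim s_pow by simp
      then have "s t < s3" using s3(1) by (intro power_less_imp_less_base[of "s t" m s3]) auto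
      then show ?case using s3(2) s_pos[OF elim(2)] k resc[OF elim(2)] by simp
    qed
  qed
  have main: "(\<forall>k\<in>{1..m}. continuous_on {0..} (\<omega> k)) \<and>
      (\<forall>k\<in>{1..m}. \<forall>t\<ge>0. cmod (rescaled_zero m a \<omega> k t - w k) < \<epsilon>) \<and>
      (\<forall>t\<ge>0. inj_on (\<lambda>k. \<omega> k t) {1..m}) \<and>
      (\<forall>k\<in>{1..m}. moves_away_from_origin (\<omega> k))"
    if H: "cmod (harmonic_moment m (polynomial_map m a0)) \<ge> \<delta>" "Re (a0 1) > 1 + 1 / s2 ^ m"
  proof -
    have "real (m+1) * \<delta> \<le> cmod A" using H(1) unfolding Acmod harmonic_moment_polynomial_map \<mu>_def
      by (intro mult_left_mono) auto
    note E = est[unfolded roots_controlled_def, rule_format, OF fam[OF this, unfolded \<sigma>_def]]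
    \<comment> \<open>Since y decreases, only t = 0 matters, where y = 1 / a_1(0)^2 < s2^m by the
      choice of the threshold.\<close>
    have s_lt: "s t < s2" if t: "t \<ge> 0" for t
    proof -
      have "r 0 = Re (a0 1)" using sol by (simp add: global_polynomial_solution_def r_def)
      then have r: "r 0 > 1 + 1 / s2 ^ m" using H(2) by simp
      have p: "1 / s2 ^ m > 0" using s2 by simp
      have "1 / s2 ^ m < r 0 * r 0" using r p mult_left_mono[of 1 "r 0" "r 0"] by linarith
      then have "1 < (r 0 * r 0) * s2 ^ m" using s2 by (simp only: pos_divide_less_eq zero_less_power)
      moreover have q: "0 < r 0 * r 0" using r p by (intro mult_pos_pos) linarith+
      ultimately have "y 0 < s2 ^ m"
        unfolding y_def power2_eq_square by (simp only: pos_divide_less_eq[OF q] mult.commute)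
      then have "s t ^ m < s2 ^ m" using time(4)[OF t] s_pow[OF t] by simp
      then show ?thesis using s2(1) by (intro power_less_imp_less_base[of "s t" m s2]) auto
    qed
    note E' = E[OF conjI[OF s_pos conjI[OF s_lt]]]
    have s_deriv: "\<exists>v<0. (s has_real_derivative v) (at t within {0..})" if t: "t \<ge> 0" for t
    proof -
      obtain v where v: "v < 0" "(y has_real_derivative v) (at t within {0..})" using time(2)[OF t] by blast
      have yp: "y t > 0" using time(1)[OF t] by simp
      have "((\<lambda>x. x powr (1 / real m)) has_real_derivative (1 / real m) * y t powr (1 / real m - 1)) (at (y t))"
        using yp by (rule has_real_derivative_powr)
      from DERIV_chain2[OF this v(2)]
      have "(s has_real_derivative (1 / real m) * y t powr (1 / real m - 1) * v) (at t within {0..})"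
        by (simp add: s_def[abs_def])
      moreover have "(1 / real m) * y t powr (1 / real m - 1) * v < 0"
        using m yp v(1) by (intro mult_pos_neg mult_pos_pos) auto
      ultimately show ?thesis by blast
    qed
    have s_cont: "continuous_on {0..} s"
      unfolding continuous_on_eq_continuous_within using s_deriv by (force intro: DERIV_continuous)
    \<comment> \<open>Both are powers of a_1: u has exponent -(m+2)/m and s has exponent -2/m, whose
      quotient is \<kappa>.\<close>
    have us: "u t = s t powr \<kappa>" if t: "t \<ge> 0" for t
    proof -
      have rp: "r t > 0" by (rule on(1)[OF t])
      have "r t = y t powr (- (1 / 2))"
        using rp by (simp add: y_def powr_minus powr_half_sqrt real_sqrt_divide)
      then show ?thesis using m by (simp add: u_def s_def powr_powr \<kappa>_def mult.commute)
    qed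
    have cont: "continuous_on {0..} (\<omega> k)" if k: "k \<in> {1..m}" for k
    proof -
      have "continuous_on {0<..<s2} (Z k)"
        using E k by (intro continuous_at_imp_continuous_on ballI) (force intro: has_vector_derivative_continuous)
      then have "continuous_on {0..} (\<lambda>t. Z k (s t))"
        by (rule continuous_on_compose2[OF _ s_cont]) (use s_pos s_lt in auto)
      moreover have "continuous_on {0..} (\<lambda>t. s t powr \<kappa>)"
        by (intro continuous_intros s_cont) (use s_pos in force)
      then have "continuous_on {0..} u"
        by (rule continuous_on_eq) (use us in auto)
      ultimately show ?thesis
        unfolding \<omega>_def by (intro continuous_intros) (use u_pos in force)+
    qed
    have close: "cmod (rescaled_zero m a \<omega> k t - w k) < \<epsilon>" if "k \<in> {1..m}" "t \<ge> 0" for k t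
      using E'[OF that(2) that(2) that(1)] resc[OF that(2)] by simp
    have inj: "inj_on (\<lambda>k. \<omega> k t) {1..m}" if t: "t \<ge> 0" for t
    proof (rule inj_onI, rule ccontr)
      fix k l assume kl: "k \<in> {1..m}" "l \<in> {1..m}" "\<omega> k t = \<omega> l t" "k \<noteq> l"
      have "Z k (s t) = Z l (s t)" using kl(3) u_pos[OF t] by (simp add: \<omega>_def)
      then have "cmod (w k - w l) \<le> cmod (Z k (s t) - w k) + cmod (Z l (s t) - w l)"
        using norm_triangle_ineq4[of "Z l (s t) - w l" "Z k (s t) - w k"] by simp
      also have "\<dots> \<le> \<sigma> / 8 + \<sigma> / 8"
        using E'[OF t t kl(1)] E'[OF t t kl(2)] unfolding \<sigma>_def by (intro add_mono) auto
      finally show False using sep[OF kl(1,2,4)] \<sigma>0 by simp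
    qed
    have away: "moves_away_from_origin (\<omega> k)" if k: "k \<in> {1..m}" for k
      unfolding moves_away_from_origin_def
    proof (intro allI impI)
      fix t :: real assume t: "t \<ge> 0"
      obtain D where D: "(Z k has_vector_derivative D) (at (s t))" "s t * cmod D < \<kappa> * cmod (Z k (s t))" "Z k (s t) \<noteq> 0"
        using E'[OF t t k] by blast
      obtain L where L: "((\<lambda>s. ln (cmod (Z k s)) - \<kappa> * ln s) has_real_derivative L) (at (s t))" "L < 0"
        using log_modulus_derivative[OF D(1) s_pos[OF t] D(3,2)] by blast
      obtain v where v: "v < 0" "(s has_real_derivative v) (at t within {0..})" using s_deriv[OF t] by blast
      have "((\<lambda>t. ln (cmod (Z k (s t))) - \<kappa> * ln (s t)) has_real_derivative L * v) (at t within {0..})"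
        by (rule DERIV_chain2[OF L(1) v(2)])
      then have "((\<lambda>t. ln (cmod (\<omega> k t))) has_real_derivative L * v) (at t within {0..})"
      proof (rule has_field_derivative_transform_within[OF _ zero_less_one])
        fix x :: real assume "x \<in> {0..}"
        then have x: "x \<ge> 0" by simp
        have Z0: "Z k (s x) \<noteq> 0" using E'[OF x x k] by blast
        have "cmod (\<omega> k x) = cmod (Z k (s x)) / u x"
          using u_pos[OF x] by (simp add: \<omega>_def norm_mult norm_divide)
        then show "ln (cmod (Z k (s x))) - \<kappa> * ln (s x) = ln (cmod (\<omega> k x))"
          using Z0 u_pos[OF x] s_pos[OF x] by (simp add: ln_div us[OF x] ln_powr)
      qed (use t in auto)
      \<comment> \<open>L < 0 is the slope of ln |\<omega>| in s, and v < 0 is the speed of s in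
        time.\<close>
      moreover have "L * v > 0" using L(2) v(1) by (rule mult_neg_neg)
      ultimately show "\<exists>d>0. ((\<lambda>s. ln (cmod (\<omega> k s))) has_real_derivative d) (at t within {0..})" by blast
    qed
    show ?thesis using cont close inj away by blast
  qed
  show ?thesis
    using zeros lim conv main by (intro exI[of _ \<omega>] exI[of _ w]) blast
qed

section \<open>Choice of the constants and conclusion\<close>

theorem theorem5p2:
  fixes m :: nat and M :: real
  assumes "m \<ge> 1" and "M > 0"
  shows "\<exists>\<epsilon>0>0. \<forall>\<epsilon>>0. \<exists>B>0. \<forall>\<delta>>0. \<exists>B'>0.
    \<forall>(q :: real \<Rightarrow> real) (a0 :: nat \<Rightarrow> complex).
      admissible_source q \<and> initial_data m a0 \<and> moment_bound m a0 M \<and> Re (a0 1) > B \<longrightarrow>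
      (\<exists>a. global_polynomial_solution q m a0 a) \<and>
      (\<forall>a. global_polynomial_solution q m a0 a \<longrightarrow>
        (\<exists>\<omega> \<omega>h. zeros_of_derivative m a \<omega> \<and> limit_zeros m a0 \<omega>h \<and>
          (\<forall>k\<in>{1..m}. ((\<lambda>t. cmod (rescaled_zero m a \<omega> k t - \<omega>h k)) \<longlongrightarrow> 0) at_top) \<and>
          (cmod (harmonic_moment m (polynomial_map m a0)) \<ge> \<delta> \<and> Re (a0 1) > B' \<longrightarrow>
            (\<forall>k\<in>{1..m}. continuous_on {0..} (\<omega> k)) \<and>
            (\<forall>k\<in>{1..m}. \<forall>t\<ge>0. cmod (rescaled_zero m a \<omega> k t - \<omega>h k) < \<epsilon>) \<and>
            (\<epsilon> < \<epsilon>0 \<longrightarrow> (\<forall>t\<ge>0. inj_on (\<lambda>k. \<omega> k t) {1..m})) \<and>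
            (\<forall>k\<in>{1..m}. moves_away_from_origin (\<omega> k)))))"
    (is "\<exists>\<epsilon>0>0. \<forall>\<epsilon>>0. \<exists>B>0. \<forall>\<delta>>0. \<exists>B'>0. ?P \<epsilon>0 \<epsilon> B \<delta> B'")
proof -
  obtain R where R: "a_priori_radius m M R" using a_priori_radius_exists[OF assms(2)] by blast
  obtain d where d: "0 < d" "d \<le> 1" "\<forall>u v :: complex. u ^ m = v ^ m \<and> u \<noteq> v \<longrightarrow> d * cmod u \<le> cmod (u - v)"
    using roots_separation[OF assms(1)] by metis
  obtain y1 K where y1: "0 < y1" "y1 \<le> 1" "y1 * (2 * M * (real (m+1))\<^sup>2) < 1" and K: "2 * M \<le> K" "0 < K"
    and ex: "\<And>\<mu>. (\<And>k. k \<in> {1..m} \<Longrightarrow> cmod (\<mu> k) \<le> M) \<Longrightarrow> \<exists>c c'. moment_branch m M y1 K \<mu> c c'"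
    using moment_branch_exists[OF assms] by metis
  \<comment> \<open>R makes the a priori bound applicable, 2 M covers the possible loss of a_1 while
    N_0 varies, and 1 / y1 brings 1 / a_1^2 below y1.\<close>
  define B where "B = R + 2 * M + 1 / y1"
  have "1 / y1 > 0" "R \<ge> 1" using y1 R by (simp_all add: a_priori_radius_def)
  then have B: "B > 0" using assms(2) unfolding B_def by linarith
  define l0 where "l0 = min 1 (1 / (real (m+1) * M))"
  define K' where "K' = 2 * (real (m+1))\<^sup>2 * K"
  have l0: "l0 > 0" using assms(2) by (simp add: l0_def)
  have \<sigma>: "d * l0 > 0" "d * l0 \<le> l0" using d l0 by (auto simp: mult_left_le_one_le)
  have K': "K' > 0" using K by (simp add: K'_def)
  have \<kappa>: "(real m + 2) / 2 > 0" by simp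
  show ?thesis
  \<comment> \<open>any \<open>\<epsilon>0\<close> will do: below \<open>s2\<close> the zeros are within an eighth of the separation of the limits\<close>
  proof (rule exI[of _ 1], intro conjI allI impI)
    fix \<epsilon> :: real assume \<epsilon>: "\<epsilon> > 0"
    show "\<exists>B>0. \<forall>\<delta>>0. \<exists>B'>0. ?P 1 \<epsilon> B \<delta> B'"
    proof (rule exI[of _ B], intro conjI B allI impI)
      fix \<delta> :: real assume \<delta>: "\<delta> > 0"
      \<comment> \<open>The lower bound for the leading coefficient (m+1) cnj M_m when |M_m| >=
        \<delta>.\<close>
      then have "real (m+1) * \<delta> > 0" by simp
      from roots_controlled_exists[OF assms(1) this K' y1(1) \<epsilon> \<sigma> \<kappa>]
      obtain s2 where s2: "0 < s2" "s2 \<le> y1"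
        and est: "roots_controlled m (real (m+1) * \<delta>) K' y1 l0 (d * l0) \<epsilon> ((real m + 2) / 2) s2"
        by blast
      \<comment> \<open>This threshold gives 1 / a_1(0)^2 < s2^m, that is, s < s2 already at time
        0.\<close>
      have B': "1 + 1 / s2 ^ m > 0" using s2 by (simp add: add_pos_pos)
      show "\<exists>B'>0. ?P 1 \<epsilon> B \<delta> B'"
      proof (rule exI[of _ "1 + 1 / s2 ^ m"], intro conjI B' allI impI; elim conjE)
        fix q :: "real \<Rightarrow> real" and a0 :: "nat \<Rightarrow> complex"
        assume q: "admissible_source q" and init: "initial_data m a0"
          and mb: "moment_bound m a0 M" and rB: "B < Re (a0 1)"
        obtain c c' where br: "moment_branch m M y1 K (\<lambda>k. moment m k a0) c c'"
          using ex[of "\<lambda>k. moment m k a0"] moment_boundD(1)[OF mb] by blast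
        note r0 = rB[unfolded B_def]
        show "\<exists>a. global_polynomial_solution q m a0 a"
          by (rule solution_exists[OF assms(2) R y1 q init mb r0 br])
        fix a assume sol: "global_polynomial_solution q m a0 a"
        from zero_motion[OF assms R y1(1,2) K q sol init mb r0 br d s2 \<delta> est[unfolded l0_def K'_def]]
        obtain \<omega> \<omega>h where Z: "zeros_of_derivative m a \<omega>" "limit_zeros m a0 \<omega>h"
          "\<forall>k\<in>{1..m}. ((\<lambda>t. cmod (rescaled_zero m a \<omega> k t - \<omega>h k)) \<longlongrightarrow> 0) at_top"
          "cmod (harmonic_moment m (polynomial_map m a0)) \<ge> \<delta> \<and> Re (a0 1) > 1 + 1 / s2 ^ m \<longrightarrow>
            (\<forall>k\<in>{1..m}. continuous_on {0..} (\<omega> k)) \<and>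
            (\<forall>k\<in>{1..m}. \<forall>t\<ge>0. cmod (rescaled_zero m a \<omega> k t - \<omega>h k) < \<epsilon>) \<and>
            (\<forall>t\<ge>0. inj_on (\<lambda>k. \<omega> k t) {1..m}) \<and>
            (\<forall>k\<in>{1..m}. moves_away_from_origin (\<omega> k))"
          by (elim exE conjE) (rule that)
        show "\<exists>\<omega> \<omega>h. zeros_of_derivative m a \<omega> \<and> limit_zeros m a0 \<omega>h \<and>
          (\<forall>k\<in>{1..m}. ((\<lambda>t. cmod (rescaled_zero m a \<omega> k t - \<omega>h k)) \<longlongrightarrow> 0) at_top) \<and>
          (cmod (harmonic_moment m (polynomial_map m a0)) \<ge> \<delta> \<and> Re (a0 1) > 1 + 1 / s2 ^ m \<longrightarrow>
            (\<forall>k\<in>{1..m}. continuous_on {0..} (\<omega> k)) \<and>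
            (\<forall>k\<in>{1..m}. \<forall>t\<ge>0. cmod (rescaled_zero m a \<omega> k t - \<omega>h k) < \<epsilon>) \<and>
            (\<epsilon> < 1 \<longrightarrow> (\<forall>t\<ge>0. inj_on (\<lambda>k. \<omega> k t) {1..m})) \<and>
            (\<forall>k\<in>{1..m}. moves_away_from_origin (\<omega> k)))"
        proof (intro exI[of _ \<omega>] exI[of _ \<omega>h] conjI Z(1,2,3) impI)
        qed (use Z(4) in \<open>blast+\<close>)
      qed
    qed
  qed simp
qed

end
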